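(* Let $H_1\curvearrowright Y_1$ and $H_2\curvearrowright Y_2$ be two finite group actions. Then the following are equivalent: \begin{enumerate} \item The condition $\Sigma(H_1\curvearrowright Y_1)$ elementary implies the condition $\Sigma(H_2\curvearrowright Y_2)$. \item $\Sigma(H_1\curvearrowright Y_1)$ implies $\Sigma(H_2\curvearrowright Y_2)$ for all clones. \item $\Sigma(H_1\curvearrowright Y_1)$ implies $\Sigma(H_2\curvearrowright Y_2)$ for the polymorphism minions of all (possibly infinite) structures. \item $\Sigma(H_1\curvearrowright Y_1)$ implies $\Sigma(H_2\curvearrowright Y_2)$ for the polymorphism minions of all finite structures. \item $\Sigma(H_1\curvearrowright Y_1)$ implies $\Sigma(H_2\curvearrowright Y_2)$ for the polymorphism minions of all structures $\mathbb S(G\curvearrowright X)$ with $G\curvearrowright X$ a finite group action. \item $\Sigma(H_1\curvearrowright Y_1)$ implies $\Sigma(H_2\curvearrowright Y_2)$ for the polymorphism minions of all structures $\mathbb S(G\curvearrowright\mathbb P(G))$ with $G$ a finite group with trivial Frattini subgroup. \item Every group in $\chi_\Sigma(H_2\curvearrowright Y_2)$ admits an epimorphism onto a group in $\chi_\Sigma(H_1\curvearrowright Y_1)$. \end{enumerate}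
   Context: All groups and all sets acted on are finite; a $G$-set may be empty. $\Phi(G)$ is the Frattini subgroup (intersection of all maximal subgroups; $\Phi(\{1\})=\{1\}$). $\mathbb P(G)$ is the $G$-set that is the disjoint union of all primitive $G$-sets up to isomorphism, i.e. of the coset actions $G/M$, with $M$ running over representatives of the conjugacy classes of maximal subgroups of $G$; $\mathbb P(\{1\})=\emptyset$. $\chi^r_\Sigma(H\curvearrowright Y)$ is the class of all groups isomorphic to $S/\Phi(S)$ where $S\le H$ is a subgroup such that $S\curvearrowright Y$ has no fixed point and there is no subgroup $S'\le H$ such that $S'\curvearrowright Y$ has no fixed point and there exists an epimorphism $S/\Phi(S)\to S'/\Phi(S')$ that is not an isomorphism. $\chi_\Sigma(H\curvearrowright Y)$ is the class of all finite groups with trivial Frattini subgroup that admit an epimorphism onto a group in $\chi^r_\Sigma(H\curvearrowright Y)$. Minions and clones. A minion $\mathcal C$ consists of a set $\mathcal C_N$ for each finite set $N$ (including $\emptyset$) and, for each map $\alpha\colon N\to M$, a map $\mathcal C_N\to\mathcal C_M$, $f\mapsto{}_\alpha f$, functorially in $\alpha$. It satisfies $\Sigma(H\curvearrowright Y)$ if there is $f\in\mathcal C_Y$ with ${}_hf=f$ for all $h\in H$. A clone is a minion with a compatible composition: elements $\pi^N_i\in\mathcal C_N$ ($i\in N$) and compositions $f\circ(g_i)_{i\in N}\in\mathcal C_M$ for $f\in\mathcal C_N$, $g_i\in\mathcal C_M$, satisfying the usual associativity and projection laws, with ${}_\alpha f=f\circ(\pi^M_{\alpha(i)})_{i\in N}$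 for $\alpha\colon N\to M$. Structures are relational, possibly with empty base set. The polymorphism minion $\mathrm{Pol}(\mathbb A)$ has $\mathrm{Pol}(\mathbb A)_N$ the set of homomorphisms $\mathbb A^N\to\mathbb A$ ($\mathbb A^\emptyset$ is a single point on which all relations hold) and ${}_\alpha f(t)=f(t\circ\alpha)$. $\mathbb S(G\curvearrowright X)$ is the structure with base set $X$ and binary relations $v_g=\{(x,g.x)\mid x\in X\}$, $g\in G$. "$\Sigma_1$ implies $\Sigma_2$ for" a class of minions means every minion in the class satisfying $\Sigma_1$ satisfies $\Sigma_2$. Elementary implication. The star product of $G\curvearrowright X$ and $H\curvearrowright Y$ is the action of $G\ltimes H^X$ on $X\times Y$ by $(g,(f_x)_x).(x,y)=(g.x,f_x.y)$ (multiplication $(g,f)(g',f')=(gg',(f_{g'.x}f'_x)_x)$). The first star power of $H\curvearrowright Y$ is itself, and the $(n+1)$-st star power, acting on $Y^{n+1}$, is the star product of the $n$-th star power with $H\curvearrowright Y$. $\Sigma(H\curvearrowright Y)$ elementary implies $\Sigma(H'\curvearrowright Y')$ if $H'\curvearrowright Y'$ can be obtained by: (1) taking a star power $W_n\curvearrowright Y^n$, $n\ge1$; (2) pulling it back along a (not necessarily injective) homomorphism $H_0\to W_n$; (3) replacing $H_0\curvearrowright Y^n$ by an action $H_0\curvearrowright Y'$ for which there is an $H_0$-equivariant map $Y^n\to Y'$; (4) passing to the induced action $H'\curvearrowright Y'$ along a surjective homomorphism $H_0\to H'$ whose kernel acts trivially on $Y'$. *)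

theory Defs
  imports "HOL-Algebra.Group_Action" "HOL-Algebra.Left_Coset"
begin

section \<open>Finite group actions\<close>

record ('g, 'x) gaction =
  grp :: "'g monoid"
  pts :: "'x set"
  act :: "'g \<Rightarrow> 'x \<Rightarrow> 'x"

text \<open>The library locale \<^locale>\<open>group_action\<close> asks for a homomorphism into the group
  of \<^emph>\<open>extensional\<close> bijections of the set, so each \<open>act A g\<close> is
  \<open>undefined\<close> outside \<open>pts A\<close>.  The set may be empty.\<close>

definition finite_action :: "('g, 'x) gaction \<Rightarrow> bool" where
  "finite_action A \<longleftrightarrow>
     group_action (grp A) (pts A) (act A) \<and> finite (carrier (grp A)) \<and> finite (pts A)"

definition equivariant :: "('g, 'x) gaction \<Rightarrow> ('g, 'y) gaction \<Rightarrow> ('x \<Rightarrow> 'y) \<Rightarrow> bool" where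
  "equivariant A B \<eta> \<longleftrightarrow> \<eta> \<in> pts A \<rightarrow> pts B \<and>
     (\<forall>g\<in>carrier (grp A). \<forall>x\<in>pts A. \<eta> (act A g x) = act B g (\<eta> x))"

definition pullback :: "'k monoid \<Rightarrow> ('k \<Rightarrow> 'g) \<Rightarrow> ('g, 'x) gaction \<Rightarrow> ('k, 'x) gaction" where
  "pullback K \<rho> A = \<lparr>grp = K, pts = pts A, act = (\<lambda>k. act A (\<rho> k))\<rparr>"

definition induced_along :: "('g \<Rightarrow> 'h) \<Rightarrow> ('g, 'x) gaction \<Rightarrow> ('h, 'x) gaction \<Rightarrow> bool" where
  "induced_along \<theta> A B \<longleftrightarrow> \<theta> \<in> epi (grp A) (grp B) \<and> pts B = pts A \<and>
     (\<forall>k\<in>kernel (grp A) (grp B) \<theta>. \<forall>x\<in>pts A. act A k x = x) \<and>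
     (\<forall>g\<in>carrier (grp A). \<forall>x\<in>pts A. act B (\<theta> g) x = act A g x)"

text \<open>Copy of an action along maps that are injective on the group and on the set.\<close>

definition transport ::
    "('g \<Rightarrow> 'h) \<Rightarrow> ('x \<Rightarrow> 'y) \<Rightarrow> ('g, 'x) gaction \<Rightarrow> ('h, 'y) gaction" where
  "transport \<phi> \<xi> A =
     (let \<phi>' = inv_into (carrier (grp A)) \<phi>; \<xi>' = inv_into (pts A) \<xi> in
     \<lparr>grp = \<lparr>carrier = \<phi> ` carrier (grp A),
             mult = (\<lambda>a b. \<phi> (\<phi>' a \<otimes>\<^bsub>grp A\<^esub> \<phi>' b)),
             one = \<phi> \<one>\<^bsub>grp A\<^esub>\<rparr>,
      pts = \<xi> ` pts A,
      act = (\<lambda>a. \<lambda>x\<in>\<xi> ` pts A. \<xi> (act A (\<phi>' a) (\<xi>' x)))\<rparr>)"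

section \<open>Star products and elementary implication\<close>

definition star_product ::
    "('g, 'x) gaction \<Rightarrow> ('h, 'y) gaction \<Rightarrow> ('g \<times> ('x \<Rightarrow> 'h), 'x \<times> 'y) gaction" where
  "star_product A B =
     \<lparr>grp = \<lparr>carrier = carrier (grp A) \<times> (pts A \<rightarrow>\<^sub>E carrier (grp B)),
             mult = (\<lambda>(g, f) (g', f').
               (g \<otimes>\<^bsub>grp A\<^esub> g', \<lambda>x\<in>pts A. f (act A g' x) \<otimes>\<^bsub>grp B\<^esub> f' x)),
             one = (\<one>\<^bsub>grp A\<^esub>, \<lambda>x\<in>pts A. \<one>\<^bsub>grp B\<^esub>)\<rparr>,
      pts = pts A \<times> pts B,
      act = (\<lambda>(g, f). \<lambda>(x, y)\<in>pts A \<times> pts B. (act A g x, act B (f x) y))\<rparr>"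

text \<open>The star powers live on types that grow with the exponent. To have one type for all
  of them, points of \<open>Y\<^sup>n\<close> are lists of length \<open>n\<close>, with \<open>(ys, y)\<close>
  encoded as \<open>ys @ [y]\<close>, and group elements are encoded by the datatype below.\<close>

datatype ('h, 'y) star_elem =
    Base 'h
  | Step "('h, 'y) star_elem" "'y list \<Rightarrow> 'h"

fun star_power :: "('h, 'y) gaction \<Rightarrow> nat \<Rightarrow> (('h, 'y) star_elem, 'y list) gaction" where
  "star_power A (Suc 0) = transport Base (\<lambda>y. [y]) A"
| "star_power A (Suc (Suc n)) =
     transport (\<lambda>(g, f). Step g f) (\<lambda>(ys, y). ys @ [y]) (star_product (star_power A (Suc n)) A)"

text \<open>The auxiliary group \<open>H0\<close> is finite, so it may be taken on a set of natural numbers.\<close>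

definition elementary_implies :: "('h, 'x) gaction \<Rightarrow> ('k, 'y) gaction \<Rightarrow> bool" where
  "elementary_implies A B \<longleftrightarrow>
     (\<exists>n \<ge> 1. \<exists>(H0 :: nat monoid) \<rho> (A' :: (nat, 'y) gaction) \<eta> \<theta>.
        group H0 \<and> finite (carrier H0) \<and>
        \<rho> \<in> hom H0 (grp (star_power A n)) \<and>
        finite_action A' \<and> grp A' = H0 \<and>
        equivariant (pullback H0 \<rho> (star_power A n)) A' \<eta> \<and>
        induced_along \<theta> A' B)"

section \<open>Frattini subgroup and primitive actions\<close>

definition maximal_subgroup :: "'g set \<Rightarrow> 'g monoid \<Rightarrow> bool" where
  "maximal_subgroup M G \<longleftrightarrow> subgroup M G \<and> M \<noteq> carrier G \<and>
     (\<forall>K. subgroup K G \<longrightarrow> M \<subseteq> K \<longrightarrow> K = M \<or> K = carrier G)"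

text \<open>Intersecting with the carrier matters only if there is no maximal subgroup,
  that is, for the trivial group among the finite ones.\<close>

definition frattini :: "'g monoid \<Rightarrow> 'g set" where
  "frattini G = carrier G \<inter> \<Inter>{M. maximal_subgroup M G}"

definition frattini_quotient :: "'g monoid \<Rightarrow> 'g set monoid" where
  "frattini_quotient G = G Mod frattini G"

definition conjugate_in :: "'g monoid \<Rightarrow> 'g set \<Rightarrow> 'g set \<Rightarrow> bool" where
  "conjugate_in G M N \<longleftrightarrow>
     (\<exists>g\<in>carrier G. N = (\<lambda>m. g \<otimes>\<^bsub>G\<^esub> m \<otimes>\<^bsub>G\<^esub> inv\<^bsub>G\<^esub> g) ` M)"

definition maximal_reps :: "'g monoid \<Rightarrow> 'g set set" where
  "maximal_reps G = (\<lambda>M. SOME N. conjugate_in G M N) ` {M. maximal_subgroup M G}"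

definition primitive_sum :: "'g monoid \<Rightarrow> ('g, 'g set \<times> 'g set) gaction" where
  "primitive_sum G =
     (let P = (SIGMA M : maximal_reps G. lcosets\<^bsub>G\<^esub> M) in
     \<lparr>grp = G, pts = P, act = (\<lambda>g. \<lambda>(M, C)\<in>P. (M, g <#\<^bsub>G\<^esub> C))\<rparr>)"

section \<open>The classes of groups attached to an action\<close>

definition subgroup_without_fixpoint :: "('h, 'y) gaction \<Rightarrow> 'h set \<Rightarrow> bool" where
  "subgroup_without_fixpoint A S \<longleftrightarrow> subgroup S (grp A) \<and>
     \<not> (\<exists>y\<in>pts A. \<forall>s\<in>S. act A s y = y)"

definition sub_frattini_quotient :: "('h, 'y) gaction \<Rightarrow> 'h set \<Rightarrow> 'h set monoid" where
  "sub_frattini_quotient A S = frattini_quotient ((grp A)\<lparr>carrier := S\<rparr>)"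

definition chi_reduced :: "('h, 'y) gaction \<Rightarrow> 'k monoid \<Rightarrow> bool" where
  "chi_reduced A K \<longleftrightarrow> group K \<and>
     (\<exists>S. subgroup_without_fixpoint A S \<and>
        \<not> (\<exists>S' e. subgroup_without_fixpoint A S' \<and>
             e \<in> epi (sub_frattini_quotient A S) (sub_frattini_quotient A S') \<and>
             e \<notin> iso (sub_frattini_quotient A S) (sub_frattini_quotient A S')) \<and>
        K \<cong> sub_frattini_quotient A S)"

text \<open>Every group satisfying \<^const>\<open>chi_reduced\<close> has an isomorphic copy of type
  \<open>'h set monoid\<close>, so nothing is lost by the type of \<open>L\<close>.\<close>

definition chi :: "('h, 'y) gaction \<Rightarrow> 'k monoid \<Rightarrow> bool" where
  "chi A K \<longleftrightarrow> group K \<and> finite (carrier K) \<and> frattini K = {\<one>\<^bsub>K\<^esub>} \<and>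
     (\<exists>(L :: 'h set monoid) e. chi_reduced A L \<and> e \<in> epi K L)"

section \<open>Minions and clones\<close>

text \<open>Finite index sets are the finite sets of elements of a type \<open>'n\<close>. A map
  \<open>N \<rightarrow> M\<close> is an extensional function, and \<open>reindex C N M \<alpha> f\<close> is
  the image of \<open>f\<close> under the map of minion components given by \<open>\<alpha>\<close>.\<close>

record ('n, 'c) minion =
  elems :: "'n set \<Rightarrow> 'c set"
  reindex :: "'n set \<Rightarrow> 'n set \<Rightarrow> ('n \<Rightarrow> 'n) \<Rightarrow> 'c \<Rightarrow> 'c"

definition is_minion :: "('n, 'c, 'z) minion_scheme \<Rightarrow> bool" where
  "is_minion C \<longleftrightarrow>
     (\<forall>N M \<alpha>. finite N \<longrightarrow> finite M \<longrightarrow> \<alpha> \<in> N \<rightarrow>\<^sub>E M \<longrightarrow>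
        reindex C N M \<alpha> \<in> elems C N \<rightarrow> elems C M) \<and>
     (\<forall>N f. finite N \<longrightarrow> f \<in> elems C N \<longrightarrow> reindex C N N (\<lambda>i\<in>N. i) f = f) \<and>
     (\<forall>N M L \<alpha> \<beta> f. finite N \<longrightarrow> finite M \<longrightarrow> finite L \<longrightarrow>
        \<alpha> \<in> N \<rightarrow>\<^sub>E M \<longrightarrow> \<beta> \<in> M \<rightarrow>\<^sub>E L \<longrightarrow> f \<in> elems C N \<longrightarrow>
        reindex C N L (compose N \<beta> \<alpha>) f = reindex C M L \<beta> (reindex C N M \<alpha> f))"

definition satisfies :: "('n, 'c, 'z) minion_scheme \<Rightarrow> ('h, 'n) gaction \<Rightarrow> bool" where
  "satisfies C A \<longleftrightarrow>
     (\<exists>f\<in>elems C (pts A). \<forall>h\<in>carrier (grp A). reindex C (pts A) (pts A) (act A h) f = f)"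

record ('n, 'c) clone = "('n, 'c) minion" +
  proj :: "'n set \<Rightarrow> 'n \<Rightarrow> 'c"
  comp :: "'n set \<Rightarrow> 'n set \<Rightarrow> 'c \<Rightarrow> ('n \<Rightarrow> 'c) \<Rightarrow> 'c"

definition is_clone :: "('n, 'c, 'z) clone_scheme \<Rightarrow> bool" where
  "is_clone C \<longleftrightarrow> is_minion C \<and>
     (\<forall>N. finite N \<longrightarrow> proj C N \<in> N \<rightarrow> elems C N) \<and>
     (\<forall>N M f g. finite N \<longrightarrow> finite M \<longrightarrow> f \<in> elems C N \<longrightarrow> g \<in> N \<rightarrow>\<^sub>E elems C M \<longrightarrow>
        comp C N M f g \<in> elems C M) \<and>
     (\<forall>N M L f g h. finite N \<longrightarrow> finite M \<longrightarrow> finite L \<longrightarrow>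
        f \<in> elems C N \<longrightarrow> g \<in> N \<rightarrow>\<^sub>E elems C M \<longrightarrow> h \<in> M \<rightarrow>\<^sub>E elems C L \<longrightarrow>
        comp C M L (comp C N M f g) h = comp C N L f (\<lambda>i\<in>N. comp C M L (g i) h)) \<and>
     (\<forall>N M i g. finite N \<longrightarrow> finite M \<longrightarrow> i \<in> N \<longrightarrow> g \<in> N \<rightarrow>\<^sub>E elems C M \<longrightarrow>
        comp C N M (proj C N i) g = g i) \<and>
     (\<forall>N f. finite N \<longrightarrow> f \<in> elems C N \<longrightarrow> comp C N N f (\<lambda>i\<in>N. proj C N i) = f) \<and>
     (\<forall>N M \<alpha> f. finite N \<longrightarrow> finite M \<longrightarrow> \<alpha> \<in> N \<rightarrow>\<^sub>E M \<longrightarrow> f \<in> elems C N \<longrightarrow>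
        reindex C N M \<alpha> f = comp C N M f (\<lambda>i\<in>N. proj C M (\<alpha> i)))"

section \<open>Relational structures and polymorphisms\<close>

record ('s, 'a) relstr =
  base :: "'a set"
  symbols :: "'s set"
  arity :: "'s \<Rightarrow> nat"
  rels :: "'s \<Rightarrow> 'a list set"

definition is_relstr :: "('s, 'a) relstr \<Rightarrow> bool" where
  "is_relstr A \<longleftrightarrow>
     (\<forall>s\<in>symbols A. rels A s \<subseteq> {t. length t = arity A s \<and> set t \<subseteq> base A})"

definition power_str :: "('s, 'a) relstr \<Rightarrow> 'n set \<Rightarrow> ('s, 'n \<Rightarrow> 'a) relstr" where
  "power_str A N =
     \<lparr>base = N \<rightarrow>\<^sub>E base A, symbols = symbols A, arity = arity A,
      rels = (\<lambda>s. {ts. length ts = arity A s \<and> set ts \<subseteq> N \<rightarrow>\<^sub>E base A \<and>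
                       (\<forall>i\<in>N. map (\<lambda>t. t i) ts \<in> rels A s)})\<rparr>"

text \<open>Meaningful only if both structures have the same symbols and arities, as a structure
  and its powers do.\<close>

definition homs :: "('s, 'a) relstr \<Rightarrow> ('s, 'b) relstr \<Rightarrow> ('a \<Rightarrow> 'b) set" where
  "homs A B = {f \<in> base A \<rightarrow>\<^sub>E base B. \<forall>s\<in>symbols A. \<forall>ts\<in>rels A s. map f ts \<in> rels B s}"

definition Pol :: "('s, 'a) relstr \<Rightarrow> ('n, ('n \<Rightarrow> 'a) \<Rightarrow> 'a) minion" where
  "Pol A =
     \<lparr>elems = (\<lambda>N. homs (power_str A N) A),
      reindex = (\<lambda>N M \<alpha> f. \<lambda>t\<in>M \<rightarrow>\<^sub>E base A. f (compose N t \<alpha>))\<rparr>"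

definition action_str :: "('g, 'x) gaction \<Rightarrow> ('g, 'x) relstr" where
  "action_str A =
     \<lparr>base = pts A, symbols = carrier (grp A), arity = (\<lambda>_. 2),
      rels = (\<lambda>g. {[x, act A g x] | x. x \<in> pts A})\<rparr>"

end

theory Submission
  imports Defs
begin

text \<open>
  Call a subgroup of a group acting on a set fixed-point free if it has no fixed point. All
  conditions are shown equivalent to the following criterion, \<open>frattini_covers A1 A2\<close>: for each
  fixed-point free subgroup \<open>S\<close> of the second action there is a fixed-point free subgroup \<open>T\<close> of
  the first one such that the Frattini quotient of \<open>S\<close> maps onto the Frattini quotient of \<open>T\<close>.

  \<^emph>\<open>The criterion from the other conditions.\<close> The polymorphisms of the structure of an action
  \<open>G\<close> on \<open>X\<close> are the \<open>G\<close>-equivariant maps from tuples to \<open>X\<close>. As an equivariant map exists as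
  soon as every stabilizer has a fixed point in the target, the condition of \<open>H\<close> acting on \<open>Y\<close>
  fails iff for some \<open>t : Y \<rightarrow> X\<close> the elements \<open>g\<close> with \<open>g t = t \<circ> h\<close> for some \<open>h \<in> H\<close> have no
  common fixed point. If \<open>X\<close> is the sum of the primitive actions, a subgroup of \<open>G\<close> without fixed
  point is all of \<open>G\<close>. From this, \<open>satisfies_primitive_sum_iff\<close> concludes that the condition
  fails iff \<open>G\<close> maps onto the Frattini quotient of a fixed-point free subgroup of \<open>H\<close>. So if
  the criterion fails at \<open>S\<close>, the Frattini quotient of \<open>S\<close>, which has trivial Frattini subgroup,
  gives a structure (and a clone, as finite groups, actions, structures and clones with finite
  components can be copied into any infinite types) that separates the two conditions. By the
  same lemma the class \<open>chi\<close> consists of the groups with trivial Frattini subgroup for which the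
  condition fails on the sum of the primitive actions.

  \<^emph>\<open>Elementary implication from the criterion.\<close> Consider a group that acts on \<open>Y\<^sub>1\<^sup>n\<close> through the
  \<open>n\<close>-th star power and maps onto \<open>H\<^sub>2\<close>. An equivariant map to \<open>Y\<^sub>2\<close> exists if the image in \<open>H\<^sub>2\<close>
  of each stabilizer has a fixed point. For a bad stabilizer, with fixed-point free image \<open>S\<close>, the
  criterion gives a subgroup \<open>R\<close> of \<open>S \<times> H\<^sub>1\<close>, the fibre product of \<open>S\<close> and \<open>T\<close>, that maps onto
  \<open>S\<close>, while the part of \<open>R\<close> that fixes any given point of \<open>Y\<^sub>1\<close> does not. Inducing \<open>R\<close> from the
  stabilizer to the whole group yields an action on \<open>Y\<^sub>1\<^sup>n\<^sup>+\<^sup>1\<close> in which the bad images are strictly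
  smaller (\<open>partial_cover_star_product\<close>), so none is left when \<open>n\<close> exceeds the order of \<open>H\<^sub>2\<close>.

  \<^emph>\<open>Soundness of elementary implication.\<close> In a clone, operations that witness two conditions
  compose to one that witnesses the condition of the star product, and operations can be moved
  along equivariant maps.
\<close>

section \<open>Actions and equivariant maps\<close>

text \<open>The action laws alone, with no condition on the values outside the set.\<close>

definition acts_on :: "('k, 'z) monoid_scheme \<Rightarrow> ('k \<Rightarrow> 'x \<Rightarrow> 'x) \<Rightarrow> 'x set \<Rightarrow> bool" where
  "acts_on K a X \<longleftrightarrow>
     (\<forall>k\<in>carrier K. \<forall>x\<in>X. a k x \<in> X) \<and> (\<forall>x\<in>X. a \<one>\<^bsub>K\<^esub> x = x) \<and>
     (\<forall>k\<in>carrier K. \<forall>l\<in>carrier K. \<forall>x\<in>X. a (k \<otimes>\<^bsub>K\<^esub> l) x = a k (a l x))"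

lemma acts_onD:
  assumes "acts_on K a X"
  shows "k \<in> carrier K \<Longrightarrow> x \<in> X \<Longrightarrow> a k x \<in> X"
    and "x \<in> X \<Longrightarrow> a \<one>\<^bsub>K\<^esub> x = x"
    and "k \<in> carrier K \<Longrightarrow> l \<in> carrier K \<Longrightarrow> x \<in> X \<Longrightarrow> a (k \<otimes>\<^bsub>K\<^esub> l) x = a k (a l x)"
  using assms unfolding acts_on_def by auto

lemma acts_on_inv:
  fixes K (structure)
  assumes "group K" "acts_on K a X" "k \<in> carrier K" "x \<in> X"
  shows "a (inv\<^bsub>K\<^esub> k) (a k x) = x" "a k (a (inv\<^bsub>K\<^esub> k) x) = x"
proof -
  interpret group K by fact
  show "a (inv k) (a k x) = x"
    using acts_onD[OF assms(2)] assms(3,4) by (metis inv_closed l_inv)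
  show "a k (a (inv k) x) = x"
    using acts_onD[OF assms(2)] assms(3,4) by (metis inv_closed r_inv)
qed

lemma acts_on_inv_eq_iff:
  assumes "group K" "acts_on K a X" "k \<in> carrier K" "x \<in> X" "y \<in> X"
  shows "a (inv\<^bsub>K\<^esub> k) x = y \<longleftrightarrow> x = a k y"
  using acts_on_inv[OF assms(1-3)] assms(4,5) by metis

lemma group_actionI:
  fixes K (structure)
  assumes "group K" "acts_on K a X" "\<And>k. k \<in> carrier K \<Longrightarrow> a k \<in> extensional X"
  shows "group_action K X a"
proof -
  interpret group K by fact
  have bij: "a k \<in> Bij X" if "k \<in> carrier K" for k
  proof -
    have "bij_betw (a k) X X"
      by (rule bij_betw_byWitness[where f' = "a (inv k)"])
        (use acts_on_inv[OF assms(1,2) that] acts_onD(1)[OF assms(2)] that in auto)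
    then show ?thesis using assms(3)[OF that] by (simp add: Bij_def)
  qed
  have "a \<in> hom K (BijGroup X)"
  proof (rule homI)
    fix k l assume kl: "k \<in> carrier K" "l \<in> carrier K"
    have "a (k \<otimes> l) = compose X (a k) (a l)"
      by (rule extensionalityI[of _ X])
        (use assms(3) kl acts_onD(3)[OF assms(2)] in \<open>auto simp: compose_def\<close>)
    then show "a (k \<otimes> l) = a k \<otimes>\<^bsub>BijGroup X\<^esub> a l"
      using bij kl by (simp add: BijGroup_def)
  qed (use bij in \<open>simp add: BijGroup_def\<close>)
  then show ?thesis
    by (simp add: group_action_def group_hom_def group_hom_axioms_def assms(1) group_BijGroup)
qed

lemma finite_actionI:
  assumes "group (grp A)" "acts_on (grp A) (act A) (pts A)"
    "\<And>k. k \<in> carrier (grp A) \<Longrightarrow> act A k \<in> extensional (pts A)"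
    "finite (carrier (grp A))" "finite (pts A)"
  shows "finite_action A"
  using group_actionI[OF assms(1-3)] assms(4,5) by (simp add: finite_action_def)

lemma finite_actionD:
  assumes "finite_action A"
  shows "group (grp A)" "acts_on (grp A) (act A) (pts A)"
    "k \<in> carrier (grp A) \<Longrightarrow> act A k \<in> pts A \<rightarrow>\<^sub>E pts A"
    "finite (carrier (grp A))" "finite (pts A)"
proof -
  interpret group_action "grp A" "pts A" "act A" using assms by (simp add: finite_action_def)
  show "group (grp A)" using group_hom group_hom.axioms(1) by blast
  show "acts_on (grp A) (act A) (pts A)"
    unfolding acts_on_def
    by (simp add: element_image[OF _ _ refl] composition_rule id_eq_one[symmetric])
  show "act A k \<in> pts A \<rightarrow>\<^sub>E pts A" if "k \<in> carrier (grp A)"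
    using bij_prop0[OF that] by (simp add: PiE_def Bij_imp_funcset Bij_imp_extensional)
qed (use assms in \<open>auto simp: finite_action_def\<close>)

lemma acts_on_hom:
  assumes "acts_on G a X" "\<rho> \<in> hom K G" "group K" "group G"
  shows "acts_on K (\<lambda>k. a (\<rho> k)) X"
proof -
  have "\<rho> \<one>\<^bsub>K\<^esub> = \<one>\<^bsub>G\<^esub>" using hom_one[OF assms(2,3,4)] .
  then show ?thesis
    using assms(1,2) unfolding acts_on_def by (auto simp: hom_def Pi_iff)
qed

lemma finite_action_pullback:
  assumes "finite_action A" "group K" "finite (carrier K)" "\<rho> \<in> hom K (grp A)"
  shows "finite_action (pullback K \<rho> A)"
proof (rule finite_actionI)
  show "acts_on (grp (pullback K \<rho> A)) (act (pullback K \<rho> A)) (pts (pullback K \<rho> A))"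
    using acts_on_hom[OF finite_actionD(2)[OF assms(1)] assms(4) assms(2)
        finite_actionD(1)[OF assms(1)]]
    by (simp add: pullback_def)
  fix k assume "k \<in> carrier (grp (pullback K \<rho> A))"
  then have "\<rho> k \<in> carrier (grp A)" using assms(4) by (auto simp: pullback_def hom_def)
  then show "act (pullback K \<rho> A) k \<in> extensional (pts (pullback K \<rho> A))"
    using finite_actionD(3)[OF assms(1)] by (simp add: pullback_def PiE_def)
qed (use assms finite_actionD(5)[OF assms(1)] in \<open>simp_all add: pullback_def\<close>)

lemma acts_on_subgroup:
  assumes "acts_on G a X" "subgroup H G"
  shows "acts_on (G\<lparr>carrier := H\<rparr>) a X"
  using assms subgroup.subset[OF assms(2)] unfolding acts_on_def by (simp add: subset_iff)

text \<open>Each point \<open>x\<close> is moved from the representative \<open>rep x\<close> of its orbit by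
  \<open>\<tau> x\<close>. The last property says that \<open>\<tau>\<close> turns every group element into elements
  of the stabilizer of the representative.\<close>

lemma orbit_transversal:
  fixes K (structure)
  assumes "group K" "acts_on K a X"
  obtains rep \<tau> where
    "\<And>x. x \<in> X \<Longrightarrow> rep x \<in> X" "\<And>x. x \<in> X \<Longrightarrow> \<tau> x \<in> carrier K"
    "\<And>x. x \<in> X \<Longrightarrow> a (\<tau> x) (rep x) = x"
    "\<And>k x. k \<in> carrier K \<Longrightarrow> x \<in> X \<Longrightarrow> rep (a k x) = rep x"
    "\<And>k x. k \<in> carrier K \<Longrightarrow> x \<in> X \<Longrightarrow>
      a (inv (\<tau> (a k x)) \<otimes> (k \<otimes> \<tau> x)) (rep x) = rep x"
proof -
  interpret group K by fact
  note D = acts_onD[OF assms(2)] and I = acts_on_inv[OF assms(1,2)]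
  define orb where "orb x = (\<lambda>k. a k x) ` carrier K" for x
  define rep where "rep x = (SOME z. z \<in> orb x)" for x
  define \<tau> where "\<tau> x = (SOME k. k \<in> carrier K \<and> a k (rep x) = x)" for x
  have orb_eq: "orb (a k x) = orb x" if k: "k \<in> carrier K" and x: "x \<in> X" for k x
  proof
    show "orb (a k x) \<subseteq> orb x"
    proof
      fix z assume "z \<in> orb (a k x)"
      then obtain l where "l \<in> carrier K" "z = a l (a k x)" by (auto simp: orb_def)
      then have "l \<otimes> k \<in> carrier K" "z = a (l \<otimes> k) x" using k x D(3) by auto
      then show "z \<in> orb x" by (auto simp: orb_def)
    qed
    show "orb x \<subseteq> orb (a k x)"
    proof
      fix z assume "z \<in> orb x"
      then obtain l where l: "l \<in> carrier K" "z = a l x" by (auto simp: orb_def)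
      have "z = a (l \<otimes> inv k) (a k x)"
        using l k x D(1) D(3)[of l "inv k" "a k x"] I(1) by simp
      then show "z \<in> orb (a k x)" using l k by (auto simp: orb_def)
    qed
  qed
  have rep_orb: "rep x \<in> orb x" if "x \<in> X" for x
    unfolding rep_def by (rule someI[of _ x]) (use that D(2)[of x] in \<open>simp add: orb_def image_iff, metis one_closed\<close>)
  have rep_in: "rep x \<in> X" if "x \<in> X" for x
    using rep_orb[OF that] that D(1) by (auto simp: orb_def)
  have \<tau>: "\<tau> x \<in> carrier K \<and> a (\<tau> x) (rep x) = x" if x: "x \<in> X" for x
  proof -
    obtain k where "k \<in> carrier K" "rep x = a k x" using rep_orb[OF x] by (auto simp: orb_def)
    then have "inv k \<in> carrier K \<and> a (inv k) (rep x) = x" using I(1) x by simp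
    then show ?thesis unfolding \<tau>_def by (rule someI)
  qed
  show ?thesis
  proof (rule that[of rep \<tau>])
    fix k x assume k: "k \<in> carrier K" and x: "x \<in> X"
    show rep_eq: "rep (a k x) = rep x" unfolding rep_def orb_eq[OF k x] ..
    have kx: "a k x \<in> X" using k x D(1) by blast
    have "a (inv (\<tau> (a k x)) \<otimes> (k \<otimes> \<tau> x)) (rep x) = a (inv (\<tau> (a k x))) (a k x)"
      using k x kx \<tau> rep_in D(3) by simp
    also have "\<dots> = rep x" using I(1)[of "\<tau> (a k x)" "rep x"] \<tau>[OF kx] rep_in[OF x] rep_eq by simp
    finally show "a (inv (\<tau> (a k x)) \<otimes> (k \<otimes> \<tau> x)) (rep x) = rep x" .
  qed (use rep_in \<tau> in blast)+
qed

text \<open>Choose an image for the representative of each orbit and move it around.\<close>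

lemma equivariant_map_exists:
  fixes K (structure)
  assumes K: "group K" and a: "acts_on K a X" and b: "acts_on K b Y"
    and fixp: "\<And>x. x \<in> X \<Longrightarrow> \<exists>y\<in>Y. \<forall>k\<in>carrier K. a k x = x \<longrightarrow> b k y = y"
  obtains \<eta> where "\<And>x. x \<in> X \<Longrightarrow> \<eta> x \<in> Y"
    "\<And>k x. k \<in> carrier K \<Longrightarrow> x \<in> X \<Longrightarrow> \<eta> (a k x) = b k (\<eta> x)"
proof -
  interpret group K by fact
  note Da = acts_onD[OF a] and Db = acts_onD[OF b]
  obtain rep \<tau> where rep: "\<And>x. x \<in> X \<Longrightarrow> rep x \<in> X" and \<tau>: "\<And>x. x \<in> X \<Longrightarrow> \<tau> x \<in> carrier K"
    and mv: "\<And>x. x \<in> X \<Longrightarrow> a (\<tau> x) (rep x) = x"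
    and inva: "\<And>k x. k \<in> carrier K \<Longrightarrow> x \<in> X \<Longrightarrow> rep (a k x) = rep x"
    and stab: "\<And>k x. k \<in> carrier K \<Longrightarrow> x \<in> X \<Longrightarrow>
      a (inv (\<tau> (a k x)) \<otimes> (k \<otimes> \<tau> x)) (rep x) = rep x"
    by (rule orbit_transversal[OF K a]) (rule that)
  have "\<exists>y. \<forall>x\<in>X. y x \<in> Y \<and> (\<forall>k\<in>carrier K. a k x = x \<longrightarrow> b k (y x) = y x)"
    by (rule bchoice) (use fixp in blast)
  then obtain y where y: "\<And>x. x \<in> X \<Longrightarrow> y x \<in> Y"
    "\<And>x k. x \<in> X \<Longrightarrow> k \<in> carrier K \<Longrightarrow> a k x = x \<Longrightarrow> b k (y x) = y x"
    by blast
  define \<eta> where "\<eta> x = b (\<tau> x) (y (rep x))" for x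
  show ?thesis
  proof (rule that[of \<eta>])
    show "\<eta> x \<in> Y" if "x \<in> X" for x
      using that rep \<tau> y(1) Db(1) by (simp add: \<eta>_def)
    fix k x assume k: "k \<in> carrier K" and x: "x \<in> X"
    let ?l = "inv (\<tau> (a k x)) \<otimes> (k \<otimes> \<tau> x)"
    have kx: "a k x \<in> X" using k x Da(1) by blast
    have l: "?l \<in> carrier K" using k x kx \<tau> by simp
    have "b ?l (y (rep x)) = y (rep x)" using y(2) l rep x stab[OF k x] by blast
    then have "b (\<tau> (a k x)) (y (rep x)) = b (\<tau> (a k x) \<otimes> ?l) (y (rep x))"
      using Db(3) \<tau>[OF kx] l y(1) rep x by simp
    also have "\<tau> (a k x) \<otimes> ?l = k \<otimes> \<tau> x"
      using \<tau> kx k x by (simp add: inv_solve_left m_assoc[symmetric])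
    also have "b (k \<otimes> \<tau> x) (y (rep x)) = b k (b (\<tau> x) (y (rep x)))"
      using Db(3) k \<tau> x y(1) rep by simp
    finally show "\<eta> (a k x) = b k (\<eta> x)"
      by (simp add: \<eta>_def inva[OF k x])
  qed
qed

section \<open>Maximal subgroups and the Frattini quotient\<close>

lemma proper_subgroup_le_maximal:
  assumes "finite (carrier G)" "subgroup U G" "U \<noteq> carrier G"
  obtains M where "maximal_subgroup M G" "U \<subseteq> M"
proof -
  let ?P = "{K. subgroup K G \<and> K \<noteq> carrier G}"
  have "finite ?P"
    by (rule finite_subset[of _ "Pow (carrier G)"])
      (use assms(1) in \<open>auto dest: subgroup.subset\<close>)
  then obtain M where "M \<in> ?P" "U \<subseteq> M" "\<forall>K\<in>?P. M \<subseteq> K \<longrightarrow> M = K"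
    using finite_has_maximal2[of ?P U] assms(2,3) by auto
  then have "maximal_subgroup M G" unfolding maximal_subgroup_def by blast
  then show thesis using that \<open>U \<subseteq> M\<close> by blast
qed

lemma subgroup_preimage:
  assumes "group G" "group K" "\<pi> \<in> hom G K" "subgroup L K"
  shows "subgroup {g \<in> carrier G. \<pi> g \<in> L} G"
proof -
  interpret group_hom G K \<pi>
    using assms by (simp add: group_hom_def group_hom_axioms_def)
  show ?thesis
    by (rule subgroup.intro)
      (use assms(4) in \<open>auto simp: subgroup.m_closed subgroup.one_closed subgroup.m_inv_closed\<close>)
qed

lemma maximal_subgroup_epi_image:
  assumes G: "group G" and K: "group K" and \<pi>: "\<pi> \<in> epi G K"
    and M: "maximal_subgroup M G" and ker: "kernel G K \<pi> \<subseteq> M"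
  shows "maximal_subgroup (\<pi> ` M) K"
    and "\<And>g. g \<in> carrier G \<Longrightarrow> \<pi> g \<in> \<pi> ` M \<Longrightarrow> g \<in> M"
proof -
  have hom: "\<pi> \<in> hom G K" and surj: "\<pi> ` carrier G = carrier K"
    using \<pi> by (auto simp: epi_def)
  interpret group_hom G K \<pi>
    using G K hom by (simp add: group_hom_def group_hom_axioms_def)
  have sM: "subgroup M G" using M by (simp add: maximal_subgroup_def)
  then interpret M: subgroup M G .
  show pull: "g \<in> M" if g: "g \<in> carrier G" and m: "\<pi> g \<in> \<pi> ` M" for g
  proof -
    obtain m where m: "m \<in> M" "\<pi> g = \<pi> m" using m by auto
    then have "g \<otimes>\<^bsub>G\<^esub> inv\<^bsub>G\<^esub> m \<in> kernel G K \<pi>" using g by (simp add: kernel_def)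
    then have "(g \<otimes>\<^bsub>G\<^esub> inv\<^bsub>G\<^esub> m) \<otimes>\<^bsub>G\<^esub> m \<in> M" using ker m(1) M.m_closed by blast
    then show ?thesis using g m(1) by (simp add: G.m_assoc)
  qed
  show "maximal_subgroup (\<pi> ` M) K"
    unfolding maximal_subgroup_def
  proof (intro conjI allI impI)
    show "subgroup (\<pi> ` M) K" using subgroup_img_is_subgroup[OF sM] .
    obtain g where "g \<in> carrier G" "g \<notin> M"
      using M M.subset by (auto simp: maximal_subgroup_def)
    then show "\<pi> ` M \<noteq> carrier K" using pull by auto
    fix L assume L: "subgroup L K" "\<pi> ` M \<subseteq> L"
    let ?L = "{g \<in> carrier G. \<pi> g \<in> L}"
    have "M \<subseteq> ?L" using L(2) M.subset by auto
    then have "?L = M \<or> ?L = carrier G"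
      using M subgroup_preimage[OF G K hom L(1)] by (auto simp: maximal_subgroup_def)
    moreover have "L = \<pi> ` ?L"
      using subgroup.subset[OF L(1)] unfolding surj[symmetric] by auto
    ultimately show "L = \<pi> ` M \<or> L = carrier K" using surj by auto
  qed
qed

lemma conjugation_epi:
  fixes G (structure)
  assumes "group G" "g \<in> carrier G"
  shows "(\<lambda>m. g \<otimes>\<^bsub>G\<^esub> m \<otimes>\<^bsub>G\<^esub> inv\<^bsub>G\<^esub> g) \<in> epi G G"
    and "kernel G G (\<lambda>m. g \<otimes>\<^bsub>G\<^esub> m \<otimes>\<^bsub>G\<^esub> inv\<^bsub>G\<^esub> g) = {\<one>\<^bsub>G\<^esub>}"
proof -
  interpret group G by fact
  note g = assms(2)
  have hom: "(\<lambda>m. g \<otimes> m \<otimes> inv g) \<in> hom G G"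
  proof (rule homI)
    fix x y assume xy: "x \<in> carrier G" "y \<in> carrier G"
    have "inv g \<otimes> (g \<otimes> (y \<otimes> inv g)) = y \<otimes> inv g" using g xy by (simp flip: m_assoc)
    then show "g \<otimes> (x \<otimes> y) \<otimes> inv g = g \<otimes> x \<otimes> inv g \<otimes> (g \<otimes> y \<otimes> inv g)"
      using g xy by (simp add: m_assoc)
  qed (use g in simp)
  have surj: "y = g \<otimes> (inv g \<otimes> y \<otimes> g) \<otimes> inv g" if "y \<in> carrier G" for y
  proof -
    have "g \<otimes> (inv g \<otimes> y \<otimes> g) \<otimes> inv g = (g \<otimes> inv g) \<otimes> y \<otimes> (g \<otimes> inv g)"
      using g that by (simp only: m_assoc m_closed inv_closed)
    then show ?thesis using g that by simp
  qed
  show "(\<lambda>m. g \<otimes> m \<otimes> inv g) \<in> epi G G"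
    unfolding epi_iff_subset
  proof (intro conjI hom subsetI)
    fix y assume y: "y \<in> carrier G"
    show "y \<in> (\<lambda>m. g \<otimes> m \<otimes> inv g) ` carrier G"
    proof (rule image_eqI)
      show "y = g \<otimes> (inv g \<otimes> y \<otimes> g) \<otimes> inv g" by (rule surj[OF y])
    qed (use y g in simp)
  qed
  have "m = \<one>" if "m \<in> carrier G" "g \<otimes> m \<otimes> inv g = \<one>" for m
  proof -
    have "g \<otimes> m = g" using that g inv_equality[of "g \<otimes> m" "inv g"] by simp
    then show ?thesis using that g r_cancel_one' l_cancel_one by auto
  qed
  then show "kernel G G (\<lambda>m. g \<otimes> m \<otimes> inv g) = {\<one>}"
    using g by (auto simp: kernel_def)
qed

lemma frattini_subset_maximal: "maximal_subgroup M G \<Longrightarrow> frattini G \<subseteq> M"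
  by (auto simp: frattini_def)

lemma frattini_normal:
  fixes G (structure)
  assumes "group G"
  shows "frattini G \<lhd> G"
proof -
  interpret group G by fact
  have "subgroup (frattini G) G"
    by (rule subgroup.intro)
      (auto simp: frattini_def maximal_subgroup_def subgroup.m_closed
        subgroup.one_closed subgroup.m_inv_closed)
  moreover have "x \<otimes> h \<otimes> inv x \<in> frattini G"
    if x: "x \<in> carrier G" and h: "h \<in> frattini G" for x h
  proof -
    have hG: "h \<in> carrier G" using h by (simp add: frattini_def)
    have "x \<otimes> h \<otimes> inv x \<in> M" if M: "maximal_subgroup M G" for M
    proof -
      let ?c = "\<lambda>m. inv x \<otimes> m \<otimes> inv (inv x)"
      have sM: "subgroup M G" using M by (simp add: maximal_subgroup_def)
      have "kernel G G ?c \<subseteq> M"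
        using conjugation_epi(2)[OF assms inv_closed[OF x]] subgroup.one_closed[OF sM] by simp
      then have "maximal_subgroup (?c ` M) G"
        by (rule maximal_subgroup_epi_image(1)
            [OF assms assms conjugation_epi(1)[OF assms inv_closed[OF x]] M])
      then obtain m where m: "m \<in> M" "h = inv x \<otimes> m \<otimes> x"
        using frattini_subset_maximal h x by fastforce
      have mG: "m \<in> carrier G" using m(1) subgroup.subset[OF sM] by blast
      have "x \<otimes> h \<otimes> inv x = (x \<otimes> inv x) \<otimes> m \<otimes> (x \<otimes> inv x)"
        unfolding m(2) using x mG by (simp only: m_assoc m_closed inv_closed)
      then show ?thesis using x mG m(1) by simp
    qed
    then show ?thesis using x hG by (auto simp: frattini_def)
  qed
  ultimately show ?thesis by (simp add: normal_inv_iff)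
qed

lemma frattini_quotient_group: "group G \<Longrightarrow> group (frattini_quotient G)"
  unfolding frattini_quotient_def using frattini_normal normal.factorgroup_is_group by blast

lemma frattini_quotient_epi:
  assumes "group G"
  shows "(\<lambda>g. frattini G #>\<^bsub>G\<^esub> g) \<in> epi G (frattini_quotient G)"
  using normal.r_coset_hom_Mod[OF frattini_normal[OF assms]]
  by (simp add: epi_def frattini_quotient_def carrier_FactGroup)

lemma frattini_coset_eq_iff:
  fixes G (structure)
  assumes "group G" "g \<in> carrier G" "h \<in> carrier G"
  shows "frattini G #>\<^bsub>G\<^esub> g = frattini G #>\<^bsub>G\<^esub> h \<longleftrightarrow> g \<otimes>\<^bsub>G\<^esub> inv\<^bsub>G\<^esub> h \<in> frattini G"
proof -
  interpret group G by fact
  interpret F: subgroup "frattini G" G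
    using frattini_normal[OF assms(1)] by (rule normal_imp_subgroup)
  have "g \<otimes> inv h \<in> frattini G \<longleftrightarrow> g \<in> frattini G #> h"
    using F.rcos_module[OF assms(1,3,2)] by simp
  also have "\<dots> \<longleftrightarrow> frattini G #> g = frattini G #> h"
    using repr_independence[OF _ assms(3) F.subgroup_axioms]
      rcos_self[OF assms(2) F.subgroup_axioms] by metis
  finally show ?thesis by simp
qed

lemma frattini_quotient_kernel:
  fixes G (structure)
  assumes "group G"
  shows "kernel G (frattini_quotient G) (\<lambda>g. frattini G #>\<^bsub>G\<^esub> g) = frattini G"
proof -
  interpret group G by fact
  have sub: "subgroup (frattini G) G"
    using frattini_normal[OF assms] by (rule normal_imp_subgroup)
  have one: "frattini G #> \<one> = frattini G"
    using sub subgroup.subset by fastforce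
  have "frattini G #> g = frattini G \<longleftrightarrow> g \<in> frattini G" if "g \<in> carrier G" for g
    using frattini_coset_eq_iff[OF assms that one_closed] that one by simp
  moreover have "frattini G \<subseteq> carrier G" by (auto simp: frattini_def)
  ultimately show ?thesis by (auto simp: kernel_def frattini_quotient_def)
qed

lemma frattini_epi_image_trivial:
  assumes G: "group G" and K: "group K" and \<pi>: "\<pi> \<in> epi G K"
    and ker: "kernel G K \<pi> = frattini G"
  shows "frattini K = {\<one>\<^bsub>K\<^esub>}"
proof -
  interpret K: group K by fact
  have "k = \<one>\<^bsub>K\<^esub>" if k: "k \<in> frattini K" for k
  proof -
    obtain g where g: "g \<in> carrier G" "k = \<pi> g"
      using k \<pi> by (auto simp: frattini_def epi_def)
    have "g \<in> M" if M: "maximal_subgroup M G" for M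
    proof -
      have kM: "kernel G K \<pi> \<subseteq> M" using ker frattini_subset_maximal[OF M] by simp
      note max = maximal_subgroup_epi_image[OF G K \<pi> M kM]
      show ?thesis using max(2)[OF g(1)] frattini_subset_maximal[OF max(1)] k g(2) by blast
    qed
    then have "g \<in> frattini G" using g(1) by (auto simp: frattini_def)
    then show ?thesis using ker g(2) by (auto simp: kernel_def)
  qed
  moreover have "\<one>\<^bsub>K\<^esub> \<in> frattini K"
    by (auto simp: frattini_def maximal_subgroup_def subgroup.one_closed)
  ultimately show ?thesis by blast
qed

text \<open>A proper subgroup does not cover the Frattini quotient, since together with the
  Frattini subgroup it still lies in a maximal subgroup.\<close>

lemma epi_frattini_quotient_avoids:
  fixes S (structure)
  assumes S: "group S" "finite (carrier S)" and e: "e \<in> epi G (frattini_quotient S)"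
    and U: "subgroup U S" "U \<noteq> carrier S"
  obtains g where "g \<in> carrier G" "\<And>u. u \<in> U \<Longrightarrow> e g \<noteq> frattini S #>\<^bsub>S\<^esub> u"
proof -
  interpret group S by fact
  obtain M where M: "maximal_subgroup M S" "U \<subseteq> M"
    using proper_subgroup_le_maximal[OF S(2) U] by blast
  then interpret M: subgroup M S by (simp add: maximal_subgroup_def)
  obtain s where s: "s \<in> carrier S" "s \<notin> M"
    using M(1) M.subset by (auto simp: maximal_subgroup_def)
  have "frattini S #> s \<in> e ` carrier G"
    using e s(1) by (auto simp: epi_def frattini_quotient_def carrier_FactGroup)
  then obtain g where g: "g \<in> carrier G" "e g = frattini S #> s" by auto
  have "e g \<noteq> frattini S #> u" if u: "u \<in> U" for u
  proof
    assume "e g = frattini S #> u"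
    moreover have uM: "u \<in> M" using u M(2) by blast
    ultimately have "s \<otimes> inv u \<in> M"
      using frattini_coset_eq_iff[OF S(1) s(1), of u] g(2) frattini_subset_maximal[OF M(1)]
      by auto
    then have "(s \<otimes> inv u) \<otimes> u \<in> M" using uM by blast
    then show False using s uM by (simp add: m_assoc)
  qed
  then show thesis using that g(1) by blast
qed

text \<open>A subgroup of the product that projects onto both factors is the graph of a
  homomorphism modulo the elements related to \<open>\<one>\<close>.\<close>

lemma relation_frattini_epi:
  assumes G: "group G" and S: "group S" and R: "subgroup R (G \<times>\<times> S)"
    and onto: "fst ` R = carrier G" "snd ` R = carrier S"
    and ker: "\<And>s. (\<one>\<^bsub>G\<^esub>, s) \<in> R \<Longrightarrow> s \<in> frattini S"
  obtains e where "e \<in> epi G (frattini_quotient S)"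
proof -
  interpret G: group G by fact
  interpret S: group S by fact
  interpret F: normal "frattini S" S by (rule frattini_normal[OF S])
  interpret R: subgroup R "G \<times>\<times> S" by fact
  define e where "e g = frattini S #>\<^bsub>S\<^esub> (SOME s. (g, s) \<in> R)" for g
  have R_in: "g \<in> carrier G \<and> s \<in> carrier S" if "(g, s) \<in> R" for g s
    using R.subset that by auto
  have e_eq: "e g = frattini S #>\<^bsub>S\<^esub> s" if gs: "(g, s) \<in> R" for g s
  proof -
    let ?s = "SOME s. (g, s) \<in> R"
    have s': "(g, ?s) \<in> R" using gs by (rule someI)
    have "(g, ?s) \<otimes>\<^bsub>G \<times>\<times> S\<^esub> inv\<^bsub>G \<times>\<times> S\<^esub> (g, s) \<in> R"
      using s' gs by (intro R.m_closed R.m_inv_closed)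
    then have "(\<one>\<^bsub>G\<^esub>, ?s \<otimes>\<^bsub>S\<^esub> inv\<^bsub>S\<^esub> s) \<in> R" using R_in gs G S by simp
    then have "?s \<otimes>\<^bsub>S\<^esub> inv\<^bsub>S\<^esub> s \<in> frattini S" by (rule ker)
    then show ?thesis unfolding e_def using R_in gs s' frattini_coset_eq_iff[OF S] by blast
  qed
  have "e \<in> hom G (frattini_quotient S)"
  proof (rule homI)
    fix g assume "g \<in> carrier G"
    then obtain s where "(g, s) \<in> R" using onto(1) by force
    then show "e g \<in> carrier (frattini_quotient S)"
      using e_eq R_in by (auto simp: frattini_quotient_def carrier_FactGroup)
  next
    fix g h assume "g \<in> carrier G" "h \<in> carrier G"
    then obtain s t where st: "(g, s) \<in> R" "(h, t) \<in> R" using onto(1) by fastforce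
    then have "(g \<otimes>\<^bsub>G\<^esub> h, s \<otimes>\<^bsub>S\<^esub> t) \<in> R" using R.m_closed by fastforce
    then show "e (g \<otimes>\<^bsub>G\<^esub> h) = e g \<otimes>\<^bsub>frattini_quotient S\<^esub> e h"
      using e_eq st R_in F.rcos_sum by (simp add: frattini_quotient_def)
  qed
  moreover have "carrier (frattini_quotient S) \<subseteq> e ` carrier G"
  proof
    fix X assume "X \<in> carrier (frattini_quotient S)"
    then obtain s where s: "s \<in> carrier S" "X = frattini S #>\<^bsub>S\<^esub> s"
      by (auto simp: frattini_quotient_def carrier_FactGroup)
    then obtain g where "(g, s) \<in> R" using onto(2) by force
    then show "X \<in> e ` carrier G" using e_eq s(2) R_in by blast
  qed
  ultimately have "e \<in> epi G (frattini_quotient S)" by (simp add: epi_iff_subset)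
  then show thesis by (rule that)
qed

section \<open>Polymorphisms of the structure of an action\<close>

lemma homs_action_str_iff:
  assumes A: "finite_action A"
  shows "f \<in> homs (power_str (action_str A) N) (action_str A) \<longleftrightarrow>
    f \<in> (N \<rightarrow>\<^sub>E pts A) \<rightarrow>\<^sub>E pts A \<and>
    (\<forall>g\<in>carrier (grp A). \<forall>t\<in>N \<rightarrow>\<^sub>E pts A. f (\<lambda>i\<in>N. act A g (t i)) = act A g (f t))"
    (is "?L \<longleftrightarrow> ?R")
proof -
  let ?T = "N \<rightarrow>\<^sub>E pts A"
  have closed: "(\<lambda>i\<in>N. act A g (t i)) \<in> ?T" if "g \<in> carrier (grp A)" "t \<in> ?T" for g t
    using that acts_onD(1)[OF finite_actionD(2)[OF A]] by auto
  have rel: "ts \<in> rels (power_str (action_str A) N) g \<longleftrightarrow>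
      (\<exists>t\<in>?T. ts = [t, \<lambda>i\<in>N. act A g (t i)])" if g: "g \<in> carrier (grp A)" for g ts
  proof
    assume ts: "ts \<in> rels (power_str (action_str A) N) g"
    then have "length ts = 2" by (simp add: power_str_def action_str_def)
    then obtain t u where tu: "ts = [t, u]"
      by (metis (no_types, opaque_lifting) One_nat_def Suc_1 length_0_conv length_Suc_conv)
    have T: "t \<in> ?T" "u \<in> ?T" and "\<And>i. i \<in> N \<Longrightarrow> u i = act A g (t i)"
      using ts unfolding tu by (auto simp: power_str_def action_str_def)
    then have "u = (\<lambda>i\<in>N. act A g (t i))" by (intro extensionalityI[of _ N]) (auto simp: PiE_def)
    then show "\<exists>t\<in>?T. ts = [t, \<lambda>i\<in>N. act A g (t i)]" using tu T by blast
  next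
    assume "\<exists>t\<in>?T. ts = [t, \<lambda>i\<in>N. act A g (t i)]"
    then obtain t where t: "t \<in> ?T" "ts = [t, \<lambda>i\<in>N. act A g (t i)]" by blast
    then show "ts \<in> rels (power_str (action_str A) N) g"
      using closed[OF g t(1)] by (auto simp: power_str_def action_str_def)
  qed
  then have rels_eq: "rels (power_str (action_str A) N) g = (\<lambda>t. [t, \<lambda>i\<in>N. act A g (t i)]) ` ?T"
    if "g \<in> carrier (grp A)" for g
    using that by blast
  have "?L \<longleftrightarrow> f \<in> ?T \<rightarrow>\<^sub>E pts A \<and> (\<forall>g\<in>carrier (grp A).
      \<forall>ts\<in>rels (power_str (action_str A) N) g. map f ts \<in> rels (action_str A) g)"
    by (auto simp: homs_def power_str_def action_str_def)
  also have "\<dots> \<longleftrightarrow> f \<in> ?T \<rightarrow>\<^sub>E pts A \<and> (\<forall>g\<in>carrier (grp A). \<forall>t\<in>?T.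
      [f t, f (\<lambda>i\<in>N. act A g (t i))] \<in> rels (action_str A) g)"
    by (intro conj_cong ball_cong refl) (simp add: rels_eq)
  also have "\<dots> \<longleftrightarrow> ?R"
    by (intro conj_cong ball_cong refl) (auto simp: action_str_def)
  finally show ?thesis .
qed

text \<open>A polymorphism of \<open>action_str A\<close> that is invariant under \<open>B\<close> is an equivariant map
  for the product of both groups, which acts on tuples from both sides.\<close>

lemma satisfies_Pol_action_str_iff:
  fixes A :: "('g, 'x) gaction" and B :: "('h, 'y) gaction"
  assumes A: "finite_action A" and B: "finite_action B"
  shows "satisfies (Pol (action_str A)) B \<longleftrightarrow>
    (\<forall>t\<in>pts B \<rightarrow> pts A. \<exists>x\<in>pts A. \<forall>g\<in>carrier (grp A). \<forall>h\<in>carrier (grp B).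
       (\<forall>y\<in>pts B. act A g (t y) = t (act B h y)) \<longrightarrow> act A g x = x)"
    (is "?L \<longleftrightarrow> ?R")
proof -
  let ?X = "pts A" and ?Y = "pts B" and ?G = "grp A" and ?H = "grp B"
  let ?T = "?Y \<rightarrow>\<^sub>E ?X"
  interpret G: group ?G using finite_actionD(1)[OF A] .
  interpret H: group ?H using finite_actionD(1)[OF B] .
  note DA = acts_onD[OF finite_actionD(2)[OF A]] and DB = acts_onD[OF finite_actionD(2)[OF B]]
  have L_iff: "?L \<longleftrightarrow> (\<exists>f. f \<in> ?T \<rightarrow>\<^sub>E ?X \<and>
      (\<forall>g\<in>carrier ?G. \<forall>t\<in>?T. f (\<lambda>y\<in>?Y. act A g (t y)) = act A g (f t)) \<and>
      (\<forall>h\<in>carrier ?H. \<forall>t\<in>?T. f (compose ?Y t (act B h)) = f t))"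
  proof -
    have eq: "(\<lambda>t\<in>?T. f (compose ?Y t (act B h))) = f \<longleftrightarrow>
        (\<forall>t\<in>?T. f (compose ?Y t (act B h)) = f t)" if "f \<in> ?T \<rightarrow>\<^sub>E ?X" for f h
      using that by (auto simp: fun_eq_iff PiE_def extensional_def split: if_splits)
    have "?L \<longleftrightarrow> (\<exists>f. f \<in> homs (power_str (action_str A) ?Y) (action_str A) \<and>
        (\<forall>h\<in>carrier ?H. (\<lambda>t\<in>?T. f (compose ?Y t (act B h))) = f))"
      by (simp add: satisfies_def Pol_def Bex_def action_str_def)
    also have "\<dots> \<longleftrightarrow> (\<exists>f. f \<in> ?T \<rightarrow>\<^sub>E ?X \<and>
        (\<forall>g\<in>carrier ?G. \<forall>t\<in>?T. f (\<lambda>y\<in>?Y. act A g (t y)) = act A g (f t)) \<and>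
        (\<forall>h\<in>carrier ?H. \<forall>t\<in>?T. f (compose ?Y t (act B h)) = f t))"
      by (intro ex_cong1) (simp add: homs_action_str_iff[OF A] eq conj_assoc cong: conj_cong)
    finally show ?thesis .
  qed
  show ?thesis
  proof
    assume ?L
    then obtain f where f: "f \<in> ?T \<rightarrow>\<^sub>E ?X"
      and equi: "\<And>g t. g \<in> carrier ?G \<Longrightarrow> t \<in> ?T \<Longrightarrow> f (\<lambda>y\<in>?Y. act A g (t y)) = act A g (f t)"
      and invar: "\<And>h t. h \<in> carrier ?H \<Longrightarrow> t \<in> ?T \<Longrightarrow> f (compose ?Y t (act B h)) = f t"
      unfolding L_iff by blast
    show ?R
    proof (rule ballI, rule bexI, intro ballI impI)
      fix t assume t: "t \<in> ?Y \<rightarrow> ?X"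
      let ?t = "restrict t ?Y"
      have tT: "?t \<in> ?T" using t by auto
      show "f ?t \<in> ?X" by (rule PiE_mem[OF f tT])
      fix g h assume gh: "g \<in> carrier ?G" "h \<in> carrier ?H"
        and *: "\<forall>y\<in>?Y. act A g (t y) = t (act B h y)"
      have "(\<lambda>y\<in>?Y. act A g (?t y)) = compose ?Y ?t (act B h)"
        using * DB(1)[OF gh(2)] by (auto simp: compose_def)
      then show "act A g (f ?t) = f ?t" using equi[OF gh(1) tT] invar[OF gh(2) tT] by simp
    qed
  next
    assume ?R
    let ?K = "?G \<times>\<times> ?H"
    define a where "a k t = (\<lambda>y\<in>?Y. act A (fst k) (t (act B (inv\<^bsub>?H\<^esub> (snd k)) y)))" for k t
    define b where "b k x = act A (fst k) x" for k :: "'g \<times> 'h" and x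
    have K: "group ?K" by (simp add: DirProd_group)
    have a: "acts_on ?K a ?T"
      unfolding acts_on_def
    proof (intro conjI ballI)
      show "a k t \<in> ?T" if "k \<in> carrier ?K" "t \<in> ?T" for k t
        unfolding a_def
        using that DB(1) by (intro restrict_PiE_iff[THEN iffD2] ballI DA(1) PiE_mem[of t]) auto
      show "a \<one>\<^bsub>?K\<^esub> t = t" if "t \<in> ?T" for t
        by (rule extensionalityI[of _ ?Y]) (use that DA(2) DB(2) in \<open>auto simp: a_def PiE_def Pi_iff\<close>)
      show "a (k \<otimes>\<^bsub>?K\<^esub> l) t = a k (a l t)"
        if "k \<in> carrier ?K" "l \<in> carrier ?K" "t \<in> ?T" for k l t
        by (rule extensionalityI[of _ ?Y])
          (use that DA DB in \<open>auto simp: a_def H.inv_mult_group PiE_def Pi_iff\<close>)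
    qed
    have b: "acts_on ?K b ?X" using DA by (auto simp: acts_on_def b_def)
    have "\<exists>x\<in>?X. \<forall>k\<in>carrier ?K. a k t = t \<longrightarrow> b k x = x" if t: "t \<in> ?T" for t
    proof -
      obtain x where x: "x \<in> ?X" "\<And>g h. g \<in> carrier ?G \<Longrightarrow> h \<in> carrier ?H \<Longrightarrow>
          (\<forall>y\<in>?Y. act A g (t y) = t (act B h y)) \<Longrightarrow> act A g x = x"
        using bspec[OF \<open>?R\<close>, of t] t unfolding PiE_def by blast
      have "b k x = x" if k: "k \<in> carrier ?K" and kt: "a k t = t" for k
        unfolding b_def
      proof (rule x(2))
        show "fst k \<in> carrier ?G" "snd k \<in> carrier ?H" using k by auto
        show "\<forall>y\<in>?Y. act A (fst k) (t y) = t (act B (snd k) y)"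
        proof
          fix y assume y: "y \<in> ?Y"
          have h: "snd k \<in> carrier ?H" using k by auto
          have "t (act B (snd k) y) = a k t (act B (snd k) y)" using kt by simp
          also have "\<dots> = act A (fst k) (t y)"
            using y h DB(1) acts_on_inv(1)[OF H.is_group finite_actionD(2)[OF B] h y]
            by (simp add: a_def)
          finally show "act A (fst k) (t y) = t (act B (snd k) y)" by simp
        qed
      qed
      then show ?thesis using x(1) by blast
    qed
    then obtain \<eta> where \<eta>: "\<And>t. t \<in> ?T \<Longrightarrow> \<eta> t \<in> ?X"
      "\<And>k t. k \<in> carrier ?K \<Longrightarrow> t \<in> ?T \<Longrightarrow> \<eta> (a k t) = b k (\<eta> t)"
      by (rule equivariant_map_exists[OF K a b]) blast+
    let ?f = "restrict \<eta> ?T"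
    have "?f (\<lambda>y\<in>?Y. act A g (t y)) = act A g (?f t)" if g: "g \<in> carrier ?G" and t: "t \<in> ?T" for g t
    proof -
      have "a (g, \<one>\<^bsub>?H\<^esub>) t = (\<lambda>y\<in>?Y. act A g (t y))"
        using DB(2) by (auto simp: a_def)
      then show ?thesis
        using \<eta>(2)[of "(g, \<one>\<^bsub>?H\<^esub>)" t] acts_onD(1)[OF a, of "(g, \<one>\<^bsub>?H\<^esub>)" t] g t
        by (simp add: b_def)
    qed
    moreover have "?f (compose ?Y t (act B h)) = ?f t"
      if h: "h \<in> carrier ?H" and t: "t \<in> ?T" for h t
    proof -
      have "a (\<one>\<^bsub>?G\<^esub>, inv\<^bsub>?H\<^esub> h) t = compose ?Y t (act B h)"
        using DA(2) DB(1) h t by (auto simp: a_def compose_def PiE_def Pi_iff)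
      then show ?thesis
        using \<eta> acts_onD(1)[OF a, of "(\<one>\<^bsub>?G\<^esub>, inv\<^bsub>?H\<^esub> h)" t] h t DA(2)
          \<eta>(2)[of "(\<one>\<^bsub>?G\<^esub>, inv\<^bsub>?H\<^esub> h)" t]
        by (simp add: b_def)
    qed
    moreover have "?f \<in> ?T \<rightarrow>\<^sub>E ?X" using \<eta>(1) by auto
    ultimately show ?L unfolding L_iff by blast
  qed
qed

section \<open>The sum of the primitive actions of a group\<close>

lemma maximal_reps_conjugate:
  assumes G: "group G" and M: "maximal_subgroup M G"
  shows "\<exists>N\<in>maximal_reps G. conjugate_in G M N"
proof -
  interpret group G by fact
  have "subgroup M G" using M by (simp add: maximal_subgroup_def)
  then have "M \<subseteq> carrier G" by (rule subgroup.subset)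
  then have "(\<lambda>m. \<one>\<^bsub>G\<^esub> \<otimes>\<^bsub>G\<^esub> m \<otimes>\<^bsub>G\<^esub> inv\<^bsub>G\<^esub> \<one>\<^bsub>G\<^esub>) ` M = M" by (force simp: image_iff)
  then have "conjugate_in G M M" unfolding conjugate_in_def by (metis one_closed)
  then have "conjugate_in G M (SOME N. conjugate_in G M N)" by (rule someI)
  then show ?thesis using M by (auto simp: maximal_reps_def)
qed

lemma maximal_reps_maximal:
  assumes G: "group G" and N: "N \<in> maximal_reps G"
  shows "maximal_subgroup N G"
proof -
  obtain M where M: "maximal_subgroup M G" and N_def: "N = (SOME N. conjugate_in G M N)"
    using N by (auto simp: maximal_reps_def)
  have "conjugate_in G M N"
    unfolding N_def using maximal_reps_conjugate[OF G M] by (auto intro: someI)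
  then obtain g where g: "g \<in> carrier G" "N = (\<lambda>m. g \<otimes>\<^bsub>G\<^esub> m \<otimes>\<^bsub>G\<^esub> inv\<^bsub>G\<^esub> g) ` M"
    by (auto simp: conjugate_in_def)
  have "subgroup M G" using M by (simp add: maximal_subgroup_def)
  then have "kernel G G (\<lambda>m. g \<otimes>\<^bsub>G\<^esub> m \<otimes>\<^bsub>G\<^esub> inv\<^bsub>G\<^esub> g) \<subseteq> M"
    using conjugation_epi(2)[OF G g(1)] subgroup.one_closed by fastforce
  then show ?thesis
    unfolding g(2) by (rule maximal_subgroup_epi_image(1)[OF G G conjugation_epi(1)[OF G g(1)] M])
qed

lemma pts_primitive_sum:
  "p \<in> pts (primitive_sum G) \<longleftrightarrow>
    (\<exists>N\<in>maximal_reps G. \<exists>a\<in>carrier G. p = (N, a <#\<^bsub>G\<^esub> N))"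
  by (auto simp: primitive_sum_def Let_def LCOSETS_def)

lemma grp_primitive_sum [simp]: "grp (primitive_sum G) = G"
  by (simp add: primitive_sum_def Let_def)

lemma act_primitive_sum:
  assumes G: "group G" and N: "N \<in> maximal_reps G" and "a \<in> carrier G" "g \<in> carrier G"
  shows "act (primitive_sum G) g (N, a <#\<^bsub>G\<^esub> N) = (N, (g \<otimes>\<^bsub>G\<^esub> a) <#\<^bsub>G\<^esub> N)"
proof -
  interpret group G by fact
  have "subgroup N G" using maximal_reps_maximal[OF G N] by (simp add: maximal_subgroup_def)
  then have "N \<subseteq> carrier G" by (rule subgroup.subset)
  then show ?thesis
    using assms by (auto simp: primitive_sum_def Let_def LCOSETS_def lcos_m_assoc)
qed

lemma finite_action_primitive_sum:
  assumes G: "group G" and fin: "finite (carrier G)"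
  shows "finite_action (primitive_sum G)"
proof (rule finite_actionI)
  interpret group G by fact
  have "acts_on G (act (primitive_sum G)) (pts (primitive_sum G))"
    unfolding acts_on_def
  proof (intro conjI ballI)
    fix p assume "p \<in> pts (primitive_sum G)"
    then obtain N a where p: "N \<in> maximal_reps G" "a \<in> carrier G" "p = (N, a <#\<^bsub>G\<^esub> N)"
      by (auto simp: pts_primitive_sum)
    show "act (primitive_sum G) \<one>\<^bsub>G\<^esub> p = p" using p act_primitive_sum[OF G] by simp
    fix g assume g: "g \<in> carrier G"
    show "act (primitive_sum G) g p \<in> pts (primitive_sum G)"
      using p g act_primitive_sum[OF G] by (auto simp: pts_primitive_sum)
  next
    fix g h p assume gh: "g \<in> carrier G" "h \<in> carrier G" and "p \<in> pts (primitive_sum G)"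
    then obtain N a where p: "N \<in> maximal_reps G" "a \<in> carrier G" "p = (N, a <#\<^bsub>G\<^esub> N)"
      by (auto simp: pts_primitive_sum)
    show "act (primitive_sum G) (g \<otimes>\<^bsub>G\<^esub> h) p =
        act (primitive_sum G) g (act (primitive_sum G) h p)"
      using p gh act_primitive_sum[OF G] by (simp add: m_assoc)
  qed
  then show "acts_on (grp (primitive_sum G)) (act (primitive_sum G)) (pts (primitive_sum G))"
    by simp
  have sub: "maximal_reps G \<subseteq> Pow (carrier G)"
    using maximal_reps_maximal[OF G] by (auto simp: maximal_subgroup_def dest: subgroup.subset)
  have "pts (primitive_sum G) \<subseteq> Pow (carrier G) \<times> Pow (carrier G)"
  proof
    fix p assume "p \<in> pts (primitive_sum G)"
    then obtain N a where p: "N \<in> maximal_reps G" "a \<in> carrier G" "p = (N, a <#\<^bsub>G\<^esub> N)"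
      by (auto simp: pts_primitive_sum)
    then show "p \<in> Pow (carrier G) \<times> Pow (carrier G)"
      using sub l_coset_subset_G[of N a] by auto
  qed
  then show "finite (pts (primitive_sum G))"
    using fin by (meson finite_Pow_iff finite_SigmaI finite_subset)
qed (use G fin in \<open>auto simp: primitive_sum_def Let_def\<close>)

lemma primitive_sum_proper_subgroup_fixpoint:
  assumes G: "group G" and fin: "finite (carrier G)"
    and U: "subgroup U G" "U \<noteq> carrier G"
  obtains p where "p \<in> pts (primitive_sum G)" "\<And>u. u \<in> U \<Longrightarrow> act (primitive_sum G) u p = p"
proof -
  interpret group G by fact
  obtain M where M: "maximal_subgroup M G" "U \<subseteq> M"
    using proper_subgroup_le_maximal[OF fin U] by blast
  obtain N g where N: "N \<in> maximal_reps G" and g: "g \<in> carrier G"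
    and N_eq: "N = (\<lambda>m. g \<otimes>\<^bsub>G\<^esub> m \<otimes>\<^bsub>G\<^esub> inv\<^bsub>G\<^esub> g) ` M"
    using maximal_reps_conjugate[OF G M(1)] by (auto simp: conjugate_in_def)
  have sN: "subgroup N G" using maximal_reps_maximal[OF G N] by (simp add: maximal_subgroup_def)
  let ?p = "(N, inv\<^bsub>G\<^esub> g <#\<^bsub>G\<^esub> N)"
  have "act (primitive_sum G) u ?p = ?p" if u: "u \<in> U" for u
  proof -
    have uG: "u \<in> carrier G" using u subgroup.subset[OF U(1)] by blast
    let ?n = "g \<otimes>\<^bsub>G\<^esub> u \<otimes>\<^bsub>G\<^esub> inv\<^bsub>G\<^esub> g"
    have n: "?n \<in> N" using u M(2) N_eq by blast
    have "inv\<^bsub>G\<^esub> g \<otimes>\<^bsub>G\<^esub> (g \<otimes>\<^bsub>G\<^esub> (u \<otimes>\<^bsub>G\<^esub> inv\<^bsub>G\<^esub> g)) = u \<otimes>\<^bsub>G\<^esub> inv\<^bsub>G\<^esub> g"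
      using uG g by (simp flip: m_assoc)
    then have "u \<otimes>\<^bsub>G\<^esub> inv\<^bsub>G\<^esub> g = inv\<^bsub>G\<^esub> g \<otimes>\<^bsub>G\<^esub> ?n" using uG g by (simp add: m_assoc)
    then have "(u \<otimes>\<^bsub>G\<^esub> inv\<^bsub>G\<^esub> g) <#\<^bsub>G\<^esub> N = inv\<^bsub>G\<^esub> g <#\<^bsub>G\<^esub> (?n <#\<^bsub>G\<^esub> N)"
      using lcos_m_assoc[OF subgroup.subset[OF sN], of "inv\<^bsub>G\<^esub> g" ?n] uG g by simp
    also have "?n <#\<^bsub>G\<^esub> N = N" using coset_join3[OF _ sN n] uG g by simp
    finally show ?thesis using act_primitive_sum[OF G N] g uG by simp
  qed
  moreover have "?p \<in> pts (primitive_sum G)" using N g by (auto simp: pts_primitive_sum)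
  ultimately show thesis using that by blast
qed

lemma primitive_sum_no_fixpoint:
  assumes G: "group G" and p: "p \<in> pts (primitive_sum G)"
  obtains g where "g \<in> carrier G" "act (primitive_sum G) g p \<noteq> p"
proof -
  interpret group G by fact
  obtain N a where N: "N \<in> maximal_reps G" and a: "a \<in> carrier G" and p_eq: "p = (N, a <#\<^bsub>G\<^esub> N)"
    using p by (auto simp: pts_primitive_sum)
  have sN: "subgroup N G" and proper: "N \<noteq> carrier G"
    using maximal_reps_maximal[OF G N] by (auto simp: maximal_subgroup_def)
  obtain h where h: "h \<in> carrier G" "h \<notin> N" using proper subgroup.subset[OF sN] by blast
  let ?g = "a \<otimes>\<^bsub>G\<^esub> h \<otimes>\<^bsub>G\<^esub> inv\<^bsub>G\<^esub> a"
  have ga: "?g \<otimes>\<^bsub>G\<^esub> a = a \<otimes>\<^bsub>G\<^esub> h" using a h by (simp add: m_assoc)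
  have "act (primitive_sum G) ?g p \<noteq> p"
  proof
    assume "act (primitive_sum G) ?g p = p"
    then have "(a \<otimes>\<^bsub>G\<^esub> h) <#\<^bsub>G\<^esub> N = a <#\<^bsub>G\<^esub> N"
      using act_primitive_sum[OF G N a, of ?g] a h ga by (simp add: p_eq)
    then have "a \<otimes>\<^bsub>G\<^esub> h \<in> a <#\<^bsub>G\<^esub> N" using lcos_self[OF _ sN, of "a \<otimes>\<^bsub>G\<^esub> h"] a h by simp
    then obtain n where n: "n \<in> N" "a \<otimes>\<^bsub>G\<^esub> h = a \<otimes>\<^bsub>G\<^esub> n" by (auto simp: l_coset_def)
    moreover have "n \<in> carrier G" using n(1) subgroup.subset[OF sN] by blast
    ultimately show False using h a by simp
  qed
  then show thesis using that[of ?g] a h by simp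
qed

section \<open>Failure on primitive sums and Frattini quotients\<close>

lemma subgroup_carrier_update_group:
  assumes "group H" "subgroup S H"
  shows "group (H\<lparr>carrier := S\<rparr>)"
  using subgroup.subgroup_is_group[OF assms(2,1)] .

lemma group_sub_frattini_quotient:
  assumes "finite_action B" "subgroup_without_fixpoint B S"
  shows "group (sub_frattini_quotient B S)"
  using assms frattini_quotient_group subgroup_carrier_update_group finite_actionD(1)
  unfolding sub_frattini_quotient_def subgroup_without_fixpoint_def by blast

lemma stabilizer_relation_subgroup:
  assumes G: "group G" and B: "finite_action B"
    and R: "subgroup R (G \<times>\<times> grp B)" and y: "y \<in> pts B"
  shows "subgroup {g. \<exists>s. (g, s) \<in> R \<and> act B s y = y} G"
proof -
  interpret G: group G by fact
  interpret H: group "grp B" using finite_actionD(1)[OF B] .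
  interpret R: subgroup R "G \<times>\<times> grp B" by fact
  note D = acts_onD[OF finite_actionD(2)[OF B]]
  have R_in: "g \<in> carrier G \<and> s \<in> carrier (grp B)" if "(g, s) \<in> R" for g s
    using R.subset that by auto
  show ?thesis
  proof (rule subgroup.intro)
    show "{g. \<exists>s. (g, s) \<in> R \<and> act B s y = y} \<subseteq> carrier G" using R_in by blast
    show "\<one>\<^bsub>G\<^esub> \<in> {g. \<exists>s. (g, s) \<in> R \<and> act B s y = y}" using R.one_closed D(2) y by auto
  next
    fix g h assume "g \<in> {g. \<exists>s. (g, s) \<in> R \<and> act B s y = y}"
      and "h \<in> {g. \<exists>s. (g, s) \<in> R \<and> act B s y = y}"
    then obtain s t where st: "(g, s) \<in> R" "(h, t) \<in> R" "act B s y = y" "act B t y = y" by auto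
    then have "(g \<otimes>\<^bsub>G\<^esub> h, s \<otimes>\<^bsub>grp B\<^esub> t) \<in> R" using R.m_closed by fastforce
    moreover have "act B (s \<otimes>\<^bsub>grp B\<^esub> t) y = y" using st R_in D(3) y by auto
    ultimately show "g \<otimes>\<^bsub>G\<^esub> h \<in> {g. \<exists>s. (g, s) \<in> R \<and> act B s y = y}" by blast
  next
    fix g assume "g \<in> {g. \<exists>s. (g, s) \<in> R \<and> act B s y = y}"
    then obtain s where s: "(g, s) \<in> R" "act B s y = y" by auto
    then have "(inv\<^bsub>G\<^esub> g, inv\<^bsub>grp B\<^esub> s) \<in> R"
      using R.m_inv_closed[OF s(1)] R_in[OF s(1)] G.is_group H.is_group by simp
    moreover have "act B (inv\<^bsub>grp B\<^esub> s) y = y"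
      using acts_on_inv(1)[OF H.is_group finite_actionD(2)[OF B], of s y] s R_in y by simp
    ultimately show "inv\<^bsub>G\<^esub> g \<in> {g. \<exists>s. (g, s) \<in> R \<and> act B s y = y}" by blast
  qed
qed

text \<open>The fibre product of \<open>G\<close> and \<open>S\<close> over the Frattini quotient of \<open>S\<close>. The part of it
  that fixes a point \<open>y\<close> has a proper projection to \<open>G\<close>, since the stabilizer of \<open>y\<close> in
  \<open>S\<close> is proper.\<close>

lemma epi_sub_frattini_quotient_relation:
  assumes G: "group G" and B: "finite_action B" and S: "subgroup_without_fixpoint B S"
    and e: "e \<in> epi G (sub_frattini_quotient B S)"
  obtains R where "subgroup R (G \<times>\<times> grp B)" "fst ` R = carrier G"
    "\<And>y. y \<in> pts B \<Longrightarrow> {g. \<exists>s. (g, s) \<in> R \<and> act B s y = y} \<noteq> carrier G"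
proof -
  let ?H = "grp B"
  let ?S = "?H\<lparr>carrier := S\<rparr>"
  interpret G: group G by fact
  interpret H: group ?H using finite_actionD(1)[OF B] .
  note D = acts_onD[OF finite_actionD(2)[OF B]]
  have sS: "subgroup S ?H" using S by (simp add: subgroup_without_fixpoint_def)
  then interpret S: group ?S by (rule subgroup_carrier_update_group[OF H.is_group])
  have finS: "finite (carrier ?S)"
    using finite_subset[OF subgroup.subset[OF sS]] finite_actionD(4)[OF B] by simp
  have eq: "sub_frattini_quotient B S = frattini_quotient ?S"
    by (simp add: sub_frattini_quotient_def)
  let ?Q = "frattini_quotient ?S"
  let ?c = "\<lambda>s. frattini ?S #>\<^bsub>?S\<^esub> s"
  have e: "e \<in> epi G ?Q" using e eq by simp
  have c: "?c \<in> epi ?S ?Q" by (rule frattini_quotient_epi[OF S.is_group])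
  interpret e: group_hom G ?Q e
    using e frattini_quotient_group[OF S.is_group] G.is_group
    by (simp add: group_hom_def group_hom_axioms_def epi_def)
  interpret c: group_hom ?S ?Q ?c
    using c frattini_quotient_group[OF S.is_group] S.is_group
    by (simp add: group_hom_def group_hom_axioms_def epi_def)
  define R where "R = {(g, s). g \<in> carrier G \<and> s \<in> S \<and> e g = ?c s}"
  have inv_eq: "inv\<^bsub>?S\<^esub> s = inv\<^bsub>?H\<^esub> s" if "s \<in> S" for s
    using H.m_inv_consistent[OF sS that] .
  have R: "subgroup R (G \<times>\<times> ?H)"
  proof (rule subgroup.intro)
    show "R \<subseteq> carrier (G \<times>\<times> ?H)" using subgroup.subset[OF sS] by (auto simp: R_def)
    show "\<one>\<^bsub>G \<times>\<times> ?H\<^esub> \<in> R"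
      using e.hom_one c.hom_one subgroup.one_closed[OF sS] by (simp add: R_def)
  next
    fix x y assume "x \<in> R" "y \<in> R"
    then show "x \<otimes>\<^bsub>G \<times>\<times> ?H\<^esub> y \<in> R"
      using e.hom_mult c.hom_mult subgroup.m_closed[OF sS] by (auto simp: R_def)
  next
    fix x assume "x \<in> R"
    then obtain g s where x: "x = (g, s)" "g \<in> carrier G" "s \<in> S" "e g = ?c s"
      by (auto simp: R_def)
    then have "?c (inv\<^bsub>?H\<^esub> s) = e (inv\<^bsub>G\<^esub> g)"
      using c.hom_inv[of s] e.hom_inv[of g] inv_eq[of s] by simp
    then show "inv\<^bsub>G \<times>\<times> ?H\<^esub> x \<in> R"
      using x subgroup.m_inv_closed[OF sS x(3)] subgroup.mem_carrier[OF sS x(3)]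
        G.is_group H.is_group by (simp add: R_def)
  qed
  moreover have "fst ` R = carrier G"
  proof
    show "fst ` R \<subseteq> carrier G" by (auto simp: R_def)
    show "carrier G \<subseteq> fst ` R"
    proof
      fix g assume g: "g \<in> carrier G"
      then have "e g \<in> ?c ` S" using e.hom_closed c by (auto simp: epi_def)
      then show "g \<in> fst ` R" using g by (force simp: R_def)
    qed
  qed
  moreover have "{g. \<exists>s. (g, s) \<in> R \<and> act B s y = y} \<noteq> carrier G" if y: "y \<in> pts B" for y
  proof -
    let ?U = "{s \<in> S. act B s y = y}"
    have "subgroup ?U ?S"
    proof (rule S.subgroupI)
      show "?U \<noteq> {}" using subgroup.one_closed[OF sS] D(2)[OF y] by auto
      fix s assume s: "s \<in> ?U"
      then have "act B (inv\<^bsub>?H\<^esub> s) y = y"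
        using acts_on_inv(1)[OF H.is_group finite_actionD(2)[OF B] _ y, of s]
          subgroup.subset[OF sS] by auto
      then show "inv\<^bsub>?S\<^esub> s \<in> ?U" using s inv_eq subgroup.m_inv_closed[OF sS] by simp
      fix t assume t: "t \<in> ?U"
      then have "act B (s \<otimes>\<^bsub>?H\<^esub> t) y = y"
        using s D(3)[OF subgroup.mem_carrier[OF sS] subgroup.mem_carrier[OF sS] y, of s t] by simp
      then show "s \<otimes>\<^bsub>?S\<^esub> t \<in> ?U" using s t subgroup.m_closed[OF sS] by simp
    qed auto
    moreover have "?U \<noteq> carrier ?S" using S y by (auto simp: subgroup_without_fixpoint_def)
    ultimately obtain g where "g \<in> carrier G" "\<And>u. u \<in> ?U \<Longrightarrow> e g \<noteq> ?c u"
      using epi_frattini_quotient_avoids[OF S.is_group finS e] by blast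
    then show ?thesis by (auto simp: R_def)
  qed
  ultimately show thesis by (rule that)
qed

lemma subgroup_DirProd_image:
  assumes G: "group G" and H: "group H" and R: "subgroup R (G \<times>\<times> H)"
  shows "subgroup (fst ` R) G" "subgroup (snd ` R) H"
proof -
  have "group_hom (G \<times>\<times> H) G fst" "group_hom (G \<times>\<times> H) H snd"
    using G H by (auto simp: group_hom_def group_hom_axioms_def DirProd_group hom_def mult_DirProd')
  then show "subgroup (fst ` R) G" "subgroup (snd ` R) H"
    using group_hom.subgroup_img_is_subgroup R by blast+
qed

lemma tuple_relation_subgroup:
  assumes G: "group G" and B: "finite_action B" and a: "acts_on G a X"
    and t: "t \<in> pts B \<rightarrow> X"
  shows "subgroup {(g, h). g \<in> carrier G \<and> h \<in> carrier (grp B) \<and>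
    (\<forall>y\<in>pts B. a g (t y) = t (act B h y))} (G \<times>\<times> grp B)" (is "subgroup ?R _")
proof -
  let ?H = "grp B"
  interpret G: group G by fact
  interpret H: group ?H using finite_actionD(1)[OF B] .
  note DB = acts_onD[OF finite_actionD(2)[OF B]] and D = acts_onD[OF a]
  show ?thesis
  proof (rule subgroup.intro)
    show "?R \<subseteq> carrier (G \<times>\<times> ?H)" by auto
    show "\<one>\<^bsub>G \<times>\<times> ?H\<^esub> \<in> ?R" using D(2) DB(2) t by auto
  next
    fix x y assume "x \<in> ?R" "y \<in> ?R"
    then show "x \<otimes>\<^bsub>G \<times>\<times> ?H\<^esub> y \<in> ?R" using D(3) DB t by (auto simp: Pi_iff)
  next
    fix x assume "x \<in> ?R"
    then obtain g h where x: "x = (g, h)" "g \<in> carrier G" "h \<in> carrier ?H"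
      and *: "\<And>y. y \<in> pts B \<Longrightarrow> a g (t y) = t (act B h y)"
      by auto
    have "a (inv\<^bsub>G\<^esub> g) (t y) = t (act B (inv\<^bsub>?H\<^esub> h) y)" if y: "y \<in> pts B" for y
    proof -
      let ?z = "act B (inv\<^bsub>?H\<^esub> h) y"
      have z: "?z \<in> pts B" using DB(1) x(3) y by simp
      have "a g (t ?z) = t y"
        using *[OF z] acts_on_inv(2)[OF H.is_group finite_actionD(2)[OF B] x(3) y] by simp
      then show ?thesis using acts_on_inv(1)[OF G a x(2), of "t ?z"] t z by auto
    qed
    then show "inv\<^bsub>G \<times>\<times> ?H\<^esub> x \<in> ?R" using x G.is_group H.is_group by simp
  qed
qed

text \<open>A tuple of points of a \<open>G\<close>-set without fixed point, on which every
  element of \<open>G\<close> acts as some element of \<open>B\<close>, gives a fixed-point free subgroup whose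
  Frattini quotient is an image of \<open>G\<close>. Such a subgroup is found by minimality.\<close>

lemma equivariant_tuple_frattini_epi:
  fixes G :: "('g, 'z) monoid_scheme"
  assumes G: "group G" and B: "finite_action B" and a: "acts_on G a X"
    and nofix: "\<And>x. x \<in> X \<Longrightarrow> \<exists>g\<in>carrier G. a g x \<noteq> x"
    and t: "t \<in> pts B \<rightarrow> X"
    and cover: "\<And>g. g \<in> carrier G \<Longrightarrow>
      \<exists>h\<in>carrier (grp B). \<forall>y\<in>pts B. a g (t y) = t (act B h y)"
  obtains S e where "subgroup_without_fixpoint B S" "e \<in> epi G (sub_frattini_quotient B S)"
proof -
  let ?H = "grp B"
  interpret G: group G by fact
  interpret H: group ?H using finite_actionD(1)[OF B] .
  note DB = acts_onD[OF finite_actionD(2)[OF B]] and D = acts_onD[OF a]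
  define R where "R = {(g, h). g \<in> carrier G \<and> h \<in> carrier ?H \<and>
    (\<forall>y\<in>pts B. a g (t y) = t (act B h y))}"
  have R: "subgroup R (G \<times>\<times> ?H)"
    unfolding R_def by (rule tuple_relation_subgroup[OF G B a t])
  then interpret R: subgroup R "G \<times>\<times> ?H" .
  have R_in: "g \<in> carrier G \<and> h \<in> carrier ?H" if "(g, h) \<in> R" for g h
    using that by (simp add: R_def)
  have R_mult: "(g \<otimes>\<^bsub>G\<^esub> g', h \<otimes>\<^bsub>?H\<^esub> h') \<in> R" if "(g, h) \<in> R" "(g', h') \<in> R" for g g' h h'
    using R.m_closed[OF that] by simp
  have R_inv: "(inv\<^bsub>G\<^esub> g, inv\<^bsub>?H\<^esub> h) \<in> R" if "(g, h) \<in> R" for g h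
    using R.m_inv_closed[OF that] R_in[OF that] G.is_group H.is_group by simp
  define P where "P S \<longleftrightarrow> subgroup S ?H \<and> (\<forall>g\<in>carrier G. \<exists>s\<in>S. (g, s) \<in> R) \<and>
    (\<forall>s\<in>S. \<exists>g. (g, s) \<in> R)" for S
  have "P (snd ` R)"
    unfolding P_def
  proof (intro conjI)
    show "subgroup (snd ` R) ?H" by (rule subgroup_DirProd_image(2)[OF G H.is_group R])
    show "\<forall>g\<in>carrier G. \<exists>s\<in>snd ` R. (g, s) \<in> R" using cover by (force simp: R_def)
  qed auto
  then obtain S where S: "P S" and min: "\<And>S'. P S' \<Longrightarrow> card S \<le> card S'"
    using ex_has_least_nat[of P "snd ` R" card] by auto
  have sS: "subgroup S ?H" and RS: "\<And>g. g \<in> carrier G \<Longrightarrow> \<exists>s\<in>S. (g, s) \<in> R"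
    and SR: "\<And>s. s \<in> S \<Longrightarrow> \<exists>g. (g, s) \<in> R"
    using S by (auto simp: P_def)
  interpret sS: subgroup S ?H by (rule sS)
  let ?S = "?H\<lparr>carrier := S\<rparr>"
  interpret S: group ?S by (rule subgroup_carrier_update_group[OF H.is_group sS])
  have finS: "finite S" using finite_subset[OF sS.subset finite_actionD(4)[OF B]] .
  have inv_eq: "inv\<^bsub>?S\<^esub> s = inv\<^bsub>?H\<^esub> s" if "s \<in> S" for s
    using H.m_inv_consistent[OF sS that] .
  have nofixS: "subgroup_without_fixpoint B S"
    unfolding subgroup_without_fixpoint_def
  proof (intro conjI notI)
    show "subgroup S ?H" by (rule sS)
    assume "\<exists>y\<in>pts B. \<forall>s\<in>S. act B s y = y"
    then obtain y where y: "y \<in> pts B" "\<And>s. s \<in> S \<Longrightarrow> act B s y = y" by blast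
    have "a g (t y) = t y" if "g \<in> carrier G" for g
      using RS[OF that] y by (auto simp: R_def)
    then show False using nofix[of "t y"] t y(1) by auto
  qed
  define R' where "R' = R \<inter> (carrier G \<times> S)"
  have R': "subgroup R' (G \<times>\<times> ?S)"
  proof (rule subgroup.intro)
    fix x assume "x \<in> R'"
    then obtain g s where x: "x = (g, s)" "(g, s) \<in> R" "s \<in> S" by (auto simp: R'_def)
    then have "inv\<^bsub>G \<times>\<times> ?S\<^esub> x = (inv\<^bsub>G\<^esub> g, inv\<^bsub>?H\<^esub> s)"
      using inv_DirProd[OF G S.is_group, of g s] R_in[OF x(2)] inv_eq by simp
    then show "inv\<^bsub>G \<times>\<times> ?S\<^esub> x \<in> R'" using x R_inv R_in by (auto simp: R'_def)
  qed (use R_mult R.one_closed in \<open>auto simp: R'_def\<close>)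
  \<comment> \<open>Otherwise a maximal subgroup that misses \<open>s\<close> would inherit \<open>P\<close>.\<close>
  have "s \<in> frattini ?S" if s1: "(\<one>\<^bsub>G\<^esub>, s) \<in> R'" for s
  proof -
    have s: "(\<one>\<^bsub>G\<^esub>, s) \<in> R" "s \<in> S" using s1 by (auto simp: R'_def)
    have "s \<in> M" if M: "maximal_subgroup M ?S" for M
    proof (rule ccontr)
      assume "s \<notin> M"
      have sM': "subgroup M ?S" using M by (simp add: maximal_subgroup_def)
      have M_S: "M \<subseteq> S" using subgroup.subset[OF sM'] by simp
      have sM: "subgroup M ?H" by (rule H.incl_subgroup[OF sS sM'])
      interpret M: subgroup M ?H by (rule sM)
      define L where "L = {x \<in> S. \<exists>m\<in>M. \<exists>g. (g, x) \<in> R \<and> (g, m) \<in> R}"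
      have "subgroup L ?S"
      proof (rule S.subgroupI)
        show "L \<subseteq> carrier ?S" by (auto simp: L_def)
        show "L \<noteq> {}"
          using s R.one_closed M.one_closed by (auto simp: L_def intro!: exI[of _ s])
        fix x assume x: "x \<in> L"
        then obtain m g where m: "m \<in> M" "(g, x) \<in> R" "(g, m) \<in> R" "x \<in> S" by (auto simp: L_def)
        then have "inv\<^bsub>?H\<^esub> x \<in> L"
          using R_inv[OF m(2)] R_inv[OF m(3)] M.m_inv_closed[OF m(1)] sS.m_inv_closed[OF m(4)]
          unfolding L_def by blast
        then show "inv\<^bsub>?S\<^esub> x \<in> L" using inv_eq m(4) by simp
        fix x' assume "x' \<in> L"
        then obtain m' g' where m': "m' \<in> M" "(g', x') \<in> R" "(g', m') \<in> R" "x' \<in> S"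
          by (auto simp: L_def)
        have "x \<otimes>\<^bsub>?H\<^esub> x' \<in> L"
          using R_mult[OF m(2) m'(2)] R_mult[OF m(3) m'(3)] M.m_closed[OF m(1) m'(1)]
            sS.m_closed[OF m(4) m'(4)] unfolding L_def by blast
        then show "x \<otimes>\<^bsub>?S\<^esub> x' \<in> L" by simp
      qed
      moreover have "M \<subseteq> L" using M_S SR unfolding L_def by blast
      moreover have "(\<one>\<^bsub>G\<^esub>, \<one>\<^bsub>?H\<^esub>) \<in> R" using R.one_closed by simp
      then have "s \<in> L" using s M.one_closed unfolding L_def by blast
      moreover have "\<forall>K. subgroup K ?S \<longrightarrow> M \<subseteq> K \<longrightarrow> K = M \<or> K = S"
        using M by (simp add: maximal_subgroup_def)
      ultimately have L: "L = S" using \<open>s \<notin> M\<close> by blast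
      have "P M"
        unfolding P_def
      proof (intro conjI ballI)
        fix g assume "g \<in> carrier G"
        then obtain x where x: "x \<in> S" "(g, x) \<in> R" using RS by blast
        then have "x \<in> L" using L by simp
        then obtain m g' where m: "m \<in> M" "(g', x) \<in> R" "(g', m) \<in> R"
          unfolding L_def by blast
        have "(g \<otimes>\<^bsub>G\<^esub> inv\<^bsub>G\<^esub> g' \<otimes>\<^bsub>G\<^esub> g', x \<otimes>\<^bsub>?H\<^esub> inv\<^bsub>?H\<^esub> x \<otimes>\<^bsub>?H\<^esub> m) \<in> R"
          using R_mult[OF R_mult[OF x(2) R_inv[OF m(2)]] m(3)] .
        then show "\<exists>s\<in>M. (g, s) \<in> R" using R_in[OF x(2)] R_in[OF m(3)] m(1)
          by (auto simp: G.m_assoc)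
      qed (use sM M_S SR in blast)+
      moreover have "M \<noteq> S" using M by (simp add: maximal_subgroup_def)
      ultimately show False using min M_S psubset_card_mono[OF finS, of M] by fastforce
    qed
    then show ?thesis using s by (auto simp: frattini_def)
  qed
  moreover have "fst ` R' = carrier G" using RS R_in by (force simp: R'_def)
  moreover have "snd ` R' = carrier ?S" using SR R_in by (force simp: R'_def)
  ultimately obtain e where "e \<in> epi G (frattini_quotient ?S)"
    using relation_frattini_epi[OF G S.is_group R'] by blast
  then show thesis using that nofixS by (simp add: sub_frattini_quotient_def)
qed

text \<open>If the condition fails at a tuple \<open>t\<close>, then every element of \<open>G\<close> acts on \<open>t\<close> as some
  element of \<open>B\<close>, because a proper subgroup of \<open>G\<close> has a fixed point. Conversely, an equivariant
  map for the fibre product is a tuple at which the condition fails.\<close>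

theorem satisfies_primitive_sum_iff:
  assumes G: "group G" and fin: "finite (carrier G)" and B: "finite_action B"
  shows "satisfies (Pol (action_str (primitive_sum G))) B \<longleftrightarrow>
    \<not> (\<exists>S e. subgroup_without_fixpoint B S \<and> e \<in> epi G (sub_frattini_quotient B S))"
    (is "?L \<longleftrightarrow> \<not> ?R")
proof -
  let ?P = "primitive_sum G"
  interpret G: group G by fact
  note P = finite_action_primitive_sum[OF G fin]
  have actP: "acts_on G (act ?P) (pts ?P)" using finite_actionD(2)[OF P] by simp
  note iff = satisfies_Pol_action_str_iff[OF P B, simplified]
  have "?R" if "\<not> ?L"
  proof -
    obtain t where t: "t \<in> pts B \<rightarrow> pts ?P" and bad: "\<And>x. x \<in> pts ?P \<Longrightarrow>
      \<exists>g\<in>carrier G. \<exists>h\<in>carrier (grp B). (\<forall>y\<in>pts B. act ?P g (t y) = t (act B h y)) \<and>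
        act ?P g x \<noteq> x"
      using \<open>\<not> ?L\<close> unfolding iff by blast
    let ?D = "{(g, h). g \<in> carrier G \<and> h \<in> carrier (grp B) \<and>
      (\<forall>y\<in>pts B. act ?P g (t y) = t (act B h y))}"
    have U: "subgroup (fst ` ?D) G"
      by (rule subgroup_DirProd_image(1)[OF G finite_actionD(1)[OF B]
            tuple_relation_subgroup[OF G B actP t]])
    have "fst ` ?D = carrier G"
    proof (rule ccontr)
      assume "fst ` ?D \<noteq> carrier G"
      then obtain p where "p \<in> pts ?P" "\<And>u. u \<in> fst ` ?D \<Longrightarrow> act ?P u p = p"
        using primitive_sum_proper_subgroup_fixpoint[OF G fin U] by blast
      then show False using bad[of p] by force
    qed
    then have "\<exists>h\<in>carrier (grp B). \<forall>y\<in>pts B. act ?P g (t y) = t (act B h y)"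
      if "g \<in> carrier G" for g
      using that by force
    then show ?R
      using equivariant_tuple_frattini_epi[OF G B actP _ t] primitive_sum_no_fixpoint[OF G]
      by metis
  qed
  moreover have "\<not> ?L" if ?R
  proof -
    obtain S e where S: "subgroup_without_fixpoint B S" and e: "e \<in> epi G (sub_frattini_quotient B S)"
      using \<open>?R\<close> by blast
    obtain R where R: "subgroup R (G \<times>\<times> grp B)" and onto: "fst ` R = carrier G"
      and proper: "\<And>y. y \<in> pts B \<Longrightarrow> {g. \<exists>s. (g, s) \<in> R \<and> act B s y = y} \<noteq> carrier G"
      using epi_sub_frattini_quotient_relation[OF G B S e] by blast
    let ?K = "(G \<times>\<times> grp B)\<lparr>carrier := R\<rparr>"
    have GH: "group (G \<times>\<times> grp B)" using DirProd_group[OF G finite_actionD(1)[OF B]] .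
    have K: "group ?K" by (rule subgroup_carrier_update_group[OF GH R])
    have a: "acts_on ?K (\<lambda>k. act B (snd k)) (pts B)"
      by (rule acts_on_subgroup[OF acts_on_hom[OF finite_actionD(2)[OF B] _ GH] R])
        (use finite_actionD(1)[OF B] in \<open>auto simp: hom_def mult_DirProd'\<close>)
    have b: "acts_on ?K (\<lambda>k. act ?P (fst k)) (pts ?P)"
      by (rule acts_on_subgroup[OF acts_on_hom[OF actP _ GH G] R])
        (auto simp: hom_def mult_DirProd')
    have "\<exists>p\<in>pts ?P. \<forall>k\<in>carrier ?K. act B (snd k) y = y \<longrightarrow> act ?P (fst k) p = p"
      if y: "y \<in> pts B" for y
    proof -
      obtain p where p: "p \<in> pts ?P"
        "\<And>u. u \<in> {g. \<exists>s. (g, s) \<in> R \<and> act B s y = y} \<Longrightarrow> act ?P u p = p"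
        using primitive_sum_proper_subgroup_fixpoint[OF G fin
            stabilizer_relation_subgroup[OF G B R y] proper[OF y]] by blast
      have "act ?P (fst k) p = p" if "k \<in> carrier ?K" "act B (snd k) y = y" for k
        by (rule p(2)) (use that in \<open>cases k; auto\<close>)
      then show ?thesis using p(1) by blast
    qed
    then obtain t where t: "\<And>y. y \<in> pts B \<Longrightarrow> t y \<in> pts ?P"
      "\<And>k y. k \<in> carrier ?K \<Longrightarrow> y \<in> pts B \<Longrightarrow> t (act B (snd k) y) = act ?P (fst k) (t y)"
      by (rule equivariant_map_exists[OF K a b]) blast+
    have "\<exists>g\<in>carrier G. \<exists>h\<in>carrier (grp B).
        (\<forall>y\<in>pts B. act ?P g (t y) = t (act B h y)) \<and> act ?P g p \<noteq> p" if p: "p \<in> pts ?P" for p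
    proof -
      obtain g where g: "g \<in> carrier G" "act ?P g p \<noteq> p"
        using primitive_sum_no_fixpoint[OF G p] by blast
      then obtain h where gh: "(g, h) \<in> R" using onto by force
      have "act ?P g (t y) = t (act B h y)" if "y \<in> pts B" for y
        using t(2)[of "(g, h)" y] gh that by simp
      then show ?thesis using g gh subgroup.subset[OF R] by auto
    qed
    moreover have "t \<in> pts B \<rightarrow> pts ?P" using t(1) by blast
    ultimately show ?thesis unfolding iff by blast
  qed
  ultimately show ?thesis by blast
qed

section \<open>The class of groups attached to an action\<close>

lemma finite_sub_frattini_quotient:
  assumes B: "finite_action B" and S: "subgroup_without_fixpoint B S"
  shows "finite (carrier (sub_frattini_quotient B S))"
proof -
  have "S \<subseteq> carrier (grp B)"
    using S by (simp add: subgroup_without_fixpoint_def subgroup.subset)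
  then have "finite S" using finite_subset finite_actionD(4)[OF B] by blast
  then show ?thesis
    by (simp add: sub_frattini_quotient_def frattini_quotient_def carrier_FactGroup)
qed

text \<open>Minimality in \<^const>\<open>chi_reduced\<close> is immaterial for \<^const>\<open>chi\<close>: among the
  Frattini quotients of fixed-point free subgroups onto which \<open>K\<close> maps, one of least order is
  minimal.\<close>

lemma chi_iff:
  assumes A: "finite_action A"
  shows "chi A K \<longleftrightarrow> group K \<and> finite (carrier K) \<and> frattini K = {\<one>\<^bsub>K\<^esub>} \<and>
    (\<exists>S e. subgroup_without_fixpoint A S \<and> e \<in> epi K (sub_frattini_quotient A S))"
    (is "_ \<longleftrightarrow> ?R")
proof
  assume chi: "chi A K"
  then obtain L :: "'a set monoid" and e where L: "chi_reduced A L" and e: "e \<in> epi K L"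
    unfolding chi_def by blast
  obtain S where S: "subgroup_without_fixpoint A S" "L \<cong> sub_frattini_quotient A S"
    using L unfolding chi_reduced_def by blast
  then obtain f where "f \<in> epi L (sub_frattini_quotient A S)"
    by (auto simp: is_iso_def iso_iff_mon_epi)
  then have "f \<circ> e \<in> epi K (sub_frattini_quotient A S)" by (rule epi_compose[OF e])
  then show ?R using chi S(1) unfolding chi_def by blast
next
  assume R: ?R
  define P where "P S \<longleftrightarrow> subgroup_without_fixpoint A S \<and> (\<exists>e. e \<in> epi K (sub_frattini_quotient A S))"
    for S
  obtain S0 where "P S0" using R unfolding P_def by blast
  then obtain S where S: "P S" and min: "\<And>S'. P S' \<Longrightarrow>
      card (carrier (sub_frattini_quotient A S)) \<le> card (carrier (sub_frattini_quotient A S'))"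
    using ex_has_least_nat[of P S0 "\<lambda>S. card (carrier (sub_frattini_quotient A S))"] by auto
  let ?L = "sub_frattini_quotient A S"
  obtain e where e: "e \<in> epi K ?L" and S': "subgroup_without_fixpoint A S"
    using S unfolding P_def by blast
  have "f \<in> iso ?L (sub_frattini_quotient A T)"
    if T: "subgroup_without_fixpoint A T" and f: "f \<in> epi ?L (sub_frattini_quotient A T)" for T f
  proof -
    let ?M = "sub_frattini_quotient A T"
    have "f \<circ> e \<in> epi K ?M" by (rule epi_compose[OF e f])
    then have "card (carrier ?L) \<le> card (carrier ?M)" using min T unfolding P_def by blast
    moreover have "f ` carrier ?L = carrier ?M" using f by (simp add: epi_def)
    ultimately have "inj_on f (carrier ?L)"
      using finite_sub_frattini_quotient[OF A S'] by (metis card_image_le eq_card_imp_inj_on le_antisym)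
    then show ?thesis using f by (simp add: iso_iff_mon_epi mon_def epi_def)
  qed
  then have "chi_reduced A ?L"
    unfolding chi_reduced_def
    using S' group_sub_frattini_quotient[OF A S'] iso_refl by blast
  then show "chi A K" using R e unfolding chi_def by blast
qed

lemma chi_iff_not_satisfies:
  assumes "finite_action A" "group K" "finite (carrier K)" "frattini K = {\<one>\<^bsub>K\<^esub>}"
  shows "chi A K \<longleftrightarrow> \<not> satisfies (Pol (action_str (primitive_sum K))) A"
  unfolding chi_iff[OF assms(1)] satisfies_primitive_sum_iff[OF assms(2,3,1)] using assms by blast

section \<open>Copies of groups and actions\<close>

text \<open>The copy of a group along a map \<open>\<phi>\<close> that is injective on the carrier.\<close>

definition group_copy :: "('g \<Rightarrow> 'k) \<Rightarrow> ('g, 'z) monoid_scheme \<Rightarrow> 'k monoid" where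
  "group_copy \<phi> G = (let \<phi>' = inv_into (carrier G) \<phi> in
     \<lparr>carrier = \<phi> ` carrier G, mult = (\<lambda>a b. \<phi> (\<phi>' a \<otimes>\<^bsub>G\<^esub> \<phi>' b)), one = \<phi> \<one>\<^bsub>G\<^esub>\<rparr>)"

lemma group_copy:
  assumes G: "group G" and inj: "inj_on \<phi> (carrier G)"
  shows "\<phi> \<in> iso G (group_copy \<phi> G)" "group (group_copy \<phi> G)"
proof -
  interpret group G by fact
  show iso: "\<phi> \<in> iso G (group_copy \<phi> G)"
    using inj by (auto simp: iso_def hom_def group_copy_def Let_def bij_betw_def)
  have "group_copy \<phi> G\<lparr>one := \<phi> \<one>\<^bsub>G\<^esub>\<rparr> = group_copy \<phi> G" by (simp add: group_copy_def Let_def)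
  then show "group (group_copy \<phi> G)" using iso_imp_img_group[OF iso] by simp
qed

lemma finite_inj_into_infinite:
  assumes "finite A" "infinite (UNIV :: 'b set)"
  obtains f :: "'a \<Rightarrow> 'b" where "inj_on f A"
proof -
  obtain B :: "'b set" where "finite B" "card B = card A"
    using infinite_arbitrarily_large[OF assms(2)] by blast
  then obtain f where "bij_betw f A B" using finite_same_card_bij assms(1) by metis
  then show thesis using that by (auto simp: bij_betw_def)
qed

lemma grp_transport: "grp (transport \<phi> \<xi> A) = group_copy \<phi> (grp A)"
  by (simp add: transport_def group_copy_def Let_def)

lemma pts_transport: "pts (transport \<phi> \<xi> A) = \<xi> ` pts A"
  by (simp add: transport_def Let_def)

lemma act_transport:
  assumes "inj_on \<phi> (carrier (grp A))" "inj_on \<xi> (pts A)" "g \<in> carrier (grp A)" "x \<in> pts A"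
  shows "act (transport \<phi> \<xi> A) (\<phi> g) (\<xi> x) = \<xi> (act A g x)"
  using assms by (simp add: transport_def Let_def)

lemma finite_action_transport:
  assumes A: "finite_action A" and \<phi>: "inj_on \<phi> (carrier (grp A))" and \<xi>: "inj_on \<xi> (pts A)"
  shows "finite_action (transport \<phi> \<xi> A)"
proof (rule finite_actionI)
  interpret group "grp A" using finite_actionD(1)[OF A] .
  note D = acts_onD[OF finite_actionD(2)[OF A]] and act = act_transport[OF \<phi> \<xi>]
  note iso = group_copy[OF is_group \<phi>]
  show "group (grp (transport \<phi> \<xi> A))" using iso(2) by (simp add: grp_transport)
  show "acts_on (grp (transport \<phi> \<xi> A)) (act (transport \<phi> \<xi> A)) (pts (transport \<phi> \<xi> A))"
    unfolding acts_on_def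
  proof (intro conjI ballI)
    fix k x assume "k \<in> carrier (grp (transport \<phi> \<xi> A))" "x \<in> pts (transport \<phi> \<xi> A)"
    then show "act (transport \<phi> \<xi> A) k x \<in> pts (transport \<phi> \<xi> A)"
      using act D(1) by (auto simp: pts_transport grp_transport group_copy_def Let_def)
  next
    fix x assume "x \<in> pts (transport \<phi> \<xi> A)"
    then show "act (transport \<phi> \<xi> A) \<one>\<^bsub>grp (transport \<phi> \<xi> A)\<^esub> x = x"
      using act D(2) by (auto simp: pts_transport grp_transport group_copy_def Let_def)
  next
    fix k l x assume "k \<in> carrier (grp (transport \<phi> \<xi> A))" "l \<in> carrier (grp (transport \<phi> \<xi> A))"
      "x \<in> pts (transport \<phi> \<xi> A)"
    then show "act (transport \<phi> \<xi> A) (k \<otimes>\<^bsub>grp (transport \<phi> \<xi> A)\<^esub> l) x =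
        act (transport \<phi> \<xi> A) k (act (transport \<phi> \<xi> A) l x)"
      using act D \<phi> by (auto simp: pts_transport grp_transport group_copy_def Let_def)
  qed
qed (use finite_actionD[OF A] in \<open>auto simp: transport_def Let_def\<close>)

lemma satisfies_Pol_transport:
  assumes A: "finite_action A" and B: "finite_action B"
    and \<phi>: "inj_on \<phi> (carrier (grp A))" and \<xi>: "inj_on \<xi> (pts A)"
  shows "satisfies (Pol (action_str (transport \<phi> \<xi> A))) B \<longleftrightarrow> satisfies (Pol (action_str A)) B"
    (is "?L \<longleftrightarrow> ?R")
proof -
  let ?T = "transport \<phi> \<xi> A"
  note D = acts_onD[OF finite_actionD(2)[OF A]] and DB = acts_onD[OF finite_actionD(2)[OF B]]
    and act = act_transport[OF \<phi> \<xi>]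
  note iffT = satisfies_Pol_action_str_iff[OF finite_action_transport[OF A \<phi> \<xi>] B]
    and iffA = satisfies_Pol_action_str_iff[OF A B]
  have tuple: "act ?T (\<phi> g) (\<xi> (t y)) = \<xi> (t (act B h y)) \<longleftrightarrow> act A g (t y) = t (act B h y)"
    if "g \<in> carrier (grp A)" "h \<in> carrier (grp B)" "y \<in> pts B" "t \<in> pts B \<rightarrow> pts A" for g h y t
  proof -
    have "t y \<in> pts A" "t (act B h y) \<in> pts A" using that DB(1) by auto
    then show ?thesis using act that(1) D(1) inj_on_eq_iff[OF \<xi>] by simp
  qed
  have fixp: "act ?T (\<phi> g) (\<xi> x) = \<xi> x \<longleftrightarrow> act A g x = x"
    if "g \<in> carrier (grp A)" "x \<in> pts A" for g x
    using act that D(1) inj_on_eq_iff[OF \<xi>] by simp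
  have car: "carrier (grp ?T) = \<phi> ` carrier (grp A)"
    by (simp add: grp_transport group_copy_def Let_def)
  have "?L \<longleftrightarrow> (\<forall>t\<in>pts B \<rightarrow> pts A. \<exists>x\<in>\<xi> ` pts A. \<forall>g\<in>carrier (grp ?T). \<forall>h\<in>carrier (grp B).
      (\<forall>y\<in>pts B. act ?T g (\<xi> (t y)) = \<xi> (t (act B h y))) \<longrightarrow> act ?T g x = x)"
    (is "_ \<longleftrightarrow> ?M")
  proof
    assume ?L
    show ?M
    proof
      fix t assume "t \<in> pts B \<rightarrow> pts A"
      then have "(\<lambda>y. \<xi> (t y)) \<in> pts B \<rightarrow> pts ?T" by (auto simp: pts_transport)
      from bspec[OF \<open>?L\<close>[unfolded iffT] this]
      show "\<exists>x\<in>\<xi> ` pts A. \<forall>g\<in>carrier (grp ?T). \<forall>h\<in>carrier (grp B).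
          (\<forall>y\<in>pts B. act ?T g (\<xi> (t y)) = \<xi> (t (act B h y))) \<longrightarrow> act ?T g x = x"
        unfolding pts_transport .
    qed
  next
    assume ?M
    show ?L
      unfolding iffT
    proof
      fix t assume t: "t \<in> pts B \<rightarrow> pts ?T"
      let ?t = "\<lambda>y. inv_into (pts A) \<xi> (t y)"
      have eq: "\<xi> (?t y) = t y" "?t y \<in> pts A" if "y \<in> pts B" for y
        using t that by (auto simp: pts_transport intro!: f_inv_into_f inv_into_into)
      have eq': "\<xi> (?t (act B h y)) = t (act B h y)"
        if "h \<in> carrier (grp B)" "y \<in> pts B" for h y
        using eq(1) DB(1) that by blast
      have "?t \<in> pts B \<rightarrow> pts A" using eq(2) by blast
      from bspec[OF \<open>?M\<close> this]
      show "\<exists>x\<in>pts ?T. \<forall>g\<in>carrier (grp ?T). \<forall>h\<in>carrier (grp B).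
          (\<forall>y\<in>pts B. act ?T g (t y) = t (act B h y)) \<longrightarrow> act ?T g x = x"
        unfolding pts_transport by (simp add: eq(1) eq' cong: ball_cong)
    qed
  qed
  also have "\<dots> \<longleftrightarrow> ?R"
    unfolding iffA car by (simp add: tuple fixp cong: ball_cong bex_cong)
  finally show ?thesis .
qed

section \<open>Star products and star powers\<close>

lemma star_product_simps:
  "grp (star_product A B) = \<lparr>carrier = carrier (grp A) \<times> (pts A \<rightarrow>\<^sub>E carrier (grp B)),
     mult = (\<lambda>(g, f) (g', f').
       (g \<otimes>\<^bsub>grp A\<^esub> g', \<lambda>x\<in>pts A. f (act A g' x) \<otimes>\<^bsub>grp B\<^esub> f' x)),
     one = (\<one>\<^bsub>grp A\<^esub>, \<lambda>x\<in>pts A. \<one>\<^bsub>grp B\<^esub>)\<rparr>"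
  "pts (star_product A B) = pts A \<times> pts B"
  "x \<in> pts A \<Longrightarrow> y \<in> pts B \<Longrightarrow>
    act (star_product A B) (g, f) (x, y) = (act A g x, act B (f x) y)"
  by (simp_all add: star_product_def)

lemma group_star_product:
  assumes A: "finite_action A" and B: "finite_action B"
  shows "group (grp (star_product A B))"
    and "\<And>g f. g \<in> carrier (grp A) \<Longrightarrow> f \<in> pts A \<rightarrow>\<^sub>E carrier (grp B) \<Longrightarrow>
      inv\<^bsub>grp (star_product A B)\<^esub> (g, f) =
      (inv\<^bsub>grp A\<^esub> g, \<lambda>x\<in>pts A. inv\<^bsub>grp B\<^esub> (f (act A (inv\<^bsub>grp A\<^esub> g) x)))"
proof -
  let ?G = "grp A" and ?H = "grp B" and ?X = "pts A" and ?W = "grp (star_product A B)"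
  interpret G: group ?G using finite_actionD(1)[OF A] .
  interpret H: group ?H using finite_actionD(1)[OF B] .
  note D = acts_onD[OF finite_actionD(2)[OF A]]
    and I = acts_on_inv[OF G.is_group finite_actionD(2)[OF A]]
  define i where "i = (\<lambda>(g, f). (inv\<^bsub>?G\<^esub> g, \<lambda>x\<in>?X. inv\<^bsub>?H\<^esub> (f (act A (inv\<^bsub>?G\<^esub> g) x))))"
  have i_closed: "i w \<in> carrier ?W" if "w \<in> carrier ?W" for w
  proof -
    obtain g f where w: "w = (g, f)" "g \<in> carrier ?G" "f \<in> ?X \<rightarrow>\<^sub>E carrier ?H"
      using \<open>w \<in> carrier ?W\<close> by (auto simp: star_product_simps)
    have "inv\<^bsub>?H\<^esub> (f (act A (inv\<^bsub>?G\<^esub> g) x)) \<in> carrier ?H" if "x \<in> ?X" for x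
      using PiE_mem[OF w(3)] D(1) w(2) that by simp
    then show ?thesis using w by (auto simp: i_def star_product_simps)
  qed
  have i_inv: "i w \<otimes>\<^bsub>?W\<^esub> w = \<one>\<^bsub>?W\<^esub>" if w: "w \<in> carrier ?W" for w
  proof -
    obtain g f where w_eq: "w = (g, f)" "g \<in> carrier ?G" "f \<in> ?X \<rightarrow>\<^sub>E carrier ?H"
      using w by (auto simp: star_product_simps)
    have "(\<lambda>x\<in>?X. (\<lambda>x\<in>?X. inv\<^bsub>?H\<^esub> (f (act A (inv\<^bsub>?G\<^esub> g) x))) (act A g x) \<otimes>\<^bsub>?H\<^esub> f x) =
        (\<lambda>x\<in>?X. \<one>\<^bsub>?H\<^esub>)"
      using w_eq D(1) I(1) PiE_mem[OF w_eq(3)] by (intro restrict_ext) simp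
    then show ?thesis using w_eq by (simp add: i_def star_product_simps)
  qed
  show group: "group ?W"
  proof (rule groupI)
    show "w \<otimes>\<^bsub>?W\<^esub> w' \<in> carrier ?W" if "w \<in> carrier ?W" "w' \<in> carrier ?W" for w w'
      using that D(1) by (auto simp: star_product_simps PiE_def Pi_iff)
    show "\<one>\<^bsub>?W\<^esub> \<in> carrier ?W" by (auto simp: star_product_simps)
    show "w \<otimes>\<^bsub>?W\<^esub> w' \<otimes>\<^bsub>?W\<^esub> w'' = w \<otimes>\<^bsub>?W\<^esub> (w' \<otimes>\<^bsub>?W\<^esub> w'')"
      if "w \<in> carrier ?W" "w' \<in> carrier ?W" "w'' \<in> carrier ?W" for w w' w''
      using that D(1,3)
      by (auto simp: star_product_simps PiE_def Pi_iff G.m_assoc H.m_assoc intro!: restrict_ext)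
    show "\<one>\<^bsub>?W\<^esub> \<otimes>\<^bsub>?W\<^esub> w = w" if "w \<in> carrier ?W" for w
    proof -
      obtain g f where w_eq: "w = (g, f)" "g \<in> carrier ?G" "f \<in> ?X \<rightarrow>\<^sub>E carrier ?H"
        using \<open>w \<in> carrier ?W\<close> by (auto simp: star_product_simps)
      have "(\<lambda>x\<in>?X. (\<lambda>x\<in>?X. \<one>\<^bsub>?H\<^esub>) (act A g x) \<otimes>\<^bsub>?H\<^esub> f x) = f"
        by (rule extensionalityI[of _ ?X])
          (use w_eq D(1) PiE_mem[OF w_eq(3)] in \<open>auto simp: PiE_def\<close>)
      then show ?thesis using w_eq by (simp add: star_product_simps)
    qed
    show "\<exists>v\<in>carrier ?W. v \<otimes>\<^bsub>?W\<^esub> w = \<one>\<^bsub>?W\<^esub>" if "w \<in> carrier ?W" for w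
      using i_closed i_inv that by blast
  qed
  show "inv\<^bsub>?W\<^esub> (g, f) = (inv\<^bsub>?G\<^esub> g, \<lambda>x\<in>?X. inv\<^bsub>?H\<^esub> (f (act A (inv\<^bsub>?G\<^esub> g) x)))"
    if "g \<in> carrier ?G" "f \<in> ?X \<rightarrow>\<^sub>E carrier ?H" for g f
  proof -
    have w: "(g, f) \<in> carrier ?W" using that by (simp add: star_product_simps)
    show ?thesis
      using group.inv_equality[OF group i_inv[OF w] w i_closed[OF w]] by (simp add: i_def)
  qed
qed

lemma finite_action_star_product:
  assumes A: "finite_action A" and B: "finite_action B"
  shows "finite_action (star_product A B)"
proof (rule finite_actionI)
  let ?W = "star_product A B"
  note DA = acts_onD[OF finite_actionD(2)[OF A]] and DB = acts_onD[OF finite_actionD(2)[OF B]]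
  show "group (grp ?W)" by (rule group_star_product(1)[OF A B])
  show "acts_on (grp ?W) (act ?W) (pts ?W)"
    unfolding acts_on_def
  proof (intro conjI ballI)
    fix k p assume k: "k \<in> carrier (grp ?W)" and p: "p \<in> pts ?W"
    obtain g f where w: "k = (g, f)" "g \<in> carrier (grp A)" "f \<in> pts A \<rightarrow>\<^sub>E carrier (grp B)"
      using k by (auto simp: star_product_simps)
    obtain x y where xy: "p = (x, y)" "x \<in> pts A" "y \<in> pts B"
      using p by (auto simp: star_product_simps)
    show "act ?W k p \<in> pts ?W"
      using w xy DA(1) DB(1) PiE_mem[OF w(3)] by (simp add: star_product_simps)
  next
    fix k k' p assume k: "k \<in> carrier (grp ?W)" and k': "k' \<in> carrier (grp ?W)"
      and p: "p \<in> pts ?W"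
    obtain g f where w: "k = (g, f)" "g \<in> carrier (grp A)" "f \<in> pts A \<rightarrow>\<^sub>E carrier (grp B)"
      using k by (auto simp: star_product_simps)
    obtain x y where xy: "p = (x, y)" "x \<in> pts A" "y \<in> pts B"
      using p by (auto simp: star_product_simps)
    obtain g' f' where w': "k' = (g', f')" "g' \<in> carrier (grp A)"
      "f' \<in> pts A \<rightarrow>\<^sub>E carrier (grp B)"
      using k' by (auto simp: star_product_simps)
    have "f (act A g' x) \<in> carrier (grp B)" using PiE_mem[OF w(3)] DA(1) w'(2) xy(2) by simp
    then show "act ?W (k \<otimes>\<^bsub>grp ?W\<^esub> k') p = act ?W k (act ?W k' p)"
      using w w' xy DA DB PiE_mem[OF w'(3)] by (simp add: star_product_simps)
  next
    fix p assume "p \<in> pts ?W"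
    then show "act ?W \<one>\<^bsub>grp ?W\<^esub> p = p" using DA(2) DB(2) by (auto simp: star_product_simps)
  qed
  show "act ?W k \<in> extensional (pts ?W)" for k
    by (cases k) (simp add: star_product_def)
  show "finite (carrier (grp ?W))"
    using finite_actionD[OF A] finite_actionD[OF B] by (simp add: star_product_simps finite_PiE)
  show "finite (pts ?W)"
    using finite_actionD[OF A] finite_actionD[OF B] by (simp add: star_product_simps)
qed

lemma inj_Step: "inj_on (\<lambda>(g, f). Step g f) A"
  by (auto simp: inj_on_def)

lemma inj_snoc: "inj_on (\<lambda>(ys, y). ys @ [y]) A"
  by (auto simp: inj_on_def)

lemma finite_action_star_power:
  assumes "finite_action A"
  shows "finite_action (star_power A (Suc n))"
proof (induction n)
  case 0
  have "finite_action (transport Base (\<lambda>y. [y]) A)"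
    by (rule finite_action_transport[OF assms]) (auto simp: inj_on_def)
  then show ?case by simp
next
  case (Suc n)
  have "finite_action (transport (\<lambda>(g, f). Step g f) (\<lambda>(ys, y). ys @ [y])
      (star_product (star_power A (Suc n)) A))"
    by (rule finite_action_transport[OF finite_action_star_product[OF Suc assms]
          inj_Step inj_snoc])
  then show ?case by simp
qed

section \<open>From Frattini quotients to star powers\<close>

text \<open>The image in \<open>B\<close> of the stabilizer of \<open>x\<close> under a subgroup \<open>K\<close> of the product.\<close>

definition stabilizer_image ::
    "('h \<times> 'g) set \<Rightarrow> ('g, 'x) gaction \<Rightarrow> 'x \<Rightarrow> 'h set" where
  "stabilizer_image K A x = {h. \<exists>g. (h, g) \<in> K \<and> act A g x = x}"

text \<open>A subgroup of the product covers the group of \<open>B\<close> and acts on the set of \<open>A\<close> in such a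
  way that the stabilizers whose image in \<open>B\<close> has no fixed point have a small image. If \<open>m\<close>
  is the order of the group of \<open>B\<close>, then there are no such stabilizers left.\<close>

definition partial_cover :: "('g, 'x) gaction \<Rightarrow> ('h, 'y) gaction \<Rightarrow> nat \<Rightarrow> bool" where
  "partial_cover A B m \<longleftrightarrow> (\<exists>K. subgroup K (grp B \<times>\<times> grp A) \<and> fst ` K = carrier (grp B) \<and>
     (\<forall>x\<in>pts A. subgroup_without_fixpoint B (stabilizer_image K A x) \<longrightarrow>
        card (stabilizer_image K A x) + m \<le> card (carrier (grp B))))"

lemma subgroup_stabilizer_image:
  assumes "finite_action A" "finite_action B" "subgroup K (grp B \<times>\<times> grp A)" "x \<in> pts A"
  shows "subgroup (stabilizer_image K A x) (grp B)"
  unfolding stabilizer_image_def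
  by (rule stabilizer_relation_subgroup[OF finite_actionD(1)[OF assms(2)] assms(1,3,4)])

text \<open>Take the trivial action of the group of \<open>B\<close>.\<close>

lemma partial_cover_0:
  assumes A: "finite_action A" and B: "finite_action B"
  shows "partial_cover A B 0"
proof -
  interpret G: group "grp A" using finite_actionD(1)[OF A] .
  interpret H: group "grp B" using finite_actionD(1)[OF B] .
  let ?K = "carrier (grp B) \<times> {\<one>\<^bsub>grp A\<^esub>}"
  have K: "subgroup ?K (grp B \<times>\<times> grp A)"
    by (rule DirProd_subgroups[OF H.is_group H.subgroup_self G.is_group G.triv_subgroup])
  have "card (stabilizer_image ?K A x) \<le> card (carrier (grp B))" if "x \<in> pts A" for x
    by (rule card_mono[OF finite_actionD(4)[OF B]]) (auto simp: stabilizer_image_def)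
  then show ?thesis unfolding partial_cover_def using K by (intro exI[of _ ?K]) auto
qed

lemma partial_cover_transport:
  assumes A: "finite_action A" and B: "finite_action B"
    and \<phi>: "inj_on \<phi> (carrier (grp A))" and \<xi>: "inj_on \<xi> (pts A)" and cover: "partial_cover A B m"
  shows "partial_cover (transport \<phi> \<xi> A) B m"
proof -
  let ?T = "transport \<phi> \<xi> A"
  interpret G: group "grp A" using finite_actionD(1)[OF A] .
  interpret H: group "grp B" using finite_actionD(1)[OF B] .
  note D = acts_onD[OF finite_actionD(2)[OF A]]
  obtain K where K: "subgroup K (grp B \<times>\<times> grp A)" "fst ` K = carrier (grp B)"
    and small: "\<And>x. x \<in> pts A \<Longrightarrow> subgroup_without_fixpoint B (stabilizer_image K A x) \<Longrightarrow>
        card (stabilizer_image K A x) + m \<le> card (carrier (grp B))"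
    using cover unfolding partial_cover_def by blast
  let ?p = "\<lambda>(h, g). (h, \<phi> g)"
  have "group_hom (grp B \<times>\<times> grp A) (grp B \<times>\<times> grp ?T) ?p"
    using group_copy[OF G.is_group \<phi>] H.is_group G.is_group
    by (auto simp: group_hom_def group_hom_axioms_def grp_transport DirProd_group iso_def hom_def
        mult_DirProd')
  then have sub: "subgroup (?p ` K) (grp B \<times>\<times> grp ?T)"
    by (rule group_hom.subgroup_img_is_subgroup[OF _ K(1)])
  have "stabilizer_image (?p ` K) ?T (\<xi> x) = stabilizer_image K A x" if x: "x \<in> pts A" for x
  proof -
    have "act ?T (\<phi> g) (\<xi> x) = \<xi> x \<longleftrightarrow> act A g x = x" if "(h, g) \<in> K" for h g
    proof -
      have "g \<in> carrier (grp A)" using subgroup.subset[OF K(1)] that by auto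
      then show ?thesis
        using act_transport[OF \<phi> \<xi> _ x] D(1)[OF _ x] x inj_on_eq_iff[OF \<xi>] by simp
    qed
    then show ?thesis unfolding stabilizer_image_def by fastforce
  qed
  then have "\<forall>x\<in>pts ?T. subgroup_without_fixpoint B (stabilizer_image (?p ` K) ?T x) \<longrightarrow>
      card (stabilizer_image (?p ` K) ?T x) + m \<le> card (carrier (grp B))"
    using small by (auto simp: pts_transport)
  moreover have "fst ` ?p ` K = carrier (grp B)"
    unfolding K(2)[symmetric] image_image by (rule image_cong) auto
  ultimately show ?thesis using sub unfolding partial_cover_def by blast
qed

text \<open>One more factor \<open>C\<close> makes the bad stabilizers smaller. Let \<open>rep\<close> and \<open>\<tau>\<close> be a
  transversal for the orbits. The given subgroups \<open>R\<close> relate the image in \<open>B\<close> of the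
  stabilizer of \<open>rep x\<close> to the group of \<open>C\<close>, and the new group consists of the elements whose
  component \<open>f x\<close> is related to \<open>\<tau> (g x)\<^sup>-\<^sup>1 h \<tau> x\<close>. As \<open>R\<close> need not be the graph of a
  homomorphism, the new group may be larger than the old one.\<close>

lemma partial_cover_star_product:
  assumes A: "finite_action A" and B: "finite_action B" and C: "finite_action C"
    and rel: "\<And>S. subgroup_without_fixpoint B S \<Longrightarrow>
      \<exists>R. subgroup R (grp B \<times>\<times> grp C) \<and> fst ` R = S \<and>
        (\<forall>y\<in>pts C. {h. \<exists>c. (h, c) \<in> R \<and> act C c y = y} \<noteq> S)"
    and cover: "partial_cover A B m"
  shows "partial_cover (star_product A C) B (Suc m)"
proof -
  let ?G = "grp A" and ?H = "grp B" and ?C = "grp C" and ?X = "pts A"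
  let ?W = "star_product A C"
  let ?HG = "?H \<times>\<times> ?G"
  interpret G: group ?G using finite_actionD(1)[OF A] .
  interpret H: group ?H using finite_actionD(1)[OF B] .
  interpret C: group ?C using finite_actionD(1)[OF C] .
  interpret HG: group ?HG by (rule DirProd_group[OF H.is_group G.is_group])
  note DA = acts_onD[OF finite_actionD(2)[OF A]] and DB = acts_onD[OF finite_actionD(2)[OF B]]
  obtain K where K: "subgroup K ?HG" "fst ` K = carrier ?H"
    and small: "\<And>x. x \<in> ?X \<Longrightarrow> subgroup_without_fixpoint B (stabilizer_image K A x) \<Longrightarrow>
        card (stabilizer_image K A x) + m \<le> card (carrier ?H)"
    using cover unfolding partial_cover_def by blast
  interpret K: subgroup K ?HG by (rule K(1))
  let ?S = "\<lambda>x. stabilizer_image K A x"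
  have subS: "subgroup (?S x) ?H" if "x \<in> ?X" for x
    by (rule subgroup_stabilizer_image[OF A B K(1) that])
  have K_in: "h \<in> carrier ?H \<and> g \<in> carrier ?G" if "(h, g) \<in> K" for h g
    using K.subset that by auto
  have K_mult: "(h \<otimes>\<^bsub>?H\<^esub> h', g \<otimes>\<^bsub>?G\<^esub> g') \<in> K" if "(h, g) \<in> K" "(h', g') \<in> K" for h g h' g'
    using K.m_closed[OF that] by simp
  have K_inv: "(inv\<^bsub>?H\<^esub> h, inv\<^bsub>?G\<^esub> g) \<in> K" if "(h, g) \<in> K" for h g
    using K.m_inv_closed[OF that] K_in[OF that] H.is_group G.is_group by simp
  let ?K = "?HG\<lparr>carrier := K\<rparr>"
  have gK: "group ?K" by (rule subgroup_carrier_update_group[OF HG.is_group K(1)])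
  have aK: "acts_on ?K (\<lambda>k. act A (snd k)) ?X"
    by (rule acts_on_subgroup[OF acts_on_hom[OF finite_actionD(2)[OF A] _ HG.is_group G.is_group] K(1)])
      (auto simp: hom_def mult_DirProd')
  obtain rep \<tau> where "\<And>x. x \<in> ?X \<Longrightarrow> rep x \<in> ?X" "\<And>x. x \<in> ?X \<Longrightarrow> \<tau> x \<in> carrier ?K"
    "\<And>x. x \<in> ?X \<Longrightarrow> act A (snd (\<tau> x)) (rep x) = x"
    "\<And>k x. k \<in> carrier ?K \<Longrightarrow> x \<in> ?X \<Longrightarrow> rep (act A (snd k) x) = rep x"
    "\<And>k x. k \<in> carrier ?K \<Longrightarrow> x \<in> ?X \<Longrightarrow>
      act A (snd (inv\<^bsub>?K\<^esub> (\<tau> (act A (snd k) x)) \<otimes>\<^bsub>?K\<^esub> (k \<otimes>\<^bsub>?K\<^esub> \<tau> x))) (rep x) = rep x"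
    by (rule orbit_transversal[OF gK aK]) blast
  then have rep: "\<And>x. x \<in> ?X \<Longrightarrow> rep x \<in> ?X" and \<tau>: "\<And>x. x \<in> ?X \<Longrightarrow> \<tau> x \<in> K"
    and mv: "\<And>x. x \<in> ?X \<Longrightarrow> act A (snd (\<tau> x)) (rep x) = x"
    and rep_inv: "\<And>k x. k \<in> K \<Longrightarrow> x \<in> ?X \<Longrightarrow> rep (act A (snd k) x) = rep x"
    and stab: "\<And>k x. k \<in> K \<Longrightarrow> x \<in> ?X \<Longrightarrow>
      act A (snd (inv\<^bsub>?K\<^esub> (\<tau> (act A (snd k) x)) \<otimes>\<^bsub>?HG\<^esub> (k \<otimes>\<^bsub>?HG\<^esub> \<tau> x))) (rep x) = rep x"
    by simp_all
  \<comment> \<open>\<open>c\<close> is the cocycle of the transversal, with values in the stabilizer images of the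
    representatives.\<close>
  define \<sigma> where "\<sigma> x = fst (\<tau> x)" for x
  have \<sigma>: "\<sigma> x \<in> carrier ?H" if "x \<in> ?X" for x
    using K_in[of "\<sigma> x" "snd (\<tau> x)"] \<tau>[OF that] by (simp add: \<sigma>_def)
  define c where "c h g x = inv\<^bsub>?H\<^esub> (\<sigma> (act A g x)) \<otimes>\<^bsub>?H\<^esub> (h \<otimes>\<^bsub>?H\<^esub> \<sigma> x)" for h g x
  have c_S: "c h g x \<in> ?S (rep x)" if hg: "(h, g) \<in> K" and x: "x \<in> ?X" for h g x
  proof -
    have gx: "act A g x \<in> ?X" using DA(1) K_in[OF hg] x by simp
    obtain h1 g1 where t1: "\<tau> (act A g x) = (h1, g1)" by force
    obtain h2 g2 where t2: "\<tau> x = (h2, g2)" by force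
    have k1: "(h1, g1) \<in> K" and k2: "(h2, g2) \<in> K" using \<tau>[OF gx] \<tau>[OF x] t1 t2 by simp_all
    have "inv\<^bsub>?K\<^esub> (h1, g1) = (inv\<^bsub>?H\<^esub> h1, inv\<^bsub>?G\<^esub> g1)"
      using HG.m_inv_consistent[OF K(1) k1] K_in[OF k1] H.is_group G.is_group by simp
    then have "act A (inv\<^bsub>?G\<^esub> g1 \<otimes>\<^bsub>?G\<^esub> (g \<otimes>\<^bsub>?G\<^esub> g2)) (rep x) = rep x"
      using stab[OF hg x] t1 t2 by simp
    moreover have "(inv\<^bsub>?H\<^esub> h1 \<otimes>\<^bsub>?H\<^esub> (h \<otimes>\<^bsub>?H\<^esub> h2), inv\<^bsub>?G\<^esub> g1 \<otimes>\<^bsub>?G\<^esub> (g \<otimes>\<^bsub>?G\<^esub> g2)) \<in> K"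
      by (intro K_mult K_inv k1 k2 hg)
    moreover have "c h g x = inv\<^bsub>?H\<^esub> h1 \<otimes>\<^bsub>?H\<^esub> (h \<otimes>\<^bsub>?H\<^esub> h2)" by (simp add: c_def \<sigma>_def t1 t2)
    ultimately show ?thesis unfolding stabilizer_image_def by auto
  qed
  have c_mult: "c (h \<otimes>\<^bsub>?H\<^esub> h') (g \<otimes>\<^bsub>?G\<^esub> g') x = c h g (act A g' x) \<otimes>\<^bsub>?H\<^esub> c h' g' x"
    if hg: "(h, g) \<in> K" "(h', g') \<in> K" and x: "x \<in> ?X" for h g h' g' x
  proof -
    let ?x' = "act A g' x" and ?x'' = "act A g (act A g' x)"
    have x': "?x' \<in> ?X" and x'': "?x'' \<in> ?X" using DA(1) K_in hg x by blast+
    have "\<sigma> ?x' \<otimes>\<^bsub>?H\<^esub> (inv\<^bsub>?H\<^esub> (\<sigma> ?x') \<otimes>\<^bsub>?H\<^esub> (h' \<otimes>\<^bsub>?H\<^esub> \<sigma> x)) = h' \<otimes>\<^bsub>?H\<^esub> \<sigma> x"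
      using \<sigma>[OF x'] \<sigma>[OF x] K_in[OF hg(2)] by (simp flip: H.m_assoc)
    then show ?thesis
      using \<sigma>[OF x] \<sigma>[OF x'] \<sigma>[OF x''] K_in[OF hg(1)] K_in[OF hg(2)] DA(3) x
      by (simp add: c_def H.m_assoc)
  qed
  have c_one: "c \<one>\<^bsub>?H\<^esub> \<one>\<^bsub>?G\<^esub> x = \<one>\<^bsub>?H\<^esub>" if "x \<in> ?X" for x
    using \<sigma>[OF that] DA(2)[OF that] by (simp add: c_def)
  have "\<forall>p\<in>?X. \<exists>R. subgroup R (?H \<times>\<times> ?C) \<and> fst ` R = ?S p \<and>
      (subgroup_without_fixpoint B (?S p) \<longrightarrow>
        (\<forall>y\<in>pts C. {h. \<exists>c. (h, c) \<in> R \<and> act C c y = y} \<noteq> ?S p))"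
  proof
    fix p assume p: "p \<in> ?X"
    show "\<exists>R. subgroup R (?H \<times>\<times> ?C) \<and> fst ` R = ?S p \<and>
      (subgroup_without_fixpoint B (?S p) \<longrightarrow>
        (\<forall>y\<in>pts C. {h. \<exists>c. (h, c) \<in> R \<and> act C c y = y} \<noteq> ?S p))"
    proof (cases "subgroup_without_fixpoint B (?S p)")
      case True
      from rel[OF True] show ?thesis by (rule ex_forward) simp
    next
      case False
      have "subgroup (?S p \<times> {\<one>\<^bsub>?C\<^esub>}) (?H \<times>\<times> ?C)"
        by (rule DirProd_subgroups[OF H.is_group subS[OF p] C.is_group C.triv_subgroup])
      then show ?thesis using False by (intro exI[of _ "?S p \<times> {\<one>\<^bsub>?C\<^esub>}"]) simp
    qed
  qed
  from bchoice[OF this] obtain R where R0: "\<forall>p\<in>?X. subgroup (R p) (?H \<times>\<times> ?C) \<and>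
      fst ` R p = ?S p \<and> (subgroup_without_fixpoint B (?S p) \<longrightarrow>
        (\<forall>y\<in>pts C. {h. \<exists>c. (h, c) \<in> R p \<and> act C c y = y} \<noteq> ?S p))"
    by (rule exE)
  have R: "subgroup (R p) (?H \<times>\<times> ?C)" and R_fst: "fst ` R p = ?S p" if "p \<in> ?X" for p
    using bspec[OF R0 that] by simp_all
  have R_proper: "{h. \<exists>c. (h, c) \<in> R p \<and> act C c y = y} \<noteq> ?S p"
    if "p \<in> ?X" "subgroup_without_fixpoint B (?S p)" "y \<in> pts C" for p y
    using bspec[OF R0 that(1)] that(2,3) by (elim conjE) simp
  have R_in: "h \<in> ?S p \<and> f \<in> carrier ?C" if "(h, f) \<in> R p" "p \<in> ?X" for h f p
    using subgroup.subset[OF R[OF that(2)]] R_fst[OF that(2)] that(1) by force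
  define K' where "K' = {(h, g, f). (h, g) \<in> K \<and> f \<in> ?X \<rightarrow>\<^sub>E carrier ?C \<and>
    (\<forall>x\<in>?X. (c h g x, f x) \<in> R (rep x))}"
  have K': "subgroup K' (?H \<times>\<times> grp ?W)"
  proof (rule subgroup.intro)
    show "K' \<subseteq> carrier (?H \<times>\<times> grp ?W)" using K_in by (auto simp: K'_def star_product_simps)
    show "\<one>\<^bsub>?H \<times>\<times> grp ?W\<^esub> \<in> K'"
      using K.one_closed c_one subgroup.one_closed[OF R[OF rep]]
      by (auto simp: K'_def star_product_simps)
  next
    fix u v assume "u \<in> K'" "v \<in> K'"
    then obtain h g f h' g' f' where u: "u = (h, g, f)" "(h, g) \<in> K" "f \<in> ?X \<rightarrow>\<^sub>E carrier ?C"
        "\<And>x. x \<in> ?X \<Longrightarrow> (c h g x, f x) \<in> R (rep x)"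
      and v: "v = (h', g', f')" "(h', g') \<in> K" "f' \<in> ?X \<rightarrow>\<^sub>E carrier ?C"
        "\<And>x. x \<in> ?X \<Longrightarrow> (c h' g' x, f' x) \<in> R (rep x)"
      by (auto simp: K'_def)
    have "(c (h \<otimes>\<^bsub>?H\<^esub> h') (g \<otimes>\<^bsub>?G\<^esub> g') x, f (act A g' x) \<otimes>\<^bsub>?C\<^esub> f' x) \<in> R (rep x)"
      if x: "x \<in> ?X" for x
    proof -
      have gx: "act A g' x \<in> ?X" using DA(1) K_in[OF v(2)] x by simp
      have "rep (act A g' x) = rep x" using rep_inv[OF v(2) x] by simp
      then show ?thesis
        using subgroup.m_closed[OF R[OF rep[OF x]] _ v(4)[OF x]] u(4)[OF gx]
          c_mult[OF u(2) v(2) x] by fastforce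
    qed
    moreover have "f (act A g' x) \<otimes>\<^bsub>?C\<^esub> f' x \<in> carrier ?C" if "x \<in> ?X" for x
      using PiE_mem[OF u(3)] PiE_mem[OF v(3)] DA(1) K_in[OF v(2)] that by simp
    ultimately show "u \<otimes>\<^bsub>?H \<times>\<times> grp ?W\<^esub> v \<in> K'"
      using u(1) v(1) K_mult[OF u(2) v(2)] by (auto simp: K'_def star_product_simps)
  next
    fix u assume "u \<in> K'"
    then obtain h g f where u: "u = (h, g, f)" "(h, g) \<in> K" "f \<in> ?X \<rightarrow>\<^sub>E carrier ?C"
        "\<And>x. x \<in> ?X \<Longrightarrow> (c h g x, f x) \<in> R (rep x)"
      by (auto simp: K'_def)
    have hg: "h \<in> carrier ?H" "g \<in> carrier ?G" using K_in[OF u(2)] by auto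
    have inv_u: "inv\<^bsub>?H \<times>\<times> grp ?W\<^esub> u =
        (inv\<^bsub>?H\<^esub> h, inv\<^bsub>?G\<^esub> g, \<lambda>x\<in>?X. inv\<^bsub>?C\<^esub> (f (act A (inv\<^bsub>?G\<^esub> g) x)))"
    proof -
      have w: "(g, f) \<in> carrier (grp ?W)" using hg u(3) by (simp add: star_product_simps)
      show ?thesis
        using inv_DirProd[OF H.is_group group_star_product(1)[OF A C] hg(1) w]
          group_star_product(2)[OF A C hg(2) u(3)] u(1) by simp
    qed
    have "(c (inv\<^bsub>?H\<^esub> h) (inv\<^bsub>?G\<^esub> g) x, inv\<^bsub>?C\<^esub> (f (act A (inv\<^bsub>?G\<^esub> g) x))) \<in> R (rep x)"
      if x: "x \<in> ?X" for x
    proof -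
      let ?z = "act A (inv\<^bsub>?G\<^esub> g) x"
      have z: "?z \<in> ?X" using DA(1) hg x by simp
      have rz: "rep ?z = rep x" using rep_inv[OF K_inv[OF u(2)] x] by simp
      have mem: "(c h g ?z, f ?z) \<in> R (rep x)" using u(4)[OF z] rz by simp
      have in_H: "c h g ?z \<in> carrier ?H" "c (inv\<^bsub>?H\<^esub> h) (inv\<^bsub>?G\<^esub> g) x \<in> carrier ?H"
        using c_S[OF u(2) z] c_S[OF K_inv[OF u(2)] x] rep x z
          subgroup.subset[OF subS] by blast+
      have "c h g ?z \<otimes>\<^bsub>?H\<^esub> c (inv\<^bsub>?H\<^esub> h) (inv\<^bsub>?G\<^esub> g) x = \<one>\<^bsub>?H\<^esub>"
        using c_mult[OF u(2) K_inv[OF u(2)] x] hg c_one[OF x] by simp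
      then have "c (inv\<^bsub>?H\<^esub> h) (inv\<^bsub>?G\<^esub> g) x = inv\<^bsub>?H\<^esub> (c h g ?z)"
        using in_H H.inv_equality H.inv_inv H.inv_closed by metis
      then show ?thesis
        using subgroup.m_inv_closed[OF R[OF rep[OF x]] mem]
          inv_DirProd[OF H.is_group C.is_group in_H(1), of "f ?z"] PiE_mem[OF u(3) z] by simp
    qed
    moreover have "inv\<^bsub>?C\<^esub> (f (act A (inv\<^bsub>?G\<^esub> g) x)) \<in> carrier ?C" if "x \<in> ?X" for x
      using PiE_mem[OF u(3)] DA(1) hg that by simp
    ultimately show "inv\<^bsub>?H \<times>\<times> grp ?W\<^esub> u \<in> K'"
      using K_inv[OF u(2)] unfolding inv_u by (auto simp: K'_def)
  qed
  have onto: "fst ` K' = carrier ?H"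
  proof
    show "fst ` K' \<subseteq> carrier ?H" using K_in by (auto simp: K'_def)
    show "carrier ?H \<subseteq> fst ` K'"
    proof
      fix h assume "h \<in> carrier ?H"
      then obtain g where hg: "(h, g) \<in> K" using K(2) by force
      have "\<forall>x\<in>?X. \<exists>f. (c h g x, f) \<in> R (rep x)"
      proof
        fix x assume x: "x \<in> ?X"
        then show "\<exists>f. (c h g x, f) \<in> R (rep x)"
          using c_S[OF hg x] R_fst[OF rep[OF x]] by force
      qed
      from bchoice[OF this] obtain f where f: "\<And>x. x \<in> ?X \<Longrightarrow> (c h g x, f x) \<in> R (rep x)" by blast
      have "f x \<in> carrier ?C" if "x \<in> ?X" for x
        using R_in[OF f[OF that] rep[OF that]] by blast
      then have "(h, g, restrict f ?X) \<in> K'" using hg f by (simp add: K'_def)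
      then show "h \<in> fst ` K'" by force
    qed
  qed
  have "card (stabilizer_image K' ?W (x, y)) + Suc m \<le> card (carrier ?H)"
    if x: "x \<in> ?X" and y: "y \<in> pts C"
      and bad: "subgroup_without_fixpoint B (stabilizer_image K' ?W (x, y))" for x y
  proof -
    let ?T = "stabilizer_image K' ?W (x, y)" and ?p = "rep x"
    have p: "?p \<in> ?X" by (rule rep[OF x])
    have T_S: "?T \<subseteq> ?S x"
      using x y by (auto simp: stabilizer_image_def K'_def star_product_simps)
    have badS: "subgroup_without_fixpoint B (?S x)"
      using bad subS[OF x] T_S unfolding subgroup_without_fixpoint_def by blast
    \<comment> \<open>Conjugation by \<open>\<sigma> x\<close> carries the image for \<open>x\<close> onto the one for \<open>rep x\<close>, where
      \<open>R\<close> bounds the part that fixes \<open>y\<close>.\<close>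
    let ?conj = "\<lambda>h. inv\<^bsub>?H\<^esub> (\<sigma> x) \<otimes>\<^bsub>?H\<^esub> (h \<otimes>\<^bsub>?H\<^esub> \<sigma> x)"
    have conj_eq: "?conj h = c h g x" if "act A g x = x" for h g
      using that by (simp add: c_def)
    have inj: "inj_on ?conj (carrier ?H)"
      using \<sigma>[OF x] by (auto simp: inj_on_def)
    have conj_S: "?conj ` ?S x \<subseteq> ?S ?p"
      using c_S x conj_eq by (fastforce simp: stabilizer_image_def)
    have "?S ?p \<subseteq> ?conj ` ?S x"
    proof
      fix s assume "s \<in> ?S ?p"
      then obtain g where g: "(s, g) \<in> K" "act A g ?p = ?p" by (auto simp: stabilizer_image_def)
      obtain \<gamma> where t: "\<tau> x = (\<sigma> x, \<gamma>)" "(\<sigma> x, \<gamma>) \<in> K" "\<gamma> \<in> carrier ?G" "act A \<gamma> ?p = x"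
        using \<tau>[OF x] mv[OF x] K_in by (metis \<sigma>_def prod.collapse)
      let ?h = "\<sigma> x \<otimes>\<^bsub>?H\<^esub> s \<otimes>\<^bsub>?H\<^esub> inv\<^bsub>?H\<^esub> (\<sigma> x)"
      have "(?h, \<gamma> \<otimes>\<^bsub>?G\<^esub> g \<otimes>\<^bsub>?G\<^esub> inv\<^bsub>?G\<^esub> \<gamma>) \<in> K" by (intro K_mult K_inv t(2) g(1))
      moreover have "act A (inv\<^bsub>?G\<^esub> \<gamma>) x = ?p"
        using acts_on_inv(1)[OF G.is_group finite_actionD(2)[OF A] t(3) p] t(4) by simp
      then have "act A (\<gamma> \<otimes>\<^bsub>?G\<^esub> g \<otimes>\<^bsub>?G\<^esub> inv\<^bsub>?G\<^esub> \<gamma>) x = x"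
        using DA(3) K_in[OF g(1)] t(3,4) x p g(2) by simp
      ultimately have hS: "?h \<in> ?S x" by (auto simp: stabilizer_image_def)
      have "s = ?conj ?h"
      proof -
        have "?conj ?h = (inv\<^bsub>?H\<^esub> (\<sigma> x) \<otimes>\<^bsub>?H\<^esub> \<sigma> x) \<otimes>\<^bsub>?H\<^esub> s \<otimes>\<^bsub>?H\<^esub> (inv\<^bsub>?H\<^esub> (\<sigma> x) \<otimes>\<^bsub>?H\<^esub> \<sigma> x)"
          using \<sigma>[OF x] K_in[OF g(1)] by (simp only: H.m_assoc H.m_closed H.inv_closed)
        then show ?thesis using \<sigma>[OF x] K_in[OF g(1)] by simp
      qed
      then show "s \<in> ?conj ` ?S x" using hS by (rule image_eqI)
    qed
    with conj_S have S_p: "?S ?p = ?conj ` ?S x" by blast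
    have sub: "?S x \<subseteq> carrier ?H" by (rule subgroup.subset[OF subS[OF x]])
    have "subgroup_without_fixpoint B (?S ?p)"
      unfolding subgroup_without_fixpoint_def
    proof (intro conjI notI)
      show "subgroup (?S ?p) ?H" by (rule subS[OF p])
      assume "\<exists>z\<in>pts B. \<forall>s\<in>?S ?p. act B s z = z"
      then obtain z where z: "z \<in> pts B" "\<And>s. s \<in> ?S ?p \<Longrightarrow> act B s z = z" by blast
      have "act B h (act B (\<sigma> x) z) = act B (\<sigma> x) z" if h: "h \<in> ?S x" for h
      proof -
        have hH: "h \<in> carrier ?H" using h sub by blast
        have "act B (inv\<^bsub>?H\<^esub> (\<sigma> x)) (act B h (act B (\<sigma> x) z)) = act B (?conj h) z"
          using DB(1,3) z(1) \<sigma>[OF x] hH by simp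
        also have "\<dots> = z" using z(2) h S_p by blast
        finally show ?thesis
          using acts_on_inv_eq_iff[OF H.is_group finite_actionD(2)[OF B] \<sigma>[OF x]]
            DB(1) hH \<sigma>[OF x] z(1) by simp
      qed
      then show False
        using badS DB(1)[OF \<sigma>[OF x] z(1)] unfolding subgroup_without_fixpoint_def by blast
    qed
    then have proper: "{h. \<exists>c. (h, c) \<in> R ?p \<and> act C c y = y} \<noteq> ?S ?p" (is "?U \<noteq> _")
      by (rule R_proper[OF p _ y])
    have U_sub: "?U \<subseteq> ?S ?p" using R_in[OF _ p] by blast
    have fin: "finite (?S x)" using finite_subset[OF sub finite_actionD(4)[OF B]] .
    have "?conj ` ?T \<subseteq> ?U"
    proof
      fix s assume "s \<in> ?conj ` ?T"
      then obtain h g f where h: "s = ?conj h" "(h, g, f) \<in> K'" "act ?W (g, f) (x, y) = (x, y)"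
        by (auto simp: stabilizer_image_def)
      then have gf: "act A g x = x" "act C (f x) y = y" "(c h g x, f x) \<in> R ?p"
        using x y by (auto simp: star_product_simps K'_def)
      then show "s \<in> ?U" using h(1) conj_eq[OF gf(1)] by auto
    qed
    moreover have "inj_on ?conj ?T" by (rule inj_on_subset[OF inj subset_trans[OF T_S sub]])
    moreover have finS: "finite (?S ?p)" unfolding S_p by (rule finite_imageI[OF fin])
    ultimately have "card ?T \<le> card ?U"
      using card_inj_on_le[OF _ _ finite_subset[OF U_sub]] by blast
    also have "\<dots> < card (?S ?p)"
      by (rule psubset_card_mono[OF finS psubsetI[OF U_sub proper]])
    also have "\<dots> \<le> card (?S x)" unfolding S_p by (rule card_image_le[OF fin])
    finally show ?thesis using small[OF x badS] by simp
  qed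
  then have "\<forall>q\<in>pts ?W. subgroup_without_fixpoint B (stabilizer_image K' ?W q) \<longrightarrow>
      card (stabilizer_image K' ?W q) + Suc m \<le> card (carrier ?H)"
    by (auto simp: star_product_simps)
  then show ?thesis using K' onto unfolding partial_cover_def by blast
qed

lemma partial_cover_star_power:
  assumes A: "finite_action A" and B: "finite_action B"
    and rel: "\<And>S. subgroup_without_fixpoint B S \<Longrightarrow>
      \<exists>R. subgroup R (grp B \<times>\<times> grp A) \<and> fst ` R = S \<and>
        (\<forall>y\<in>pts A. {h. \<exists>c. (h, c) \<in> R \<and> act A c y = y} \<noteq> S)"
  shows "partial_cover (star_power A (Suc m)) B m"
proof (induction m)
  case 0
  show ?case by (rule partial_cover_0[OF finite_action_star_power[OF A] B])
next
  case (Suc m)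
  have "partial_cover (star_product (star_power A (Suc m)) A) B (Suc m)"
    by (rule partial_cover_star_product[OF finite_action_star_power[OF A] B A rel Suc])
  then have "partial_cover (transport (\<lambda>(g, f). Step g f) (\<lambda>(ys, y). ys @ [y])
      (star_product (star_power A (Suc m)) A)) B (Suc m)"
    by (rule partial_cover_transport[OF
          finite_action_star_product[OF finite_action_star_power[OF A] A] B inj_Step inj_snoc])
  then show ?case by simp
qed

text \<open>A stabilizer image is nonempty, so it cannot satisfy the bound in \<^const>\<open>partial_cover\<close>
  when \<open>m\<close> is the order of the group of \<open>B\<close>. Hence all images have fixed points and an
  equivariant map exists.\<close>

lemma partial_cover_imp_elementary_implies:
  assumes A: "finite_action A" and B: "finite_action B"
    and cover: "partial_cover (star_power A (Suc n)) B (card (carrier (grp B)))"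
  shows "elementary_implies A B"
proof -
  let ?P = "star_power A (Suc n)"
  let ?H = "grp B" and ?G = "grp (star_power A (Suc n))"
  have P: "finite_action ?P" by (rule finite_action_star_power[OF A])
  interpret G: group ?G using finite_actionD(1)[OF P] .
  interpret H: group ?H using finite_actionD(1)[OF B] .
  have HG: "group (?H \<times>\<times> ?G)" by (rule DirProd_group[OF H.is_group G.is_group])
  obtain K where K: "subgroup K (?H \<times>\<times> ?G)" "fst ` K = carrier ?H"
    and small: "\<And>x. x \<in> pts ?P \<Longrightarrow> subgroup_without_fixpoint B (stabilizer_image K ?P x) \<Longrightarrow>
        card (stabilizer_image K ?P x) + card (carrier ?H) \<le> card (carrier ?H)"
    using cover unfolding partial_cover_def by blast
  let ?K = "(?H \<times>\<times> ?G)\<lparr>carrier := K\<rparr>"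
  have gK: "group ?K" by (rule subgroup_carrier_update_group[OF HG K(1)])
  have homs: "fst \<in> hom ?K ?H" "snd \<in> hom ?K ?G"
    using subgroup.subset[OF K(1)] by (auto simp: hom_def mult_DirProd')
  have a: "acts_on ?K (\<lambda>k. act ?P (snd k)) (pts ?P)"
    by (rule acts_on_hom[OF finite_actionD(2)[OF P] homs(2) gK G.is_group])
  have b: "acts_on ?K (\<lambda>k. act B (fst k)) (pts B)"
    by (rule acts_on_hom[OF finite_actionD(2)[OF B] homs(1) gK H.is_group])
  have "\<exists>y\<in>pts B. \<forall>k\<in>carrier ?K. act ?P (snd k) x = x \<longrightarrow> act B (fst k) y = y"
    if x: "x \<in> pts ?P" for x
  proof -
    have sub: "subgroup (stabilizer_image K ?P x) ?H"
      by (rule subgroup_stabilizer_image[OF P B K(1) x])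
    have "finite (stabilizer_image K ?P x)"
      using finite_subset[OF subgroup.subset[OF sub] finite_actionD(4)[OF B]] .
    then have "card (stabilizer_image K ?P x) \<noteq> 0" using subgroup.one_closed[OF sub] by auto
    then have "\<not> subgroup_without_fixpoint B (stabilizer_image K ?P x)"
      using small[OF x] by linarith
    then obtain y where y: "y \<in> pts B" "\<And>h. h \<in> stabilizer_image K ?P x \<Longrightarrow> act B h y = y"
      using sub unfolding subgroup_without_fixpoint_def by blast
    have "act B (fst k) y = y" if "k \<in> carrier ?K" "act ?P (snd k) x = x" for k
      by (rule y(2)) (use that in \<open>cases k; auto simp: stabilizer_image_def\<close>)
    then show ?thesis using y(1) by blast
  qed
  then obtain \<eta> where \<eta>: "\<And>x. x \<in> pts ?P \<Longrightarrow> \<eta> x \<in> pts B"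
    "\<And>k x. k \<in> carrier ?K \<Longrightarrow> x \<in> pts ?P \<Longrightarrow> \<eta> (act ?P (snd k) x) = act B (fst k) (\<eta> x)"
    by (rule equivariant_map_exists[OF gK a b]) blast+
  have "K \<subseteq> carrier ?H \<times> carrier ?G" using subgroup.subset[OF K(1)] by simp
  then have finK: "finite K"
    using finite_actionD(4)[OF B] finite_actionD(4)[OF P] finite_subset by blast
  obtain \<phi> :: "_ \<Rightarrow> nat" where \<phi>: "inj_on \<phi> K"
    using finite_inj_into_infinite[OF finK, where ?'b = nat] by auto
  let ?N = "group_copy \<phi> ?K"
  define \<psi> where "\<psi> = inv_into K \<phi>"
  have H0: "group ?N" and iso: "\<phi> \<in> iso ?K ?N"
    using group_copy[OF gK, of \<phi>] \<phi> by simp_all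
  have \<psi>: "\<psi> \<in> iso ?N ?K"
    using group.iso_set_sym[OF gK iso] by (simp add: \<psi>_def)
  then have \<psi>_hom: "\<psi> \<in> hom ?N ?K" and \<psi>_onto: "\<psi> ` carrier ?N = K"
    by (auto simp: iso_def bij_betw_def)
  let ?\<rho> = "snd \<circ> \<psi>" and ?\<theta> = "fst \<circ> \<psi>"
  have \<rho>: "?\<rho> \<in> hom ?N ?G" and \<theta>: "?\<theta> \<in> hom ?N ?H"
    using hom_compose[OF \<psi>_hom] homs by auto
  have \<theta>_epi: "?\<theta> \<in> epi ?N ?H"
  proof -
    have "?\<theta> ` carrier ?N = carrier ?H" unfolding image_comp[symmetric] \<psi>_onto K(2) ..
    then show ?thesis using \<theta> unfolding epi_def by blast
  qed
  let ?A' = "pullback ?N ?\<theta> B"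
  have fin: "finite (carrier ?N)" using finK by (simp add: group_copy_def Let_def)
  have A': "finite_action ?A'" by (rule finite_action_pullback[OF B H0 fin \<theta>])
  have \<psi>_in: "\<psi> k \<in> carrier ?K" if "k \<in> carrier ?N" for k
    using \<psi>_onto that by auto
  have equi: "equivariant (pullback ?N ?\<rho> ?P) ?A' \<eta>"
    using \<eta> \<psi>_in by (simp add: equivariant_def pullback_def)
  have ind: "induced_along ?\<theta> ?A' B"
    using \<theta>_epi acts_onD(2)[OF finite_actionD(2)[OF B]]
    by (simp add: induced_along_def pullback_def kernel_def)
  show ?thesis
    unfolding elementary_implies_def
    by (rule exI[of _ "Suc n"], intro conjI exI[of _ ?N] exI[of _ ?\<rho>] exI[of _ ?A'] exI[of _ \<eta>]
        exI[of _ ?\<theta>] H0 fin \<rho> A' equi ind) (simp_all add: pullback_def)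
qed

text \<open>The criterion to which all conditions reduce: each Frattini quotient of a fixed-point
  free subgroup of \<open>B\<close> maps onto one of a fixed-point free subgroup of \<open>A\<close>.\<close>

definition frattini_covers :: "('g, 'x) gaction \<Rightarrow> ('h, 'y) gaction \<Rightarrow> bool" where
  "frattini_covers A B \<longleftrightarrow> (\<forall>S. subgroup_without_fixpoint B S \<longrightarrow>
     (\<exists>T e. subgroup_without_fixpoint A T \<and>
        e \<in> epi (sub_frattini_quotient B S) (sub_frattini_quotient A T)))"

theorem frattini_covers_imp_elementary_implies:
  assumes A: "finite_action A" and B: "finite_action B" and cov: "frattini_covers A B"
  shows "elementary_implies A B"
proof (rule partial_cover_imp_elementary_implies[OF A B partial_cover_star_power[OF A B]])
  interpret H: group "grp B" using finite_actionD(1)[OF B] .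
  interpret G: group "grp A" using finite_actionD(1)[OF A] .
  fix S assume S: "subgroup_without_fixpoint B S"
  let ?S = "(grp B)\<lparr>carrier := S\<rparr>"
  have sS: "subgroup S (grp B)" using S by (simp add: subgroup_without_fixpoint_def)
  have gS: "group ?S" by (rule subgroup_carrier_update_group[OF H.is_group sS])
  obtain T e where T: "subgroup_without_fixpoint A T"
    and e: "e \<in> epi (sub_frattini_quotient B S) (sub_frattini_quotient A T)"
    using cov S unfolding frattini_covers_def by blast
  have "e \<circ> (\<lambda>s. frattini ?S #>\<^bsub>?S\<^esub> s) \<in> epi ?S (sub_frattini_quotient A T)"
    using epi_compose[OF frattini_quotient_epi[OF gS]] e by (simp add: sub_frattini_quotient_def)
  from epi_sub_frattini_quotient_relation[OF gS A T this]
  obtain R where R: "subgroup R (?S \<times>\<times> grp A)" "fst ` R = S"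
    and proper: "\<And>y. y \<in> pts A \<Longrightarrow> {h. \<exists>c. (h, c) \<in> R \<and> act A c y = y} \<noteq> S"
    by auto
  have "subgroup (S \<times> carrier (grp A)) (grp B \<times>\<times> grp A)"
    by (rule DirProd_subgroups[OF H.is_group sS G.is_group G.subgroup_self])
  then have "subgroup R (grp B \<times>\<times> grp A)"
    by (rule group.incl_subgroup[OF DirProd_group[OF H.is_group G.is_group]])
      (use R(1) in \<open>simp add: DirProd_def\<close>)
  then show "\<exists>R. subgroup R (grp B \<times>\<times> grp A) \<and> fst ` R = S \<and>
      (\<forall>y\<in>pts A. {h. \<exists>c. (h, c) \<in> R \<and> act A c y = y} \<noteq> S)"
    using R(2) proper by blast
qed

section \<open>Clones satisfy what is elementary implied\<close>

text \<open>An operation of a clone with arguments indexed by an arbitrary set \<open>Z\<close>, which need not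
  consist of indices of the clone: it maps the families of \<open>M\<close>-ary elements to \<open>M\<close>-ary
  elements and commutes with the composition from the outside.\<close>

definition generalized_operation ::
    "('n, 'c, 'r) clone_scheme \<Rightarrow> 'z set \<Rightarrow> ('n set \<Rightarrow> ('z \<Rightarrow> 'c) \<Rightarrow> 'c) \<Rightarrow> bool" where
  "generalized_operation C Z \<Phi> \<longleftrightarrow>
     (\<forall>M g. finite M \<longrightarrow> g \<in> Z \<rightarrow> elems C M \<longrightarrow> \<Phi> M g \<in> elems C M) \<and>
     (\<forall>M g g'. finite M \<longrightarrow> g \<in> Z \<rightarrow> elems C M \<longrightarrow> (\<forall>z\<in>Z. g z = g' z) \<longrightarrow> \<Phi> M g = \<Phi> M g') \<and>
     (\<forall>M L g h. finite M \<longrightarrow> finite L \<longrightarrow> g \<in> Z \<rightarrow> elems C M \<longrightarrow> h \<in> M \<rightarrow>\<^sub>E elems C L \<longrightarrow>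
        comp C M L (\<Phi> M g) h = \<Phi> L (\<lambda>z. comp C M L (g z) h))"

text \<open>The condition of an action on an arbitrary set, stated for generalized operations. For
  a finite action on indices of the clone it agrees with \<^const>\<open>satisfies\<close>.\<close>

definition generalized_satisfies ::
    "('n, 'c, 'r) clone_scheme \<Rightarrow> ('g, 'z) gaction \<Rightarrow> bool" where
  "generalized_satisfies C A \<longleftrightarrow> (\<exists>\<Phi>. generalized_operation C (pts A) \<Phi> \<and>
     (\<forall>k\<in>carrier (grp A). \<forall>M g. finite M \<longrightarrow> g \<in> pts A \<rightarrow> elems C M \<longrightarrow>
        \<Phi> M (\<lambda>z. g (act A k z)) = \<Phi> M g))"

lemma generalized_satisfiesE:
  assumes "generalized_satisfies C A"
  obtains \<Phi> where "generalized_operation C (pts A) \<Phi>"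
    "\<And>k M g. k \<in> carrier (grp A) \<Longrightarrow> finite M \<Longrightarrow> g \<in> pts A \<rightarrow> elems C M \<Longrightarrow>
      \<Phi> M (\<lambda>z. g (act A k z)) = \<Phi> M g"
proof -
  from assms[unfolded generalized_satisfies_def]
  obtain \<Phi> where \<Phi>: "generalized_operation C (pts A) \<Phi> \<and>
      (\<forall>k\<in>carrier (grp A). \<forall>M g. finite M \<longrightarrow> g \<in> pts A \<rightarrow> elems C M \<longrightarrow>
        \<Phi> M (\<lambda>z. g (act A k z)) = \<Phi> M g)"
    by (rule exE)
  show thesis
    by (rule that[OF \<Phi>[THEN conjunct1] \<Phi>[THEN conjunct2, rule_format]])
qed

lemma generalized_operationD:
  assumes "generalized_operation C Z \<Phi>" "finite M" "g \<in> Z \<rightarrow> elems C M"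
  shows "\<Phi> M g \<in> elems C M"
    and "(\<And>z. z \<in> Z \<Longrightarrow> g z = g' z) \<Longrightarrow> \<Phi> M g = \<Phi> M g'"
    and "finite L \<Longrightarrow> h \<in> M \<rightarrow>\<^sub>E elems C L \<Longrightarrow> comp C M L (\<Phi> M g) h = \<Phi> L (\<lambda>z. comp C M L (g z) h)"
proof -
  note D = assms(1)[unfolded generalized_operation_def]
  show "\<Phi> M g \<in> elems C M" by (rule D[THEN conjunct1, rule_format, OF assms(2,3)])
  show "\<Phi> M g = \<Phi> M g'" if "\<And>z. z \<in> Z \<Longrightarrow> g z = g' z"
    by (rule D[THEN conjunct2, THEN conjunct1, rule_format, OF assms(2,3) that])
  show "comp C M L (\<Phi> M g) h = \<Phi> L (\<lambda>z. comp C M L (g z) h)"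
    if "finite L" "h \<in> M \<rightarrow>\<^sub>E elems C L"
    by (rule D[THEN conjunct2, THEN conjunct2, rule_format, OF assms(2) that(1) assms(3) that(2)])
qed

lemma is_cloneD:
  assumes "is_clone C"
  shows "finite N \<Longrightarrow> i \<in> N \<Longrightarrow> proj C N i \<in> elems C N"
    and "finite N \<Longrightarrow> finite M \<Longrightarrow> f \<in> elems C N \<Longrightarrow> g \<in> N \<rightarrow>\<^sub>E elems C M \<Longrightarrow>
      comp C N M f g \<in> elems C M"
    and "finite N \<Longrightarrow> finite M \<Longrightarrow> finite L \<Longrightarrow> f \<in> elems C N \<Longrightarrow> g \<in> N \<rightarrow>\<^sub>E elems C M \<Longrightarrow>
      h \<in> M \<rightarrow>\<^sub>E elems C L \<Longrightarrow>
      comp C M L (comp C N M f g) h = comp C N L f (\<lambda>i\<in>N. comp C M L (g i) h)"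
    and "finite N \<Longrightarrow> finite M \<Longrightarrow> i \<in> N \<Longrightarrow> g \<in> N \<rightarrow>\<^sub>E elems C M \<Longrightarrow>
      comp C N M (proj C N i) g = g i"
    and "finite N \<Longrightarrow> finite M \<Longrightarrow> \<alpha> \<in> N \<rightarrow>\<^sub>E M \<Longrightarrow> f \<in> elems C N \<Longrightarrow>
      reindex C N M \<alpha> f = comp C N M f (\<lambda>i\<in>N. proj C M (\<alpha> i))"
proof -
  note D = assms[unfolded is_clone_def, THEN conjunct2]
  show "finite N \<Longrightarrow> i \<in> N \<Longrightarrow> proj C N i \<in> elems C N"
    by (rule D[THEN conjunct1, rule_format, THEN funcset_mem])
  note D = D[THEN conjunct2]
  show "finite N \<Longrightarrow> finite M \<Longrightarrow> f \<in> elems C N \<Longrightarrow> g \<in> N \<rightarrow>\<^sub>E elems C M \<Longrightarrow>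
      comp C N M f g \<in> elems C M"
    by (rule D[THEN conjunct1, rule_format])
  note D = D[THEN conjunct2]
  show "finite N \<Longrightarrow> finite M \<Longrightarrow> finite L \<Longrightarrow> f \<in> elems C N \<Longrightarrow> g \<in> N \<rightarrow>\<^sub>E elems C M \<Longrightarrow>
      h \<in> M \<rightarrow>\<^sub>E elems C L \<Longrightarrow>
      comp C M L (comp C N M f g) h = comp C N L f (\<lambda>i\<in>N. comp C M L (g i) h)"
    by (rule D[THEN conjunct1, rule_format])
  note D = D[THEN conjunct2]
  show "finite N \<Longrightarrow> finite M \<Longrightarrow> i \<in> N \<Longrightarrow> g \<in> N \<rightarrow>\<^sub>E elems C M \<Longrightarrow>
      comp C N M (proj C N i) g = g i"
    by (rule D[THEN conjunct1, rule_format])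
  note D = D[THEN conjunct2, THEN conjunct2]
  show "finite N \<Longrightarrow> finite M \<Longrightarrow> \<alpha> \<in> N \<rightarrow>\<^sub>E M \<Longrightarrow> f \<in> elems C N \<Longrightarrow>
      reindex C N M \<alpha> f = comp C N M f (\<lambda>i\<in>N. proj C M (\<alpha> i))"
    by (rule D[rule_format])
qed

lemma satisfies_imp_generalized_satisfies:
  assumes C: "is_clone C" and A: "finite_action A" and sat: "satisfies C A"
  shows "generalized_satisfies C A"
proof -
  let ?Y = "pts A"
  note fin = finite_actionD(5)[OF A] and D = acts_onD[OF finite_actionD(2)[OF A]]
  obtain f where f: "f \<in> elems C ?Y"
    and inv_f: "\<And>h. h \<in> carrier (grp A) \<Longrightarrow> reindex C ?Y ?Y (act A h) f = f"
    using sat unfolding satisfies_def by blast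
  define \<Phi> where "\<Phi> M g = comp C ?Y M f (restrict g ?Y)" for M g
  have restr: "restrict g ?Y \<in> ?Y \<rightarrow>\<^sub>E elems C M" if "g \<in> ?Y \<rightarrow> elems C M" for g M
    using that by simp
  have "generalized_operation C ?Y \<Phi>"
    unfolding generalized_operation_def
  proof (intro conjI allI impI)
    show "\<Phi> M g \<in> elems C M" if "finite M" "g \<in> ?Y \<rightarrow> elems C M" for M g
      unfolding \<Phi>_def by (rule is_cloneD(2)[OF C fin that(1) f restr[OF that(2)]])
    show "\<Phi> M g = \<Phi> M g'" if "\<forall>z\<in>?Y. g z = g' z" for M g g'
      using that by (simp add: \<Phi>_def cong: restrict_cong)
    show "comp C M L (\<Phi> M g) h = \<Phi> L (\<lambda>z. comp C M L (g z) h)"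
      if "finite M" "finite L" "g \<in> ?Y \<rightarrow> elems C M" "h \<in> M \<rightarrow>\<^sub>E elems C L" for M L g h
      unfolding \<Phi>_def is_cloneD(3)[OF C fin that(1,2) f restr[OF that(3)] that(4)]
      by (simp cong: restrict_cong)
  qed
  moreover have "\<Phi> M (\<lambda>z. g (act A k z)) = \<Phi> M g"
    if k: "k \<in> carrier (grp A)" and M: "finite M" and g: "g \<in> ?Y \<rightarrow> elems C M" for k M g
  proof -
    let ?p = "\<lambda>i\<in>?Y. proj C ?Y (act A k i)"
    have act: "act A k \<in> ?Y \<rightarrow>\<^sub>E ?Y" using finite_actionD(3)[OF A k] .
    have p: "?p \<in> ?Y \<rightarrow>\<^sub>E elems C ?Y" using is_cloneD(1)[OF C fin] D(1)[OF k] by simp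
    have "\<Phi> M g = comp C ?Y M (comp C ?Y ?Y f ?p) (restrict g ?Y)"
      using is_cloneD(5)[OF C fin fin act f] inv_f[OF k] by (simp add: \<Phi>_def)
    also have "\<dots> = comp C ?Y M f (\<lambda>i\<in>?Y. comp C ?Y M (?p i) (restrict g ?Y))"
      by (rule is_cloneD(3)[OF C fin fin M f p restr[OF g]])
    also have "(\<lambda>i\<in>?Y. comp C ?Y M (?p i) (restrict g ?Y)) = (\<lambda>i\<in>?Y. g (act A k i))"
      using is_cloneD(4)[OF C fin M _ restr[OF g]] D(1)[OF k] by (intro restrict_ext) simp
    finally show ?thesis unfolding \<Phi>_def by (rule sym)
  qed
  ultimately show ?thesis unfolding generalized_satisfies_def by blast
qed

lemma generalized_satisfies_imp_satisfies:
  assumes C: "is_clone C" and A: "finite_action A" and sat: "generalized_satisfies C A"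
  shows "satisfies C A"
proof -
  let ?Y = "pts A"
  note fin = finite_actionD(5)[OF A] and D = acts_onD[OF finite_actionD(2)[OF A]]
  obtain \<Phi> where \<Phi>: "generalized_operation C ?Y \<Phi>"
    and inv_\<Phi>: "\<And>k M g. k \<in> carrier (grp A) \<Longrightarrow> finite M \<Longrightarrow> g \<in> ?Y \<rightarrow> elems C M \<Longrightarrow>
      \<Phi> M (\<lambda>z. g (act A k z)) = \<Phi> M g"
    by (rule generalized_satisfiesE[OF sat]) (rule that)
  note \<Phi>D = generalized_operationD[OF \<Phi>]
  have p: "proj C ?Y \<in> ?Y \<rightarrow> elems C ?Y" using is_cloneD(1)[OF C fin] by simp
  let ?f = "\<Phi> ?Y (proj C ?Y)"
  have f: "?f \<in> elems C ?Y" by (rule \<Phi>D(1)[OF fin p])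
  moreover have "reindex C ?Y ?Y (act A h) ?f = ?f" if h: "h \<in> carrier (grp A)" for h
  proof -
    let ?q = "\<lambda>i\<in>?Y. proj C ?Y (act A h i)"
    have q: "?q \<in> ?Y \<rightarrow>\<^sub>E elems C ?Y" using is_cloneD(1)[OF C fin] D(1)[OF h] by simp
    have "reindex C ?Y ?Y (act A h) ?f = comp C ?Y ?Y ?f ?q"
      by (rule is_cloneD(5)[OF C fin fin finite_actionD(3)[OF A h] f])
    also have "\<dots> = \<Phi> ?Y (\<lambda>z. comp C ?Y ?Y (proj C ?Y z) ?q)" by (rule \<Phi>D(3)[OF fin p fin q])
    also have "\<dots> = \<Phi> ?Y (\<lambda>z. proj C ?Y (act A h z))"
    proof (rule \<Phi>D(2)[OF fin])
      show "comp C ?Y ?Y (proj C ?Y z) ?q = proj C ?Y (act A h z)" if "z \<in> ?Y" for z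
        using is_cloneD(4)[OF C fin fin that q] that by simp
      then show "(\<lambda>z. comp C ?Y ?Y (proj C ?Y z) ?q) \<in> ?Y \<rightarrow> elems C ?Y"
        using is_cloneD(1)[OF C fin] D(1)[OF h] by simp
    qed
    also have "\<dots> = ?f" by (rule inv_\<Phi>[OF h fin p])
    finally show ?thesis .
  qed
  ultimately show ?thesis unfolding satisfies_def by blast
qed

text \<open>The hypotheses hold if \<open>B\<close> is a copy of \<open>A\<close>, and also for the composite of the last
  three steps of an elementary implication: pulling back, an equivariant map, and passing to a
  quotient group.\<close>

lemma generalized_satisfies_map:
  assumes sat: "generalized_satisfies C A" and \<eta>: "\<And>x. x \<in> pts A \<Longrightarrow> \<eta> x \<in> pts B"
    and lift: "\<And>k. k \<in> carrier (grp B) \<Longrightarrow>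
      \<exists>l\<in>carrier (grp A). \<forall>x\<in>pts A. act B k (\<eta> x) = \<eta> (act A l x)"
    and closed: "\<And>l x. l \<in> carrier (grp A) \<Longrightarrow> x \<in> pts A \<Longrightarrow> act A l x \<in> pts A"
  shows "generalized_satisfies C B"
proof -
  obtain \<Phi> where \<Phi>: "generalized_operation C (pts A) \<Phi>"
    and inv_\<Phi>: "\<And>k M g. k \<in> carrier (grp A) \<Longrightarrow> finite M \<Longrightarrow> g \<in> pts A \<rightarrow> elems C M \<Longrightarrow>
      \<Phi> M (\<lambda>z. g (act A k z)) = \<Phi> M g"
    by (rule generalized_satisfiesE[OF sat]) (rule that)
  note \<Phi>D = generalized_operationD[OF \<Phi>]
  define \<Psi> where "\<Psi> M g = \<Phi> M (\<lambda>x. g (\<eta> x))" for M g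
  have pull: "(\<lambda>x. g (\<eta> x)) \<in> pts A \<rightarrow> elems C M" if "g \<in> pts B \<rightarrow> elems C M" for g M
    using that \<eta> by auto
  have "generalized_operation C (pts B) \<Psi>"
    unfolding generalized_operation_def
  proof (intro conjI allI impI)
    fix M g assume M: "finite M" and g: "g \<in> pts B \<rightarrow> elems C M"
    show "\<Psi> M g \<in> elems C M" unfolding \<Psi>_def by (rule \<Phi>D(1)[OF M pull[OF g]])
    show "\<Psi> M g = \<Psi> M g'" if "\<forall>z\<in>pts B. g z = g' z" for g'
      unfolding \<Psi>_def by (rule \<Phi>D(2)[OF M pull[OF g]]) (use that \<eta> in blast)
    show "comp C M L (\<Psi> M g) h = \<Psi> L (\<lambda>z. comp C M L (g z) h)"
      if "finite L" "h \<in> M \<rightarrow>\<^sub>E elems C L" for L h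
      unfolding \<Psi>_def by (rule \<Phi>D(3)[OF M pull[OF g] that])
  qed
  moreover have "\<Psi> M (\<lambda>z. g (act B k z)) = \<Psi> M g"
    if k: "k \<in> carrier (grp B)" and M: "finite M" and g: "g \<in> pts B \<rightarrow> elems C M" for k M g
  proof -
    obtain l where l: "l \<in> carrier (grp A)"
      and eq: "\<And>x. x \<in> pts A \<Longrightarrow> act B k (\<eta> x) = \<eta> (act A l x)"
      using lift[OF k] by blast
    have "\<Phi> M (\<lambda>x. g (\<eta> (act A l x))) = \<Phi> M (\<lambda>x. g (act B k (\<eta> x)))"
      by (rule \<Phi>D(2)[OF M]) (use g \<eta> closed[OF l] eq in auto)
    then show ?thesis unfolding \<Psi>_def using inv_\<Phi>[OF l M pull[OF g]] by simp
  qed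
  ultimately show ?thesis unfolding generalized_satisfies_def by blast
qed

text \<open>The operation of \<open>B\<close> is applied to each row and that of \<open>A\<close> to the results. A group
  element \<open>(g, f)\<close> permutes the rows by \<open>g\<close> and acts within them by \<open>f\<close>.\<close>

lemma generalized_satisfies_star_product:
  assumes C: "is_clone C" and A: "finite_action A" and B: "finite_action B"
    and satA: "generalized_satisfies C A" and satB: "generalized_satisfies C B"
  shows "generalized_satisfies C (star_product A B)"
proof -
  let ?W = "star_product A B"
  note DA = acts_onD[OF finite_actionD(2)[OF A]] and DB = acts_onD[OF finite_actionD(2)[OF B]]
  obtain \<Phi> where \<Phi>: "generalized_operation C (pts A) \<Phi>"
    and inv_\<Phi>: "\<And>k M g. k \<in> carrier (grp A) \<Longrightarrow> finite M \<Longrightarrow> g \<in> pts A \<rightarrow> elems C M \<Longrightarrow>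
      \<Phi> M (\<lambda>z. g (act A k z)) = \<Phi> M g"
    by (rule generalized_satisfiesE[OF satA]) (rule that)
  obtain \<Psi> where \<Psi>: "generalized_operation C (pts B) \<Psi>"
    and inv_\<Psi>: "\<And>k M g. k \<in> carrier (grp B) \<Longrightarrow> finite M \<Longrightarrow> g \<in> pts B \<rightarrow> elems C M \<Longrightarrow>
      \<Psi> M (\<lambda>z. g (act B k z)) = \<Psi> M g"
    by (rule generalized_satisfiesE[OF satB]) (rule that)
  note \<Phi>D = generalized_operationD[OF \<Phi>] and \<Psi>D = generalized_operationD[OF \<Psi>]
  define \<Theta> where "\<Theta> M g = \<Phi> M (\<lambda>x. \<Psi> M (\<lambda>y. g (x, y)))" for M and g :: "_ \<times> _ \<Rightarrow> _"
  have row: "(\<lambda>y. g (x, y)) \<in> pts B \<rightarrow> elems C M"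
    if "g \<in> pts A \<times> pts B \<rightarrow> elems C M" "x \<in> pts A" for g M x
    using that by auto
  have inner: "(\<lambda>x. \<Psi> M (\<lambda>y. g (x, y))) \<in> pts A \<rightarrow> elems C M"
    if "finite M" "g \<in> pts A \<times> pts B \<rightarrow> elems C M" for g M
    using \<Psi>D(1)[OF that(1) row[OF that(2)]] by blast
  have "generalized_operation C (pts A \<times> pts B) \<Theta>"
    unfolding generalized_operation_def
  proof (intro conjI allI impI)
    fix M g assume M: "finite M" and g: "g \<in> pts A \<times> pts B \<rightarrow> elems C M"
    show "\<Theta> M g \<in> elems C M" unfolding \<Theta>_def by (rule \<Phi>D(1)[OF M inner[OF M g]])
    show "\<Theta> M g = \<Theta> M g'" if "\<forall>z\<in>pts A \<times> pts B. g z = g' z" for g'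
      unfolding \<Theta>_def
      by (rule \<Phi>D(2)[OF M inner[OF M g] \<Psi>D(2)[OF M row[OF g]]]) (use that in auto)
    fix L h assume L: "finite L" and h: "h \<in> M \<rightarrow>\<^sub>E elems C L"
    have "comp C M L (\<Theta> M g) h = \<Phi> L (\<lambda>x. comp C M L (\<Psi> M (\<lambda>y. g (x, y))) h)"
      unfolding \<Theta>_def by (rule \<Phi>D(3)[OF M inner[OF M g] L h])
    also have "\<dots> = \<Theta> L (\<lambda>z. comp C M L (g z) h)"
      unfolding \<Theta>_def
    proof (rule \<Phi>D(2)[OF L])
      show eq: "comp C M L (\<Psi> M (\<lambda>y. g (x, y))) h = \<Psi> L (\<lambda>y. comp C M L (g (x, y)) h)"
        if "x \<in> pts A" for x
        by (rule \<Psi>D(3)[OF M row[OF g that] L h])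
      show "(\<lambda>x. comp C M L (\<Psi> M (\<lambda>y. g (x, y))) h) \<in> pts A \<rightarrow> elems C L"
        using is_cloneD(2)[OF C M L \<Psi>D(1)[OF M row[OF g]] h] by simp
    qed
    finally show "comp C M L (\<Theta> M g) h = \<Theta> L (\<lambda>z. comp C M L (g z) h)" .
  qed
  moreover have "\<Theta> M (\<lambda>z. g (act ?W k z)) = \<Theta> M g"
    if k: "k \<in> carrier (grp ?W)" and M: "finite M" and g: "g \<in> pts A \<times> pts B \<rightarrow> elems C M" for k M g
  proof -
    obtain a f where k_eq: "k = (a, f)" and a: "a \<in> carrier (grp A)"
      and f: "f \<in> pts A \<rightarrow>\<^sub>E carrier (grp B)"
      using k by (auto simp: star_product_simps)
    have g': "(\<lambda>z. g (act ?W k z)) \<in> pts A \<times> pts B \<rightarrow> elems C M"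
    proof
      fix z assume "z \<in> pts A \<times> pts B"
      then have "act ?W k z \<in> pts ?W"
        using acts_onD(1)[OF finite_actionD(2)[OF finite_action_star_product[OF A B]] k]
        by (simp add: star_product_simps)
      then show "g (act ?W k z) \<in> elems C M" using g by (auto simp: star_product_simps)
    qed
    have "\<Theta> M (\<lambda>z. g (act ?W k z)) = \<Phi> M (\<lambda>x. \<Psi> M (\<lambda>y. g (act A a x, y)))"
      unfolding \<Theta>_def
    proof (rule \<Phi>D(2)[OF M inner[OF M g']])
      fix x assume x: "x \<in> pts A"
      have ax: "act A a x \<in> pts A" using DA(1)[OF a x] .
      have "\<Psi> M (\<lambda>y. g (act ?W k (x, y))) = \<Psi> M (\<lambda>y. g (act A a x, act B (f x) y))"
        by (rule \<Psi>D(2)[OF M row[OF g' x]]) (simp add: k_eq star_product_simps x)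
      also have "\<dots> = \<Psi> M (\<lambda>y. g (act A a x, y))"
        by (rule inv_\<Psi>[OF PiE_mem[OF f x] M row[OF g ax]])
      finally show "\<Psi> M (\<lambda>y. g (act ?W k (x, y))) = \<Psi> M (\<lambda>y. g (act A a x, y))" .
    qed
    also have "\<dots> = \<Theta> M g" unfolding \<Theta>_def by (rule inv_\<Phi>[OF a M inner[OF M g]])
    finally show ?thesis .
  qed
  ultimately show ?thesis unfolding generalized_satisfies_def star_product_simps by blast
qed

lemma generalized_satisfies_transport:
  assumes A: "finite_action A" and \<phi>: "inj_on \<phi> (carrier (grp A))" and \<xi>: "inj_on \<xi> (pts A)"
    and sat: "generalized_satisfies C A"
  shows "generalized_satisfies C (transport \<phi> \<xi> A)"
proof (rule generalized_satisfies_map[OF sat])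
  show "\<xi> x \<in> pts (transport \<phi> \<xi> A)" if "x \<in> pts A" for x
    using that by (simp add: pts_transport)
  show "act A l x \<in> pts A" if "l \<in> carrier (grp A)" "x \<in> pts A" for l x
    using acts_onD(1)[OF finite_actionD(2)[OF A] that] .
  fix k assume "k \<in> carrier (grp (transport \<phi> \<xi> A))"
  then obtain l where "l \<in> carrier (grp A)" "k = \<phi> l"
    by (auto simp: grp_transport group_copy_def Let_def)
  then show "\<exists>l\<in>carrier (grp A). \<forall>x\<in>pts A. act (transport \<phi> \<xi> A) k (\<xi> x) = \<xi> (act A l x)"
    using act_transport[OF \<phi> \<xi>] by auto
qed

lemma generalized_satisfies_star_power:
  assumes C: "is_clone C" and A: "finite_action A" and sat: "generalized_satisfies C A"
  shows "generalized_satisfies C (star_power A (Suc n))"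
proof (induction n)
  case 0
  have "generalized_satisfies C (transport Base (\<lambda>y. [y]) A)"
    by (rule generalized_satisfies_transport[OF A _ _ sat]) (auto simp: inj_on_def)
  then show ?case by simp
next
  case (Suc n)
  note P = finite_action_star_power[OF A, of n]
  have "generalized_satisfies C (transport (\<lambda>(g, f). Step g f) (\<lambda>(ys, y). ys @ [y])
      (star_product (star_power A (Suc n)) A))"
    by (rule generalized_satisfies_transport[OF finite_action_star_product[OF P A] inj_Step inj_snoc
          generalized_satisfies_star_product[OF C P A Suc sat]])
  then show ?case by simp
qed

theorem elementary_implies_sound:
  fixes A :: "('h, 'y) gaction" and B :: "('k, 'y) gaction"
  assumes A: "finite_action A" and B: "finite_action B" and impl: "elementary_implies A B"
    and C: "is_clone C" and sat: "satisfies C A"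
  shows "satisfies C B"
proof -
  obtain n and N :: "nat monoid" and \<rho> and A' :: "(nat, 'y) gaction" and \<eta> \<theta> where
    n: "n \<ge> 1" and \<rho>: "\<rho> \<in> hom N (grp (star_power A n))" and A': "grp A' = N"
    and \<eta>: "equivariant (pullback N \<rho> (star_power A n)) A' \<eta>" and \<theta>: "induced_along \<theta> A' B"
    using impl unfolding elementary_implies_def by blast
  obtain m where m: "n = Suc m" using n by (cases n) auto
  note P = finite_action_star_power[OF A, of m]
  have "generalized_satisfies C (star_power A (Suc m))"
    by (rule generalized_satisfies_star_power[OF C A satisfies_imp_generalized_satisfies[OF C A sat]])
  then have "generalized_satisfies C B"
  proof (rule generalized_satisfies_map)
    show "\<eta> x \<in> pts B" if "x \<in> pts (star_power A (Suc m))" for x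
      using \<eta> \<theta> that by (auto simp: equivariant_def pullback_def induced_along_def m)
    show "act (star_power A (Suc m)) l x \<in> pts (star_power A (Suc m))"
      if "l \<in> carrier (grp (star_power A (Suc m)))" "x \<in> pts (star_power A (Suc m))" for l x
      using acts_onD(1)[OF finite_actionD(2)[OF P] that] .
    fix k assume "k \<in> carrier (grp B)"
    then obtain l where l: "l \<in> carrier N" "k = \<theta> l"
      using \<theta> A' unfolding induced_along_def epi_def by blast
    have "act B k (\<eta> x) = \<eta> (act (star_power A (Suc m)) (\<rho> l) x)"
      if "x \<in> pts (star_power A (Suc m))" for x
      using \<eta> \<theta> that l A'
      by (auto simp: equivariant_def pullback_def induced_along_def m Pi_iff)
    then show "\<exists>l\<in>carrier (grp (star_power A (Suc m))). \<forall>x\<in>pts (star_power A (Suc m)).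
        act B k (\<eta> x) = \<eta> (act (star_power A (Suc m)) l x)"
      using \<rho> l(1) m by (auto simp: hom_def)
  qed
  then show ?thesis by (rule generalized_satisfies_imp_satisfies[OF C B])
qed

section \<open>Clones of polymorphisms and their copies\<close>

text \<open>The polymorphism minion with projections and the composition of functions.\<close>

definition Pol_clone :: "('s, 'a) relstr \<Rightarrow> ('n, ('n \<Rightarrow> 'a) \<Rightarrow> 'a) clone" where
  "Pol_clone B = \<lparr>elems = elems (Pol B), reindex = reindex (Pol B),
     proj = (\<lambda>N i. \<lambda>t\<in>N \<rightarrow>\<^sub>E base B. t i),
     comp = (\<lambda>N M f g. \<lambda>t\<in>M \<rightarrow>\<^sub>E base B. f (\<lambda>i\<in>N. g i t))\<rparr>"

lemma satisfies_Pol_clone: "satisfies (Pol_clone B) A \<longleftrightarrow> satisfies (Pol B) A"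
  by (simp add: satisfies_def Pol_clone_def)

lemma homs_power_iff:
  "f \<in> homs (power_str B N) B \<longleftrightarrow> f \<in> (N \<rightarrow>\<^sub>E base B) \<rightarrow>\<^sub>E base B \<and>
    (\<forall>s\<in>symbols B. \<forall>ts. length ts = arity B s \<longrightarrow> set ts \<subseteq> N \<rightarrow>\<^sub>E base B \<longrightarrow>
      (\<forall>i\<in>N. map (\<lambda>t. t i) ts \<in> rels B s) \<longrightarrow> map f ts \<in> rels B s)"
  by (auto simp: homs_def power_str_def)

lemma Pol_comp_closed:
  assumes f: "f \<in> homs (power_str B N) B" and g: "\<And>i. i \<in> N \<Longrightarrow> g i \<in> homs (power_str B M) B"
  shows "(\<lambda>t\<in>M \<rightarrow>\<^sub>E base B. f (\<lambda>i\<in>N. g i t)) \<in> homs (power_str B M) B" (is "?c \<in> _")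
  unfolding homs_power_iff
proof (intro conjI ballI allI impI)
  have f_map: "f \<in> (N \<rightarrow>\<^sub>E base B) \<rightarrow>\<^sub>E base B" using f by (simp add: homs_power_iff)
  have g_map: "g i \<in> (M \<rightarrow>\<^sub>E base B) \<rightarrow>\<^sub>E base B" if "i \<in> N" for i
    using g[OF that] by (simp add: homs_power_iff)
  have tuple: "(\<lambda>i\<in>N. g i t) \<in> N \<rightarrow>\<^sub>E base B" if "t \<in> M \<rightarrow>\<^sub>E base B" for t
    using PiE_mem[OF g_map that] by simp
  show "?c \<in> (M \<rightarrow>\<^sub>E base B) \<rightarrow>\<^sub>E base B" using PiE_mem[OF f_map tuple] by simp
  fix s ts assume s: "s \<in> symbols B" and len: "length ts = arity B s"
    and ts: "set ts \<subseteq> M \<rightarrow>\<^sub>E base B" and rel: "\<forall>i\<in>M. map (\<lambda>t. t i) ts \<in> rels B s"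
  let ?us = "map (\<lambda>t. \<lambda>i\<in>N. g i t) ts"
  have "map f ?us \<in> rels B s"
  proof -
    have "map (\<lambda>u. u i) ?us \<in> rels B s" if i: "i \<in> N" for i
    proof -
      have "map (g i) ts \<in> rels B s"
        using g[OF i] s len ts rel unfolding homs_power_iff by blast
      moreover have "map (\<lambda>u. u i) ?us = map (g i) ts" using i by simp
      ultimately show ?thesis by (simp only:)
    qed
    moreover have "length ?us = arity B s" using len by simp
    moreover have "set ?us \<subseteq> N \<rightarrow>\<^sub>E base B"
      unfolding set_map by (rule image_subsetI, rule tuple) (use ts in blast)
    ultimately show ?thesis using f s unfolding homs_power_iff by blast
  qed
  moreover have "map ?c ts = map f ?us" using ts by (auto simp: comp_def)
  ultimately show "map ?c ts \<in> rels B s" by (simp only:)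
qed

lemma Pol_proj_closed:
  assumes "i \<in> N"
  shows "(\<lambda>t\<in>N \<rightarrow>\<^sub>E base B. t i) \<in> homs (power_str B N) B"
  unfolding homs_power_iff
proof (intro conjI ballI allI impI)
  fix s ts assume ts: "set ts \<subseteq> N \<rightarrow>\<^sub>E base B" and "\<forall>i\<in>N. map (\<lambda>t. t i) ts \<in> rels B s"
  then have "map (\<lambda>t. t i) ts \<in> rels B s" using assms by blast
  moreover have "map (\<lambda>t\<in>N \<rightarrow>\<^sub>E base B. t i) ts = map (\<lambda>t. t i) ts" using ts by auto
  ultimately show "map (\<lambda>t\<in>N \<rightarrow>\<^sub>E base B. t i) ts \<in> rels B s" by (simp only:)
qed (use assms in auto)

lemma is_clone_Pol_clone:
  fixes B :: "('s, 'a) relstr"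
  shows "is_clone (Pol_clone B :: ('n, ('n \<Rightarrow> 'a) \<Rightarrow> 'a) clone)"
proof -
  let ?H = "\<lambda>N :: 'n set. homs (power_str B N) B" and ?X = "base B"
  have map: "f \<in> (N \<rightarrow>\<^sub>E ?X) \<rightarrow>\<^sub>E ?X" if "f \<in> ?H N" for f N
    using that by (simp add: homs_power_iff)
  have simps: "elems (Pol_clone B) = ?H"
    "reindex (Pol_clone B) N M \<alpha> = (\<lambda>f. \<lambda>t\<in>M \<rightarrow>\<^sub>E ?X. f (compose N t \<alpha>))"
    "proj (Pol_clone B) N = (\<lambda>i. \<lambda>t\<in>N \<rightarrow>\<^sub>E ?X. t i)"
    "comp (Pol_clone B) N M f g = (\<lambda>t\<in>M \<rightarrow>\<^sub>E ?X. f (\<lambda>i\<in>N. g i t))" for N M \<alpha> f g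
    by (simp_all add: Pol_clone_def Pol_def)
  have ext: "(\<lambda>t\<in>N \<rightarrow>\<^sub>E ?X. f t) = f" if "f \<in> ?H N" for f N
    using map[OF that] by (simp add: PiE_def extensional_restrict)
  have reindex: "(\<lambda>t\<in>M \<rightarrow>\<^sub>E ?X. f (compose N t \<alpha>)) =
      (\<lambda>t\<in>M \<rightarrow>\<^sub>E ?X. f (\<lambda>i\<in>N. (\<lambda>i\<in>N. \<lambda>t\<in>M \<rightarrow>\<^sub>E ?X. t (\<alpha> i)) i t))" for f N M \<alpha>
    by (intro restrict_ext) (simp add: compose_def cong: restrict_cong)
  have "is_minion (Pol_clone B :: ('n, ('n \<Rightarrow> 'a) \<Rightarrow> 'a) clone)"
    unfolding is_minion_def simps
  proof (intro conjI allI impI)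
    fix N M :: "'n set" and \<alpha> assume \<alpha>: "\<alpha> \<in> N \<rightarrow>\<^sub>E M"
    show "(\<lambda>f. \<lambda>t\<in>M \<rightarrow>\<^sub>E ?X. f (compose N t \<alpha>)) \<in> ?H N \<rightarrow> ?H M"
    proof
      fix f assume f: "f \<in> ?H N"
      show "(\<lambda>t\<in>M \<rightarrow>\<^sub>E ?X. f (compose N t \<alpha>)) \<in> ?H M"
        unfolding reindex
      proof (rule Pol_comp_closed[OF f])
        fix i assume i: "i \<in> N"
        show "(\<lambda>i\<in>N. \<lambda>t\<in>M \<rightarrow>\<^sub>E ?X. t (\<alpha> i)) i \<in> ?H M"
          by (simp only: restrict_apply'[OF i] Pol_proj_closed[OF PiE_mem[OF \<alpha> i]])
      qed
    qed
  next
    fix N :: "'n set" and f assume f: "f \<in> ?H N"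
    have "compose N t (\<lambda>i\<in>N. i) = t" if "t \<in> N \<rightarrow>\<^sub>E ?X" for t
      by (rule extensionalityI[of _ N]) (use that in \<open>auto simp: PiE_def compose_def\<close>)
    then show "(\<lambda>t\<in>N \<rightarrow>\<^sub>E ?X. f (compose N t (\<lambda>i\<in>N. i))) = f"
      using ext[OF f] by (simp cong: restrict_cong)
  next
    fix N M L :: "'n set" and \<alpha> \<beta> f
    assume \<alpha>: "\<alpha> \<in> N \<rightarrow>\<^sub>E M" and \<beta>: "\<beta> \<in> M \<rightarrow>\<^sub>E L"
    have "compose N t (compose N \<beta> \<alpha>) = compose N (compose M t \<beta>) \<alpha>" for t :: "'n \<Rightarrow> 'a"
      using \<alpha> by (auto simp: compose_def fun_eq_iff)
    moreover have "compose M t \<beta> \<in> M \<rightarrow>\<^sub>E ?X" if "t \<in> L \<rightarrow>\<^sub>E ?X" for t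
      using that \<beta> by (auto simp: compose_def)
    ultimately show "(\<lambda>t\<in>L \<rightarrow>\<^sub>E ?X. f (compose N t (compose N \<beta> \<alpha>))) =
        (\<lambda>t\<in>L \<rightarrow>\<^sub>E ?X. (\<lambda>t\<in>M \<rightarrow>\<^sub>E ?X. f (compose N t \<alpha>)) (compose M t \<beta>))"
      by (intro restrict_ext) simp
  qed
  then show ?thesis
    unfolding is_clone_def simps
  proof (intro conjI allI impI)
    fix N :: "'n set"
    show "(\<lambda>i. \<lambda>t\<in>N \<rightarrow>\<^sub>E ?X. t i) \<in> N \<rightarrow> ?H N"
      by (rule funcsetI) (rule Pol_proj_closed)
  next
    fix N M :: "'n set" and f g assume f: "f \<in> ?H N" and g: "g \<in> N \<rightarrow>\<^sub>E ?H M"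
    show "(\<lambda>t\<in>M \<rightarrow>\<^sub>E ?X. f (\<lambda>i\<in>N. g i t)) \<in> ?H M"
      by (rule Pol_comp_closed[OF f PiE_mem[OF g]])
  next
    fix N M L :: "'n set" and f g h assume h: "h \<in> M \<rightarrow>\<^sub>E ?H L"
    have "(\<lambda>j\<in>M. h j t) \<in> M \<rightarrow>\<^sub>E ?X" if "t \<in> L \<rightarrow>\<^sub>E ?X" for t
      using PiE_mem[OF map[OF PiE_mem[OF h]] that] by simp
    then show "(\<lambda>t\<in>L \<rightarrow>\<^sub>E ?X. (\<lambda>t\<in>M \<rightarrow>\<^sub>E ?X. f (\<lambda>i\<in>N. g i t)) (\<lambda>i\<in>M. h i t)) =
        (\<lambda>t\<in>L \<rightarrow>\<^sub>E ?X. f (\<lambda>i\<in>N. (\<lambda>i\<in>N. \<lambda>t\<in>L \<rightarrow>\<^sub>E ?X. g i (\<lambda>j\<in>M. h j t)) i t))"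
      by (intro restrict_ext) (simp cong: restrict_cong)
  next
    fix N M :: "'n set" and i g assume i: "i \<in> N" and g: "g \<in> N \<rightarrow>\<^sub>E ?H M"
    have "(\<lambda>i\<in>N. g i t) \<in> N \<rightarrow>\<^sub>E ?X" if "t \<in> M \<rightarrow>\<^sub>E ?X" for t
      using PiE_mem[OF map[OF PiE_mem[OF g]] that] by simp
    then have "(\<lambda>t\<in>M \<rightarrow>\<^sub>E ?X. (\<lambda>t\<in>N \<rightarrow>\<^sub>E ?X. t i) (\<lambda>i\<in>N. g i t)) = (\<lambda>t\<in>M \<rightarrow>\<^sub>E ?X. g i t)"
      using i by (intro restrict_ext) simp
    then show "(\<lambda>t\<in>M \<rightarrow>\<^sub>E ?X. (\<lambda>t\<in>N \<rightarrow>\<^sub>E ?X. t i) (\<lambda>i\<in>N. g i t)) = g i"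
      using ext[OF PiE_mem[OF g i]] by simp
  next
    fix N :: "'n set" and f assume f: "f \<in> ?H N"
    have "(\<lambda>i\<in>N. (\<lambda>i\<in>N. \<lambda>t\<in>N \<rightarrow>\<^sub>E ?X. t i) i t) = t" if "t \<in> N \<rightarrow>\<^sub>E ?X" for t
      by (rule extensionalityI[of _ N]) (use that in \<open>auto simp: PiE_def\<close>)
    then show "(\<lambda>t\<in>N \<rightarrow>\<^sub>E ?X. f (\<lambda>i\<in>N. (\<lambda>i\<in>N. \<lambda>t\<in>N \<rightarrow>\<^sub>E ?X. t i) i t)) = f"
      using ext[OF f] by (simp cong: restrict_cong)
  next
    fix N M :: "'n set" and \<alpha> f
    show "(\<lambda>t\<in>M \<rightarrow>\<^sub>E ?X. f (compose N t \<alpha>)) =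
        (\<lambda>t\<in>M \<rightarrow>\<^sub>E ?X. f (\<lambda>i\<in>N. (\<lambda>i\<in>N. \<lambda>t\<in>M \<rightarrow>\<^sub>E ?X. t (\<alpha> i)) i t))"
      by (rule reindex)
  qed
qed

lemma finite_elems_Pol:
  assumes "finite N" "finite (base B)"
  shows "finite (elems (Pol_clone B) N)"
proof (rule finite_subset)
  show "elems (Pol_clone B) N \<subseteq> (N \<rightarrow>\<^sub>E base B) \<rightarrow>\<^sub>E base B"
  proof
    fix f assume "f \<in> elems (Pol_clone B) N"
    then have "f \<in> homs (power_str B N) B" by (simp add: Pol_clone_def Pol_def)
    then show "f \<in> (N \<rightarrow>\<^sub>E base B) \<rightarrow>\<^sub>E base B" by (simp add: homs_power_iff)
  qed
  show "finite ((N \<rightarrow>\<^sub>E base B) \<rightarrow>\<^sub>E base B)" using assms by (intro finite_PiE)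
qed

text \<open>Components of a clone at different index sets are unrelated as sets, so each of them can
  be copied on its own.\<close>

definition clone_copy :: "('n set \<Rightarrow> 'b \<Rightarrow> 'c) \<Rightarrow> ('n, 'b) clone \<Rightarrow> ('n, 'c) clone" where
  "clone_copy \<iota> C = (let \<kappa> = (\<lambda>N. inv_into (elems C N) (\<iota> N)) in
     \<lparr>elems = (\<lambda>N. \<iota> N ` elems C N),
      reindex = (\<lambda>N M \<alpha> f. \<iota> M (reindex C N M \<alpha> (\<kappa> N f))), proj = (\<lambda>N i. \<iota> N (proj C N i)),
      comp = (\<lambda>N M f g. \<iota> M (comp C N M (\<kappa> N f) (\<lambda>i\<in>N. \<kappa> M (g i))))\<rparr>)"

lemma is_clone_reindex_closed:
  assumes C: "is_clone C" and "finite N" "finite M" "\<alpha> \<in> N \<rightarrow>\<^sub>E M" "f \<in> elems C N"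
  shows "reindex C N M \<alpha> f \<in> elems C M"
  using C[unfolded is_clone_def, THEN conjunct1, unfolded is_minion_def, THEN conjunct1,
      rule_format, OF assms(2-4)] assms(5) by (rule funcset_mem)

lemma satisfies_clone_copy:
  assumes C: "is_clone C" and inj: "\<And>N. finite N \<Longrightarrow> inj_on (\<iota> N) (elems C N)"
    and A: "finite_action A"
  shows "satisfies (clone_copy \<iota> C) A \<longleftrightarrow> satisfies C A"
proof -
  have Y: "finite (pts A)" by (rule finite_actionD(5)[OF A])
  have "reindex (clone_copy \<iota> C) (pts A) (pts A) (act A h) (\<iota> (pts A) f) = \<iota> (pts A) f \<longleftrightarrow>
      reindex C (pts A) (pts A) (act A h) f = f"
    if "h \<in> carrier (grp A)" "f \<in> elems C (pts A)" for h f
    using is_clone_reindex_closed[OF C Y Y finite_actionD(3)[OF A that(1)] that(2)] that(2) inj[OF Y]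
    by (simp add: clone_copy_def Let_def inj_on_eq_iff[OF inj[OF Y]])
  moreover have "elems (clone_copy \<iota> C) N = \<iota> N ` elems C N" for N
    by (simp add: clone_copy_def Let_def)
  ultimately show ?thesis by (simp add: satisfies_def cong: ball_cong bex_cong)
qed

lemma is_clone_clone_copy:
  fixes C :: "('n, 'b) clone"
  assumes C: "is_clone C" and inj: "\<And>N. finite N \<Longrightarrow> inj_on (\<iota> N) (elems C N)"
  shows "is_clone (clone_copy \<iota> C)" (is "is_clone ?C")
proof -
  define \<kappa> where "\<kappa> N = inv_into (elems C N) (\<iota> N)" for N
  have \<kappa>: "\<kappa> N (\<iota> N f) = f" if "finite N" "f \<in> elems C N" for N f
    using inj[OF that(1)] that(2) by (simp add: \<kappa>_def)
  have simps: "elems ?C N = \<iota> N ` elems C N"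
    "reindex ?C N M \<alpha> = (\<lambda>f. \<iota> M (reindex C N M \<alpha> (\<kappa> N f)))"
    "proj ?C N = (\<lambda>i. \<iota> N (proj C N i))"
    "comp ?C N M f g = \<iota> M (comp C N M (\<kappa> N f) (\<lambda>i\<in>N. \<kappa> M (g i)))" for N M \<alpha> f g
    by (simp_all add: clone_copy_def \<kappa>_def)
  note reindex_closed = is_clone_reindex_closed[OF C]
  have \<kappa>_tuple: "(\<lambda>i\<in>N. \<kappa> M (g i)) \<in> N \<rightarrow>\<^sub>E elems C M"
    if "finite M" "g \<in> N \<rightarrow>\<^sub>E \<iota> M ` elems C M" for N M g
    using PiE_mem[OF that(2)] \<kappa>[OF that(1)] by fastforce
  have "is_minion ?C"
    unfolding is_minion_def simps
  proof (intro conjI allI impI)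
    fix N M :: "'n set" and \<alpha> assume "finite N" "finite M" "\<alpha> \<in> N \<rightarrow>\<^sub>E M"
    then show "(\<lambda>f. \<iota> M (reindex C N M \<alpha> (\<kappa> N f))) \<in> \<iota> N ` elems C N \<rightarrow> \<iota> M ` elems C M"
      using reindex_closed \<kappa> by auto
  next
    fix N :: "'n set" and f assume N: "finite N" and "f \<in> \<iota> N ` elems C N"
    then show "\<iota> N (reindex C N N (\<lambda>i\<in>N. i) (\<kappa> N f)) = f"
      using \<kappa> C[unfolded is_clone_def, THEN conjunct1, unfolded is_minion_def, THEN conjunct2,
          THEN conjunct1, rule_format] by auto
  next
    fix N M L :: "'n set" and \<alpha> \<beta> f
    assume fins: "finite N" "finite M" "finite L" and \<alpha>: "\<alpha> \<in> N \<rightarrow>\<^sub>E M" and \<beta>: "\<beta> \<in> M \<rightarrow>\<^sub>E L"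
      and "f \<in> \<iota> N ` elems C N"
    then obtain f0 where f0: "f0 \<in> elems C N" "f = \<iota> N f0" by auto
    show "\<iota> L (reindex C N L (compose N \<beta> \<alpha>) (\<kappa> N f)) =
        \<iota> L (reindex C M L \<beta> (\<kappa> M (\<iota> M (reindex C N M \<alpha> (\<kappa> N f)))))"
      using C[unfolded is_clone_def, THEN conjunct1, unfolded is_minion_def, THEN conjunct2,
          THEN conjunct2, rule_format, OF fins \<alpha> \<beta> f0(1)]
      by (simp add: f0 \<kappa> fins reindex_closed[OF fins(1,2) \<alpha> f0(1)])
  qed
  then show ?thesis
    unfolding is_clone_def simps
  proof (intro conjI allI impI)
    fix N :: "'n set" assume "finite N"
    then show "(\<lambda>i. \<iota> N (proj C N i)) \<in> N \<rightarrow> \<iota> N ` elems C N" using is_cloneD(1)[OF C] by simp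
  next
    fix N M :: "'n set" and f g
    assume fins: "finite N" "finite M" and f: "f \<in> \<iota> N ` elems C N"
      and g: "g \<in> N \<rightarrow>\<^sub>E \<iota> M ` elems C M"
    show "\<iota> M (comp C N M (\<kappa> N f) (\<lambda>i\<in>N. \<kappa> M (g i))) \<in> \<iota> M ` elems C M"
      using is_cloneD(2)[OF C fins _ \<kappa>_tuple[OF fins(2) g]] f \<kappa>[OF fins(1)] by auto
  next
    fix N M L :: "'n set" and f g h
    assume fins: "finite N" "finite M" "finite L" and "f \<in> \<iota> N ` elems C N"
      and g: "g \<in> N \<rightarrow>\<^sub>E \<iota> M ` elems C M" and h: "h \<in> M \<rightarrow>\<^sub>E \<iota> L ` elems C L"
    then obtain f0 where f0: "f0 \<in> elems C N" "f = \<iota> N f0" by auto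
    let ?g = "\<lambda>i\<in>N. \<kappa> M (g i)" and ?h = "\<lambda>j\<in>M. \<kappa> L (h j)"
    note g0 = \<kappa>_tuple[OF fins(2) g] and h0 = \<kappa>_tuple[OF fins(3) h]
    have gi: "\<kappa> L (\<iota> L (comp C M L (\<kappa> M (g i)) ?h)) = comp C M L (?g i) ?h" if "i \<in> N" for i
      using \<kappa>[OF fins(3) is_cloneD(2)[OF C fins(2,3) PiE_mem[OF g0 that] h0]] that by simp
    have "\<iota> L (comp C M L (\<kappa> M (\<iota> M (comp C N M (\<kappa> N f) ?g))) ?h) =
        \<iota> L (comp C M L (comp C N M f0 ?g) ?h)"
      by (simp add: f0 \<kappa> fins is_cloneD(2)[OF C fins(1,2) f0(1) g0])
    also have "\<dots> = \<iota> L (comp C N L f0 (\<lambda>i\<in>N. comp C M L (?g i) ?h))"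
      using is_cloneD(3)[OF C fins f0(1) g0 h0] by simp
    also have "(\<lambda>i\<in>N. comp C M L (?g i) ?h) =
        (\<lambda>i\<in>N. \<kappa> L ((\<lambda>i\<in>N. \<iota> L (comp C M L (\<kappa> M (g i)) ?h)) i))"
      using gi by (intro restrict_ext) simp
    finally show "\<iota> L (comp C M L (\<kappa> M (\<iota> M (comp C N M (\<kappa> N f) ?g))) ?h) =
        \<iota> L (comp C N L (\<kappa> N f) (\<lambda>i\<in>N. \<kappa> L ((\<lambda>i\<in>N. \<iota> L (comp C M L (\<kappa> M (g i)) ?h)) i)))"
      unfolding f0(2) \<kappa>[OF fins(1) f0(1)] .
  next
    fix N M :: "'n set" and i g
    assume fins: "finite N" "finite M" and i: "i \<in> N" and g: "g \<in> N \<rightarrow>\<^sub>E \<iota> M ` elems C M"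
    obtain x where x: "x \<in> elems C M" "g i = \<iota> M x" using PiE_mem[OF g i] by auto
    show "\<iota> M (comp C N M (\<kappa> N (\<iota> N (proj C N i))) (\<lambda>i\<in>N. \<kappa> M (g i))) = g i"
      using is_cloneD(4)[OF C fins i \<kappa>_tuple[OF fins(2) g]] i x
      by (simp add: \<kappa> fins is_cloneD(1)[OF C fins(1) i])
  next
    fix N :: "'n set" and f assume N: "finite N" and "f \<in> \<iota> N ` elems C N"
    then obtain f0 where f0: "f0 \<in> elems C N" "f = \<iota> N f0" by auto
    have "(\<lambda>i\<in>N. \<kappa> N ((\<lambda>i\<in>N. \<iota> N (proj C N i)) i)) = (\<lambda>i\<in>N. proj C N i)"
      using \<kappa>[OF N is_cloneD(1)[OF C N]] by (intro restrict_ext) simp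
    then show "\<iota> N (comp C N N (\<kappa> N f) (\<lambda>i\<in>N. \<kappa> N ((\<lambda>i\<in>N. \<iota> N (proj C N i)) i))) = f"
      using C[unfolded is_clone_def, THEN conjunct2, THEN conjunct2, THEN conjunct2,
          THEN conjunct2, THEN conjunct2, THEN conjunct1, rule_format, OF N f0(1)]
      by (simp add: f0 \<kappa> N)
  next
    fix N M :: "'n set" and \<alpha> f
    assume fins: "finite N" "finite M" and \<alpha>: "\<alpha> \<in> N \<rightarrow>\<^sub>E M" and "f \<in> \<iota> N ` elems C N"
    then obtain f0 where f0: "f0 \<in> elems C N" "f = \<iota> N f0" by auto
    have "(\<lambda>i\<in>N. \<kappa> M ((\<lambda>i\<in>N. \<iota> M (proj C M (\<alpha> i))) i)) = (\<lambda>i\<in>N. proj C M (\<alpha> i))"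
      using \<kappa>[OF fins(2) is_cloneD(1)[OF C fins(2)]] PiE_mem[OF \<alpha>] by (intro restrict_ext) simp
    then show "\<iota> M (reindex C N M \<alpha> (\<kappa> N f)) =
        \<iota> M (comp C N M (\<kappa> N f) (\<lambda>i\<in>N. \<kappa> M ((\<lambda>i\<in>N. \<iota> M (proj C M (\<alpha> i))) i)))"
      using is_cloneD(5)[OF C fins \<alpha> f0(1)] by (simp add: f0 \<kappa> fins)
  qed
qed

section \<open>The equivalences\<close>

lemma is_relstr_action_str:
  assumes "finite_action A"
  shows "is_relstr (action_str A)"
  using acts_onD(1)[OF finite_actionD(2)[OF assms]] by (auto simp: is_relstr_def action_str_def)

text \<open>If the criterion fails at \<open>S\<close>, then any copy of the Frattini quotient of \<open>S\<close>
  separates the two conditions.\<close>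

lemma not_frattini_covers_imp_separating_group:
  assumes A: "finite_action A" and B: "finite_action B" and ncov: "\<not> frattini_covers A B"
    and inf: "infinite (UNIV :: 'k set)"
  obtains K :: "'k monoid" where "group K" "finite (carrier K)" "frattini K = {\<one>\<^bsub>K\<^esub>}"
    "satisfies (Pol (action_str (primitive_sum K))) A"
    "\<not> satisfies (Pol (action_str (primitive_sum K))) B"
proof -
  obtain S where S: "subgroup_without_fixpoint B S"
    and none: "\<And>T e. subgroup_without_fixpoint A T \<Longrightarrow>
      e \<notin> epi (sub_frattini_quotient B S) (sub_frattini_quotient A T)"
    using ncov unfolding frattini_covers_def by blast
  let ?S = "(grp B)\<lparr>carrier := S\<rparr>" and ?Q = "sub_frattini_quotient B S"
  let ?c = "\<lambda>s. frattini ?S #>\<^bsub>?S\<^esub> s"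
  have sS: "subgroup S (grp B)" using S by (simp add: subgroup_without_fixpoint_def)
  have gS: "group ?S" by (rule subgroup_carrier_update_group[OF finite_actionD(1)[OF B] sS])
  have Q_eq: "?Q = frattini_quotient ?S" by (simp add: sub_frattini_quotient_def)
  have Q: "group ?Q" by (rule group_sub_frattini_quotient[OF B S])
  have finQ: "finite (carrier ?Q)" by (rule finite_sub_frattini_quotient[OF B S])
  obtain \<phi> :: "_ \<Rightarrow> 'k" where \<phi>: "inj_on \<phi> (carrier ?Q)"
    by (rule finite_inj_into_infinite[OF finQ inf])
  define K where "K = group_copy \<phi> ?Q"
  have iso: "\<phi> \<in> iso ?Q K" and gK: "group K" using group_copy[OF Q \<phi>] by (simp_all add: K_def)
  have finK: "finite (carrier K)" using finQ by (simp add: K_def group_copy_def Let_def)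
  have c: "?c \<in> epi ?S ?Q" unfolding Q_eq by (rule frattini_quotient_epi[OF gS])
  have \<phi>_epi: "\<phi> \<in> epi ?Q K" using iso by (simp add: iso_iff_mon_epi)
  have \<phi>_one: "\<phi> x = \<one>\<^bsub>K\<^esub> \<longleftrightarrow> x = \<one>\<^bsub>?Q\<^esub>" if "x \<in> carrier ?Q" for x
    using inj_on_eq_iff[OF \<phi> that monoid.one_closed[OF group.is_monoid[OF Q]]]
    by (simp add: K_def group_copy_def Let_def)
  have c_in: "?c s \<in> carrier ?Q" if "s \<in> carrier ?S" for s
    using c that unfolding epi_def by blast
  have "kernel ?S K (\<phi> \<circ> ?c) = kernel ?S ?Q ?c"
    unfolding kernel_def using \<phi>_one[OF c_in] by auto
  then have "kernel ?S K (\<phi> \<circ> ?c) = frattini ?S"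
    unfolding Q_eq by (simp only: frattini_quotient_kernel[OF gS])
  then have fratt: "frattini K = {\<one>\<^bsub>K\<^esub>}"
    by (rule frattini_epi_image_trivial[OF gS gK epi_compose[OF c \<phi>_epi]])
  have "inv_into (carrier ?Q) \<phi> \<in> epi K ?Q"
    using group.iso_set_sym[OF Q iso] by (simp add: iso_iff_mon_epi)
  then have "\<not> satisfies (Pol (action_str (primitive_sum K))) B"
    unfolding satisfies_primitive_sum_iff[OF gK finK B] using S by blast
  moreover have "satisfies (Pol (action_str (primitive_sum K))) A"
    unfolding satisfies_primitive_sum_iff[OF gK finK A]
    using none epi_compose[OF \<phi>_epi] by blast
  ultimately show thesis using that[OF gK finK fratt] by blast
qed

lemma not_frattini_covers_imp_separating_action:
  assumes A: "finite_action A" and B: "finite_action B" and ncov: "\<not> frattini_covers A B"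
    and inf: "infinite (UNIV :: 'k set)" "infinite (UNIV :: 'x set)"
  obtains D :: "('k, 'x) gaction" where "finite_action D" "satisfies (Pol (action_str D)) A"
    "\<not> satisfies (Pol (action_str D)) B"
proof -
  obtain K :: "'k monoid" where K: "group K" "finite (carrier K)"
    and sep: "satisfies (Pol (action_str (primitive_sum K))) A"
      "\<not> satisfies (Pol (action_str (primitive_sum K))) B"
    by (rule not_frattini_covers_imp_separating_group[OF A B ncov inf(1)])
  let ?P = "primitive_sum K"
  note P = finite_action_primitive_sum[OF K]
  obtain \<xi> :: "_ \<Rightarrow> 'x" where \<xi>: "inj_on \<xi> (pts ?P)"
    by (rule finite_inj_into_infinite[OF finite_actionD(5)[OF P] inf(2)])
  have id: "inj_on id (carrier (grp ?P))" by simp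
  show thesis
    by (rule that[OF finite_action_transport[OF P id \<xi>]])
      (use sep in \<open>simp_all only: satisfies_Pol_transport[OF P A id \<xi>]
        satisfies_Pol_transport[OF P B id \<xi>] not_False_eq_True\<close>)
qed

lemma elementary_implies_Pol:
  fixes A :: "('h, 'y) gaction" and B :: "('k, 'y) gaction"
  assumes "finite_action A" "finite_action B" "elementary_implies A B" "satisfies (Pol R) A"
  shows "satisfies (Pol R) B"
  using elementary_implies_sound[OF assms(1-3) is_clone_Pol_clone[of R]] assms(4)
  by (simp add: satisfies_Pol_clone)

theorem theorem6p2:
  fixes A1 :: "('h1, 'y) gaction" and A2 :: "('h2, 'y) gaction"
  assumes "finite_action A1" and "finite_action A2"
    and "infinite (UNIV :: 'y set)"
    and "infinite (UNIV :: 'c set)"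
    and "infinite (UNIV :: 's set)" and "infinite (UNIV :: 'a set)"
    and "infinite (UNIV :: 'g set)" and "infinite (UNIV :: 'x set)"
  shows
    "(elementary_implies A1 A2 \<longleftrightarrow>
       (\<forall>C :: ('y, 'c) clone. is_clone C \<longrightarrow> satisfies C A1 \<longrightarrow> satisfies C A2)) \<and>
     (elementary_implies A1 A2 \<longleftrightarrow>
       (\<forall>B :: ('s, 'a) relstr. is_relstr B \<longrightarrow>
          satisfies (Pol B) A1 \<longrightarrow> satisfies (Pol B) A2)) \<and>
     (elementary_implies A1 A2 \<longleftrightarrow>
       (\<forall>B :: ('s, 'a) relstr. is_relstr B \<longrightarrow> finite (base B) \<longrightarrow>
          satisfies (Pol B) A1 \<longrightarrow> satisfies (Pol B) A2)) \<and>
     (elementary_implies A1 A2 \<longleftrightarrow>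
       (\<forall>A :: ('g, 'x) gaction. finite_action A \<longrightarrow>
          satisfies (Pol (action_str A)) A1 \<longrightarrow> satisfies (Pol (action_str A)) A2)) \<and>
     (elementary_implies A1 A2 \<longleftrightarrow>
       (\<forall>G :: 'g monoid. group G \<longrightarrow> finite (carrier G) \<longrightarrow> frattini G = {\<one>\<^bsub>G\<^esub>} \<longrightarrow>
          satisfies (Pol (action_str (primitive_sum G))) A1 \<longrightarrow>
          satisfies (Pol (action_str (primitive_sum G))) A2)) \<and>
     (elementary_implies A1 A2 \<longleftrightarrow>
       (\<forall>K :: 'g monoid. chi A2 K \<longrightarrow>
          (\<exists>(L :: 'g monoid) e. chi A1 L \<and> e \<in> epi K L)))"
proof -
  note A1 = \<open>finite_action A1\<close> and A2 = \<open>finite_action A2\<close>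
  let ?E = "elementary_implies A1 A2"
  have cov: "?E" if "frattini_covers A1 A2"
    by (rule frattini_covers_imp_elementary_implies[OF A1 A2 that])
  note Pol = elementary_implies_Pol[OF A1 A2]
  have "?E \<longleftrightarrow> (\<forall>C :: ('y, 'c) clone. is_clone C \<longrightarrow> satisfies C A1 \<longrightarrow> satisfies C A2)"
  proof (intro iffI allI impI)
    show "satisfies C A2" if "?E" "is_clone C" "satisfies C A1" for C :: "('y, 'c) clone"
      by (rule elementary_implies_sound[OF A1 A2 that])
    assume impl: "\<forall>C :: ('y, 'c) clone. is_clone C \<longrightarrow> satisfies C A1 \<longrightarrow> satisfies C A2"
    show ?E
    proof (rule cov, rule ccontr)
      assume "\<not> frattini_covers A1 A2"
      then obtain D :: "('g, 'x) gaction" where D: "finite_action D"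
        and sep: "satisfies (Pol (action_str D)) A1" "\<not> satisfies (Pol (action_str D)) A2"
        by (rule not_frattini_covers_imp_separating_action[OF A1 A2 _ assms(7,8)])
      let ?C = "Pol_clone (action_str D) :: ('y, ('y \<Rightarrow> 'x) \<Rightarrow> 'x) clone"
      have fin: "finite (elems ?C N)" if "finite N" for N
        by (rule finite_elems_Pol[OF that])
          (use finite_actionD(5)[OF D] in \<open>simp add: action_str_def\<close>)
      have "\<forall>N. \<exists>\<iota> :: (('y \<Rightarrow> 'x) \<Rightarrow> 'x) \<Rightarrow> 'c. finite N \<longrightarrow> inj_on \<iota> (elems ?C N)"
        using finite_inj_into_infinite[OF fin assms(4)] by metis
      from choice[OF this] obtain \<iota> :: "'y set \<Rightarrow> (('y \<Rightarrow> 'x) \<Rightarrow> 'x) \<Rightarrow> 'c"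
        where inj: "\<And>N. finite N \<Longrightarrow> inj_on (\<iota> N) (elems ?C N)" by blast
      note copy = is_clone_clone_copy[OF is_clone_Pol_clone inj]
        satisfies_clone_copy[OF is_clone_Pol_clone inj A1]
        satisfies_clone_copy[OF is_clone_Pol_clone inj A2]
      show False using impl copy sep unfolding satisfies_Pol_clone by blast
    qed
  qed
  moreover have "?E \<longleftrightarrow> (\<forall>B :: ('s, 'a) relstr. is_relstr B \<longrightarrow>
      satisfies (Pol B) A1 \<longrightarrow> satisfies (Pol B) A2)" (is "_ \<longleftrightarrow> ?str")
    and "?E \<longleftrightarrow> (\<forall>B :: ('s, 'a) relstr. is_relstr B \<longrightarrow> finite (base B) \<longrightarrow>
      satisfies (Pol B) A1 \<longrightarrow> satisfies (Pol B) A2)" (is "_ \<longleftrightarrow> ?fin")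
  proof -
    have "?E" if ?fin
    proof (rule cov, rule ccontr)
      assume "\<not> frattini_covers A1 A2"
      then obtain D :: "('s, 'a) gaction" where D: "finite_action D"
        and sep: "satisfies (Pol (action_str D)) A1" "\<not> satisfies (Pol (action_str D)) A2"
        by (rule not_frattini_covers_imp_separating_action[OF A1 A2 _ assms(5,6)])
      have "finite (base (action_str D))" using finite_actionD(5)[OF D] by (simp add: action_str_def)
      then show False using \<open>?fin\<close> is_relstr_action_str[OF D] sep by blast
    qed
    then show "?E \<longleftrightarrow> ?str" "?E \<longleftrightarrow> ?fin" using Pol by blast+
  qed
  moreover have "?E \<longleftrightarrow> (\<forall>A :: ('g, 'x) gaction. finite_action A \<longrightarrow>
      satisfies (Pol (action_str A)) A1 \<longrightarrow> satisfies (Pol (action_str A)) A2)" (is "_ \<longleftrightarrow> ?act")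
  proof -
    have "?E" if ?act
    proof (rule cov, rule ccontr)
      assume "\<not> frattini_covers A1 A2"
      then obtain D :: "('g, 'x) gaction" where "finite_action D"
        "satisfies (Pol (action_str D)) A1" "\<not> satisfies (Pol (action_str D)) A2"
        by (rule not_frattini_covers_imp_separating_action[OF A1 A2 _ assms(7,8)])
      then show False using \<open>?act\<close> by blast
    qed
    then show ?thesis using Pol by blast
  qed
  moreover have "?E \<longleftrightarrow> (\<forall>G :: 'g monoid. group G \<longrightarrow> finite (carrier G) \<longrightarrow>
      frattini G = {\<one>\<^bsub>G\<^esub>} \<longrightarrow> satisfies (Pol (action_str (primitive_sum G))) A1 \<longrightarrow>
      satisfies (Pol (action_str (primitive_sum G))) A2)" (is "_ \<longleftrightarrow> ?prim")
    and "?E \<longleftrightarrow> (\<forall>K :: 'g monoid. chi A2 K \<longrightarrow> (\<exists>(L :: 'g monoid) e. chi A1 L \<and> e \<in> epi K L))"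
      (is "_ \<longleftrightarrow> ?chi")
  proof -
    have prim: "?E" if ?prim
    proof (rule cov, rule ccontr)
      assume "\<not> frattini_covers A1 A2"
      then obtain K :: "'g monoid" where "group K" "finite (carrier K)" "frattini K = {\<one>\<^bsub>K\<^esub>}"
        "satisfies (Pol (action_str (primitive_sum K))) A1"
        "\<not> satisfies (Pol (action_str (primitive_sum K))) A2"
        by (rule not_frattini_covers_imp_separating_group[OF A1 A2 _ assms(7)])
      then show False using \<open>?prim\<close> by blast
    qed
    then show E_prim: "?E \<longleftrightarrow> ?prim" using Pol by blast
    have "?prim" if ?chi
    proof (intro allI impI)
      fix G :: "'g monoid"
      assume G: "group G" "finite (carrier G)" "frattini G = {\<one>\<^bsub>G\<^esub>}"
        and sat: "satisfies (Pol (action_str (primitive_sum G))) A1"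
      show "satisfies (Pol (action_str (primitive_sum G))) A2"
      proof (rule ccontr)
        assume "\<not> satisfies (Pol (action_str (primitive_sum G))) A2"
        then have "chi A2 G" using chi_iff_not_satisfies[OF A2 G] by blast
        then obtain L :: "'g monoid" and e where "chi A1 L" "e \<in> epi G L"
          using \<open>?chi\<close> by blast
        then have "chi A1 G" using G epi_compose unfolding chi_iff[OF A1] by blast
        then show False using chi_iff_not_satisfies[OF A1 G] sat by blast
      qed
    qed
    moreover have "?chi" if ?prim
    proof (intro allI impI)
      fix K :: "'g monoid" assume K: "chi A2 K"
      then have gK: "group K" "finite (carrier K)" "frattini K = {\<one>\<^bsub>K\<^esub>}"
        unfolding chi_def by blast+
      then have "chi A1 K"
        using K \<open>?prim\<close> chi_iff_not_satisfies[OF A1 gK] chi_iff_not_satisfies[OF A2 gK] by blast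
      moreover have "(\<lambda>x. x) \<in> epi K K" by (auto simp: epi_def hom_def)
      ultimately show "\<exists>(L :: 'g monoid) e. chi A1 L \<and> e \<in> epi K L" by blast
    qed
    ultimately show "?E \<longleftrightarrow> ?chi" using E_prim by blast
  qed
  ultimately show ?thesis by blast
qed

end
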